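(* Let $S$ be a set of abstract vector variables and $x\in S$. Let $\Omega_x^{\mathrm{mon}}$ be the central multiplicative set generated by all determinants $D^Y_k$, where $Y$ ranges over the finite subsets of $S\setminus\{x\}$ and $k\ge0$. Then $$R_{\mathbb B}(S)_{\Omega_x^{\mathrm{mon}}}=\ker\Bigl(\partial^{\mathrm R}_{x,q}:R_{\mathbb B}(S)_{\Omega_x^{\mathrm{mon}}}\to R_{\mathbb B}(S)_{\Omega_x^{\mathrm{mon}}}\Bigr)\oplus R_x\,R_{\mathbb B}(S)_{\Omega_x^{\mathrm{mon}}},$$ where $R_xF=Fx$; equivalently, the second summand is $R_{\mathbb B}(S)_{\Omega_x^{\mathrm{mon}}}\,x$.
   Context: **Radial algebra.** For a set $S$ of abstract vector variables, $R(S)$ is the associative unital $\mathbb R$-algebra generated by $S$ subject to $[\{u,v\},w]=0$ for all $u,v,w\in S$, where $\{a,b\}=ab+ba$, $[a,b]=ab-ba$. The wedge is the antisymmetrized product $u_1\wedge\cdots\wedge u_p=\frac1{p!}\sum_{\pi}\operatorname{sgn}(\pi)u_{\pi(1)}\cdots u_{\pi(p)}$ (empty wedge $=1$). **Coefficients.** $q,Q$ are algebraically independent indeterminates, $\mathbb B=\mathbb R[q,q^{-1},Q,(1-q)^{-1}]$, $R_{\mathbb B}(S)=\mathbb B\otimes_{\mathbb R}R(S)$. For integers $n,a$: $[n]_q=\frac{1-q^n}{1-q}$, $q^{m+a}:=Qq^a$, $[m+a]_q:=\frac{1-Qq^a}{1-q}$ ($m$ is only a formal symbol). For a multiplicative set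 $\Omega$ of central elements, $\mathcal M_\Omega=\Omega^{-1}\mathcal M$. **Scalars.** For finite $Y=\{y_1,\dots,y_N\}\subset S\setminus\{x\}$: $r=x^2$, $s_i=\{x,y_i\}$, $c_{ij}=\{y_i,y_j\}=c_{ji}$ are central and $\mathcal A_x(Y)=\mathbb B[r,s_1,\dots,s_N,c_{ij}:1\le i\le j\le N]$ is a polynomial algebra. For $I=\{i_1<\cdots<i_p\}\subset\{1,\dots,N\}$, $y_I=y_{i_1}\wedge\cdots\wedge y_{i_p}$, $y_\varnothing=1$. It is known that $R_{\mathbb B}(\{x\}\cup Y)=\bigoplus_I y_I\mathcal A_x(Y)\oplus\bigoplus_I(x\wedge y_I)\mathcal A_x(Y)$, free over $\mathcal A_x(Y)$ on the elements $y_I,\ x\wedge y_I$. **Jackson operators.** For a scalar variable $u$ and parameter $P$: $\delta^{(u)}_Pf=\frac{f(u)-f(Pu)}{(1-P)u}$, $T^{(u)}_Pf(u)=f(Pu)$. For $A\in\mathcal A_x(Y)$, $$\partial^{\mathrm{sc},Y}_{x,q}A=(1+q)\,x\,\delta^{(r)}_{q^2}A+2\sum_{i=1}^N y_i\,T^{(r)}_{q^2}\delta^{(s_i)}_qA.$$ **Right $q$-vector derivatives.** $\partial^{Y,\mathrm R}_{x,q}$ is the $\mathbb B$-linear operator on $R_{\mathbb B}(\{x\}\cup Y)$ with, for $p=|I|$ and $A,B\in\mathcal A_x(Y)$, $$\partial^{Y,\mathrm R}_{x,q}(y_IA)=y_I\,\partial^{\mathrm{sc},Y}_{x,q}(A),\qquad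 \partial^{Y,\mathrm R}_{x,q}((x\wedge y_I)B)=(-1)^p[m-p]_q\,y_IB+q^{m-p}(x\wedge y_I)\,\partial^{\mathrm{sc},Y}_{x,q}(B).$$ These are compatible under $Y\subset Z$ and define $\partial^{\mathrm R}_{x,q}$ on $R_{\mathbb B}(S)$, restricting to $\partial^{Y,\mathrm R}_{x,q}$ on each $R_{\mathbb B}(\{x\}\cup Y)$. It is linear over all central elements generated by $\mathbb B$ and the anticommutators $\{y,y'\}$, $y,y'\in S\setminus\{x\}$, and so extends to the localization. **Determinants.** The $x$-degree is $\deg_xr=2$, $\deg_xs_i=1$, $\deg_xc_{ij}=0$, $\deg_xy_I=0$, $\deg_x(x\wedge y_I)=1$. $\mathbb T_Y=\mathbb B[c_{ij}:1\le i\le j\le N]$. $H^Y_n$ is the degree-$n$ component of $R_{\mathbb B}(\{x\}\cup Y)$, a finite free $\mathbb T_Y$-module with basis $y_Ir^as^\beta$ ($2a+|\beta|=n$) and $(x\wedge y_I)r^as^\beta$ ($1+2a+|\beta|=n$). $\mathcal K^Y_k:=\partial^{Y,\mathrm R}_{x,q}R_x|_{H^Y_k}:H^Y_k\to H^Y_k$ is $\mathbb T_Y$-linear and $D^Y_k:=\det\mathcal K^Y_k\in\mathbb T_Y$. *)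

theory Defs
  imports
    "HOL-Analysis.Analysis"
    "HOL-Library.Poly_Mapping"
    "HOL-Library.FuncSet"
    "HOL-Computational_Algebra.Fraction_Field"
    "HOL-Algebra.AbelCoset"
    "Jordan_Normal_Form.Determinant"
begin

section \<open>Ideals, commutators and centres in noncommutative rings\<close>

definition commutator :: "'a::ring \<Rightarrow> 'a \<Rightarrow> 'a" where
  "commutator a b = a * b - b * a"

definition anticommutator :: "'a::ring \<Rightarrow> 'a \<Rightarrow> 'a" where
  "anticommutator a b = a * b + b * a"

inductive_set two_sided_ideal :: "'a::ring_1 set \<Rightarrow> 'a set" for G :: "'a set" where
  gen: "g \<in> G \<Longrightarrow> g \<in> two_sided_ideal G"
| zero: "0 \<in> two_sided_ideal G"
| add: "a \<in> two_sided_ideal G \<Longrightarrow> b \<in> two_sided_ideal G \<Longrightarrow> a + b \<in> two_sided_ideal G"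
| left: "a \<in> two_sided_ideal G \<Longrightarrow> r * a \<in> two_sided_ideal G"
| right: "a \<in> two_sided_ideal G \<Longrightarrow> a * r \<in> two_sided_ideal G"

lemma two_sided_ideal_minus:
  "a \<in> two_sided_ideal G \<Longrightarrow> - a \<in> two_sided_ideal G"
  using two_sided_ideal.left[of a G "-1"] by simp

lemma two_sided_ideal_diff:
  "a \<in> two_sided_ideal G \<Longrightarrow> b \<in> two_sided_ideal G \<Longrightarrow> a - b \<in> two_sided_ideal G"
  using two_sided_ideal.add[OF _ two_sided_ideal_minus, of a G b] by simp

definition ideal_cong :: "'a::ring_1 set \<Rightarrow> 'a \<Rightarrow> 'a \<Rightarrow> bool" where
  "ideal_cong G a b \<longleftrightarrow> a - b \<in> two_sided_ideal G"

lemma equivp_ideal_cong: "equivp (ideal_cong G)"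
proof (rule equivpI)
  show "reflp (ideal_cong G)"
    by (auto intro!: reflpI simp: ideal_cong_def two_sided_ideal.zero)
  show "symp (ideal_cong G)"
  proof (rule sympI)
    fix a b assume "ideal_cong G a b"
    then show "ideal_cong G b a"
      using two_sided_ideal_minus[of "a - b" G] by (simp add: ideal_cong_def)
  qed
  show "transp (ideal_cong G)"
  proof (rule transpI)
    fix a b c assume "ideal_cong G a b" "ideal_cong G b c"
    then show "ideal_cong G a c"
      using two_sided_ideal.add[of "a - b" G "b - c"] by (simp add: ideal_cong_def)
  qed
qed

lemma ideal_cong_add:
  assumes "ideal_cong G a a'" "ideal_cong G b b'"
  shows "ideal_cong G (a + b) (a' + b')"
proof -
  have "a + b - (a' + b') = (a - a') + (b - b')" by simp
  with assms show ?thesis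
    unfolding ideal_cong_def by (simp only: two_sided_ideal.add)
qed

lemma ideal_cong_minus: "ideal_cong G a a' \<Longrightarrow> ideal_cong G (- a) (- a')"
  using two_sided_ideal_minus[of "a - a'" G] by (simp add: ideal_cong_def)

lemma ideal_cong_diff:
  assumes "ideal_cong G a a'" "ideal_cong G b b'"
  shows "ideal_cong G (a - b) (a' - b')"
  using ideal_cong_add[OF assms(1) ideal_cong_minus[OF assms(2)]] by simp

lemma ideal_cong_mult:
  assumes "ideal_cong G a a'" "ideal_cong G b b'"
  shows "ideal_cong G (a * b) (a' * b')"
proof -
  have "a * b - a' * b' = (a - a') * b + a' * (b - b')" by (simp add: algebra_simps)
  with assms show ?thesis
    unfolding ideal_cong_def
    by (simp only: two_sided_ideal.add two_sided_ideal.left two_sided_ideal.right)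
qed

text \<open>The centre as a commutative ring type, so that library determinants apply to matrices
  with central entries.\<close>

typedef (overloaded) 'a central = "{z::'a::ring_1. \<forall>w. z * w = w * z}"
  morphisms of_central to_central
  by (rule exI[of _ 0]) simp

setup_lifting type_definition_central

instantiation central :: (ring_1) comm_ring_1
begin
lift_definition zero_central :: "'a central" is 0 by simp
lift_definition one_central :: "'a central" is 1 by simp
lift_definition plus_central :: "'a central \<Rightarrow> 'a central \<Rightarrow> 'a central" is "(+)"
  by (simp add: algebra_simps)
lift_definition minus_central :: "'a central \<Rightarrow> 'a central \<Rightarrow> 'a central" is "(-)"
  by (simp add: algebra_simps)
lift_definition uminus_central :: "'a central \<Rightarrow> 'a central" is uminus
  by simp
lift_definition times_central :: "'a central \<Rightarrow> 'a central \<Rightarrow> 'a central" is "(*)"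
  by (metis mult.assoc)
instance
proof
  fix a b c :: "'a central"
  show "a * b * c = a * (b * c)" by transfer (rule mult.assoc)
  show "a * b = b * a" by transfer blast
  show "1 * a = a" by transfer simp
  show "a + b + c = a + (b + c)" by transfer (rule add.assoc)
  show "a + b = b + a" by transfer (rule add.commute)
  show "0 + a = a" by transfer simp
  show "- a + a = 0" by transfer simp
  show "a - b = a + - b" by transfer simp
  show "(a + b) * c = a * c + b * c" by transfer (rule distrib_right)
  show "(0 :: 'a central) \<noteq> 1" by transfer simp
qed
end


section \<open>The radial algebra\<close>

text \<open>Words in the variables, written additively so that the functions \<open>'v word_monoid \<Rightarrow>\<^sub>0 real\<close>
  with the convolution product form the free associative real algebra on \<^typ>\<open>'v\<close>.\<close>

datatype 'v word_monoid = Wd "'v list"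

instantiation word_monoid :: (type) monoid_add
begin
definition zero_word_monoid :: "'a word_monoid" where "zero_word_monoid = Wd []"
fun plus_word_monoid :: "'a word_monoid \<Rightarrow> 'a word_monoid \<Rightarrow> 'a word_monoid" where
  "plus_word_monoid (Wd us) (Wd vs) = Wd (us @ vs)"
instance
proof
  fix a b c :: "'a word_monoid"
  show "a + b + c = a + (b + c)" by (cases a; cases b; cases c) simp
  show "0 + a = a" by (cases a) (simp add: zero_word_monoid_def)
  show "a + 0 = a" by (cases a) (simp add: zero_word_monoid_def)
qed
end

type_synonym 'v free_algebra = "'v word_monoid \<Rightarrow>\<^sub>0 real"

definition free_var :: "'v \<Rightarrow> 'v free_algebra" where
  "free_var v = Poly_Mapping.single (Wd [v]) 1"

definition radial_relations :: "'v free_algebra set" where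
  "radial_relations =
     {commutator (anticommutator (free_var u) (free_var v)) (free_var w) | u v w. True}"

text \<open>\<open>'v radial\<close> is \<open>R(S)\<close> where the set \<open>S\<close> of abstract vector variables is the type
  \<^typ>\<open>'v\<close>.\<close>

quotient_type 'v radial = "'v free_algebra" / "ideal_cong radial_relations"
  by (rule equivp_ideal_cong)

lemma poly_mapping_sum_induct [case_names single sum]:
  assumes single: "\<And>k v. P (Poly_Mapping.single k v)"
    and sum: "\<And>f g. P f \<Longrightarrow> P g \<Longrightarrow> P (f + g)"
  shows "P (f :: 'k \<Rightarrow>\<^sub>0 'c::monoid_add)"
proof (induction f rule: update_induct)
  case const
  show ?case using single[of undefined 0] by simp
next
  case (update f a b)
  then have "Poly_Mapping.update a b f = Poly_Mapping.single a b + f"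
    by (intro poly_mapping_eqI)
       (auto simp: lookup_add lookup_single lookup_update in_keys_iff when_def)
  with single sum update show ?case by simp
qed

lemma single_zero_central:
  fixes f :: "'v free_algebra"
  shows "Poly_Mapping.single 0 c * f = f * Poly_Mapping.single 0 c"
proof (induction f rule: poly_mapping_sum_induct)
  case (single k v)
  then show ?case by (simp add: mult_single mult.commute)
next
  case (sum f g)
  then show ?case by (simp add: algebra_simps)
qed

lemma lookup_zero_times:
  fixes f g :: "'v free_algebra"
  shows "Poly_Mapping.lookup (f * g) 0 = Poly_Mapping.lookup f 0 * Poly_Mapping.lookup g 0"
proof (induction f rule: poly_mapping_sum_induct)
  case (single k v)
  show ?case
  proof (induction g rule: poly_mapping_sum_induct)
    case (single k' v')
    have "k + k' = 0 \<longleftrightarrow> k = 0 \<and> k' = 0"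
      by (cases k; cases k') (auto simp: zero_word_monoid_def)
    then show ?case by (auto simp: mult_single lookup_single when_def)
  next
    case (sum f g)
    then show ?case by (simp add: algebra_simps lookup_add)
  qed
next
  case (sum f' g')
  then show ?case by (simp add: algebra_simps lookup_add)
qed

lemma radial_ideal_constant_term:
  "f \<in> two_sided_ideal (radial_relations :: 'v free_algebra set) \<Longrightarrow> Poly_Mapping.lookup f 0 = 0"
  by (induction rule: two_sided_ideal.induct)
     (auto simp: radial_relations_def commutator_def lookup_minus lookup_add lookup_zero_times)

instantiation radial :: (type) real_algebra_1
begin
lift_definition zero_radial :: "'a radial" is 0 .
lift_definition one_radial :: "'a radial" is 1 .
lift_definition plus_radial :: "'a radial \<Rightarrow> 'a radial \<Rightarrow> 'a radial" is "(+)"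
  by (rule ideal_cong_add)
lift_definition minus_radial :: "'a radial \<Rightarrow> 'a radial \<Rightarrow> 'a radial" is "(-)"
  by (rule ideal_cong_diff)
lift_definition uminus_radial :: "'a radial \<Rightarrow> 'a radial" is uminus
  by (rule ideal_cong_minus)
lift_definition times_radial :: "'a radial \<Rightarrow> 'a radial \<Rightarrow> 'a radial" is "(*)"
  by (rule ideal_cong_mult)
lift_definition scaleR_radial :: "real \<Rightarrow> 'a radial \<Rightarrow> 'a radial" is
  "\<lambda>c f. Poly_Mapping.single 0 c * f"
  by (rule ideal_cong_mult) (simp_all add: ideal_cong_def two_sided_ideal.zero)
instance
proof
  have refl: "f = g \<Longrightarrow> ideal_cong radial_relations f g" for f g :: "'a free_algebra"
    by (simp add: ideal_cong_def two_sided_ideal.zero)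
  fix a b c :: "'a radial" and s t :: real
  show "a + b + c = a + (b + c)" by transfer (rule refl, simp add: algebra_simps)
  show "a + b = b + a" by transfer (rule refl, simp add: algebra_simps)
  show "0 + a = a" by transfer (rule refl, simp)
  show "- a + a = 0" by transfer (rule refl, simp)
  show "a - b = a + - b" by transfer (rule refl, simp)
  show "a * b * c = a * (b * c)" by transfer (rule refl, simp add: algebra_simps)
  show "(a + b) * c = a * c + b * c" by transfer (rule refl, simp add: algebra_simps)
  show "a * (b + c) = a * b + a * c" by transfer (rule refl, simp add: algebra_simps)
  show "1 * a = a" by transfer (rule refl, simp)
  show "a * 1 = a" by transfer (rule refl, simp)
  show "(0 :: 'a radial) \<noteq> 1"
  proof transfer
    show "\<not> ideal_cong radial_relations (0 :: 'a free_algebra) 1"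
      using radial_ideal_constant_term[of "- 1 :: 'a free_algebra"]
      by (auto simp: ideal_cong_def lookup_one)
  qed
  show "s *\<^sub>R (a + b) = s *\<^sub>R a + s *\<^sub>R b"
    by transfer (rule refl, simp add: algebra_simps)
  show "(s + t) *\<^sub>R a = s *\<^sub>R a + t *\<^sub>R a"
    by transfer (rule refl, simp add: algebra_simps single_add)
  show "s *\<^sub>R t *\<^sub>R a = (s * t) *\<^sub>R a"
    by transfer (rule refl, simp add: mult.assoc[symmetric] mult_single)
  show "1 *\<^sub>R a = a"
    by transfer (rule refl, simp)
  show "s *\<^sub>R a * b = s *\<^sub>R (a * b)"
    by transfer (rule refl, simp add: mult.assoc)
  show "a * s *\<^sub>R b = s *\<^sub>R (a * b)"
    by transfer (rule refl, metis mult.assoc single_zero_central)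
qed
end

lift_definition radial_var :: "'v \<Rightarrow> 'v radial" is free_var .

definition wedge :: "'v list \<Rightarrow> 'v radial" where
  "wedge us = (1 / fact (length us)) *\<^sub>R
     (\<Sum>\<pi> | \<pi> permutes {..<length us}.
        of_int (sign \<pi>) * prod_list (map (\<lambda>i. radial_var (us ! \<pi> i)) [0..<length us]))"


section \<open>The coefficient ring\<close>

definition q_frac :: "real poly poly fract" where
  "q_frac = Fraction_Field.Fract [:[:0, 1:]:] 1"

definition Q_frac :: "real poly poly fract" where
  "Q_frac = Fraction_Field.Fract [:0, 1:] 1"

definition const_frac :: "real \<Rightarrow> real poly poly fract" where
  "const_frac c = Fraction_Field.Fract [:[:c:]:] 1"

text \<open>The subring \<open>\<real>[q, q\<inverse>, Q, (1-q)\<inverse>]\<close> of the field of fractions of \<open>\<real>[q][Q]\<close>.\<close>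

inductive_set coeff_subring :: "real poly poly fract set" where
  const: "const_frac c \<in> coeff_subring"
| q: "q_frac \<in> coeff_subring"
| q_inv: "inverse q_frac \<in> coeff_subring"
| Q: "Q_frac \<in> coeff_subring"
| one_minus_q_inv: "inverse (1 - q_frac) \<in> coeff_subring"
| add: "a \<in> coeff_subring \<Longrightarrow> b \<in> coeff_subring \<Longrightarrow> a + b \<in> coeff_subring"
| mult: "a \<in> coeff_subring \<Longrightarrow> b \<in> coeff_subring \<Longrightarrow> a * b \<in> coeff_subring"

lemma const_frac_simps:
  "const_frac 0 = 0" "const_frac 1 = 1" "const_frac (-1) = -1"
  "const_frac (c + d) = const_frac c + const_frac d"
  "const_frac (c * d) = const_frac c * const_frac d"
  by (simp_all add: const_frac_def Zero_fract_def One_fract_def one_pCons)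

lemma coeff_subring_simps:
  "0 \<in> coeff_subring" "1 \<in> coeff_subring"
  "a \<in> coeff_subring \<Longrightarrow> - a \<in> coeff_subring"
  "a \<in> coeff_subring \<Longrightarrow> b \<in> coeff_subring \<Longrightarrow> a - b \<in> coeff_subring"
proof -
  show zero: "0 \<in> coeff_subring" and one: "1 \<in> coeff_subring"
    using coeff_subring.const[of 0] coeff_subring.const[of 1] by (simp_all add: const_frac_simps)
  show um: "- a \<in> coeff_subring" if "a \<in> coeff_subring" for a
    using coeff_subring.mult[OF coeff_subring.const[of "-1"] that] by (simp add: const_frac_simps)
  show "a - b \<in> coeff_subring" if "a \<in> coeff_subring" "b \<in> coeff_subring"
    using coeff_subring.add[OF that(1) um[OF that(2)]] by simp
qed

typedef coeff = coeff_subring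
  using coeff_subring.Q by blast

setup_lifting type_definition_coeff

instantiation coeff :: "{idom, real_algebra_1}"
begin
lift_definition zero_coeff :: coeff is 0 by (rule coeff_subring_simps)
lift_definition one_coeff :: coeff is 1 by (rule coeff_subring_simps)
lift_definition plus_coeff :: "coeff \<Rightarrow> coeff \<Rightarrow> coeff" is "(+)" by (rule coeff_subring.add)
lift_definition minus_coeff :: "coeff \<Rightarrow> coeff \<Rightarrow> coeff" is "(-)" by (rule coeff_subring_simps)
lift_definition uminus_coeff :: "coeff \<Rightarrow> coeff" is uminus by (rule coeff_subring_simps)
lift_definition times_coeff :: "coeff \<Rightarrow> coeff \<Rightarrow> coeff" is "(*)" by (rule coeff_subring.mult)
lift_definition scaleR_coeff :: "real \<Rightarrow> coeff \<Rightarrow> coeff" is "\<lambda>c a. const_frac c * a"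
  by (rule coeff_subring.mult[OF coeff_subring.const])
instance
proof
  fix a b c :: coeff and s t :: real
  show "a * b * c = a * (b * c)" by transfer (rule mult.assoc)
  show "a * b = b * a" by transfer (rule mult.commute)
  show "1 * a = a" by transfer simp
  show "a + b + c = a + (b + c)" by transfer (rule add.assoc)
  show "a + b = b + a" by transfer (rule add.commute)
  show "0 + a = a" by transfer simp
  show "- a + a = 0" by transfer simp
  show "a - b = a + - b" by transfer simp
  show "(a + b) * c = a * c + b * c" by transfer (rule distrib_right)
  show "a * (b + c) = a * b + a * c" by transfer (rule distrib_left)
  show "a * 1 = a" by transfer simp
  show "0 * a = 0" by transfer simp
  show "a * 0 = 0" by transfer simp
  show "(0 :: coeff) \<noteq> 1" by transfer simp
  show "a \<noteq> 0 \<Longrightarrow> b \<noteq> 0 \<Longrightarrow> a * b \<noteq> 0" by transfer simp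
  show "s *\<^sub>R (a + b) = s *\<^sub>R a + s *\<^sub>R b" by transfer (rule distrib_left)
  show "(s + t) *\<^sub>R a = s *\<^sub>R a + t *\<^sub>R a"
    by transfer (simp only: const_frac_simps distrib_right)
  show "s *\<^sub>R t *\<^sub>R a = (s * t) *\<^sub>R a"
    by transfer (simp only: const_frac_simps mult.assoc)
  show "1 *\<^sub>R a = a" by transfer (simp add: const_frac_simps)
  show "s *\<^sub>R a * b = s *\<^sub>R (a * b)" by transfer (rule mult.assoc)
  show "a * s *\<^sub>R b = s *\<^sub>R (a * b)" by transfer (rule mult.left_commute)
qed
end

lift_definition q_ind :: coeff is q_frac by (rule coeff_subring.q)
lift_definition q_inv :: coeff is "inverse q_frac" by (rule coeff_subring.q_inv)
lift_definition Q_ind :: coeff is Q_frac by (rule coeff_subring.Q)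
lift_definition one_minus_q_inv :: coeff is "inverse (1 - q_frac)"
  by (rule coeff_subring.one_minus_q_inv)

definition q_pow :: "int \<Rightarrow> coeff" where
  "q_pow a = (if 0 \<le> a then q_ind ^ nat a else q_inv ^ nat (- a))"

text \<open>\<open>q_m_pow a\<close> is \<open>q\<close> to the formal exponent \<open>m+a\<close>, and \<open>q_m_number a\<close> is the
  \<open>q\<close>-number of \<open>m+a\<close>.\<close>

definition q_m_pow :: "int \<Rightarrow> coeff" where
  "q_m_pow a = Q_ind * q_pow a"

definition q_m_number :: "int \<Rightarrow> coeff" where
  "q_m_number a = (1 - Q_ind * q_pow a) * one_minus_q_inv"


section \<open>Extension of scalars\<close>

text \<open>The tensor product over the reals of two real algebras: the integral monoid ring of the
  multiplicative monoid \<open>A \<times> B\<close> modulo the bilinearity relations. The additive span of these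
  relations is stable under multiplication by pairs, so passing to the ideal adds nothing and
  the underlying group is the usual tensor product.\<close>

datatype ('a, 'b) pair_monoid = Pr 'a 'b

instantiation pair_monoid :: (monoid_mult, monoid_mult) monoid_add
begin
definition zero_pair_monoid :: "('a, 'b) pair_monoid" where "zero_pair_monoid = Pr 1 1"
fun plus_pair_monoid :: "('a, 'b) pair_monoid \<Rightarrow> ('a, 'b) pair_monoid \<Rightarrow> ('a, 'b) pair_monoid"
  where "plus_pair_monoid (Pr a b) (Pr a' b') = Pr (a * a') (b * b')"
instance
proof
  fix a b c :: "('a, 'b) pair_monoid"
  show "a + b + c = a + (b + c)" by (cases a; cases b; cases c) (simp add: mult.assoc)
  show "0 + a = a" by (cases a) (simp add: zero_pair_monoid_def)
  show "a + 0 = a" by (cases a) (simp add: zero_pair_monoid_def)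
qed
end

type_synonym ('a, 'b) pair_ring = "('a, 'b) pair_monoid \<Rightarrow>\<^sub>0 int"

definition pair_gen :: "'a \<Rightarrow> 'b \<Rightarrow> ('a, 'b) pair_ring" where
  "pair_gen a b = Poly_Mapping.single (Pr a b) 1"

definition tensor_relations :: "('a::real_algebra_1, 'b::real_algebra_1) pair_ring set" where
  "tensor_relations =
     {pair_gen (a + a') b - pair_gen a b - pair_gen a' b | a a' b. True} \<union>
     {pair_gen a (b + b') - pair_gen a b - pair_gen a b' | a b b'. True} \<union>
     {pair_gen (c *\<^sub>R a) b - pair_gen a (c *\<^sub>R b) | a b c. True}"

quotient_type (overloaded) ('a, 'b) tensor =
    "('a::real_algebra_1, 'b::real_algebra_1) pair_ring" / "ideal_cong tensor_relations"
  by (rule equivp_ideal_cong)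

lift_definition tens :: "'a::real_algebra_1 \<Rightarrow> 'b::real_algebra_1 \<Rightarrow> ('a, 'b) tensor" is pair_gen .

text \<open>The tensor product is nonzero, as is needed for it to be an instance of \<^class>\<open>ring_1\<close>.\<close>

lemma linear_functional_one:
  "\<exists>\<phi> :: 'a::real_algebra_1 \<Rightarrow> real. linear \<phi> \<and> \<phi> 1 = 1"
  using real_vector.dependent_single[of "1::'a"]
    linear_independent_extend[of "{1::'a}" "\<lambda>_. 1 :: real"] by auto

definition pair_eval :: "('a \<Rightarrow> 'b \<Rightarrow> real) \<Rightarrow> ('a, 'b) pair_ring \<Rightarrow> real" where
  "pair_eval \<beta> f = (\<Sum>k\<in>Poly_Mapping.keys f.
     of_int (Poly_Mapping.lookup f k) * (case k of Pr a b \<Rightarrow> \<beta> a b))"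

lemma pair_eval_superset:
  assumes "finite A" "Poly_Mapping.keys f \<subseteq> A"
  shows "pair_eval \<beta> f = (\<Sum>k\<in>A.
     of_int (Poly_Mapping.lookup f k) * (case k of Pr a b \<Rightarrow> \<beta> a b))"
  unfolding pair_eval_def
  by (rule sum.mono_neutral_left) (use assms in \<open>auto simp: in_keys_iff\<close>)

lemma pair_eval_add: "pair_eval \<beta> (f + g) = pair_eval \<beta> f + pair_eval \<beta> g"
proof -
  let ?A = "Poly_Mapping.keys f \<union> Poly_Mapping.keys g"
  have "Poly_Mapping.keys (f + g) \<subseteq> ?A" by (rule keys_add)
  then show ?thesis
    by (simp add: pair_eval_superset[of ?A] lookup_add algebra_simps sum.distrib)
qed

lemma pair_eval_minus: "pair_eval \<beta> (- f) = - pair_eval \<beta> f"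
  by (simp add: pair_eval_def sum_negf)

lemma pair_eval_diff: "pair_eval \<beta> (f - g) = pair_eval \<beta> f - pair_eval \<beta> g"
  using pair_eval_add[of \<beta> f "- g"] by (simp add: pair_eval_minus)

lemma pair_eval_single: "pair_eval \<beta> (Poly_Mapping.single (Pr a b) n) = of_int n * \<beta> a b"
  by (simp add: pair_eval_def)

lemma pair_eval_ideal:
  fixes f :: "('a::real_algebra_1, 'b::real_algebra_1) pair_ring"
  assumes lin: "linear \<phi>" "linear \<psi>"
    and f: "f \<in> two_sided_ideal tensor_relations"
  shows "pair_eval (\<lambda>a b. \<phi> a * \<psi> b) (g * f * h) = 0"
  using f
proof (induction arbitrary: g h rule: two_sided_ideal.induct)
  case (gen r)
  show ?case
  proof (induction g rule: poly_mapping_sum_induct)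
    case (single k n)
    obtain a0 b0 where k: "k = Pr a0 b0" by (cases k)
    show ?case
    proof (induction h rule: poly_mapping_sum_induct)
      case (single k' n')
      obtain a1 b1 where k': "k' = Pr a1 b1" by (cases k')
      note [simp] = linear_add[OF lin(1)] linear_add[OF lin(2)]
        linear_scale[OF lin(1)] linear_scale[OF lin(2)]
      from gen show ?case
        unfolding tensor_relations_def pair_gen_def k k'
        by (elim UnE CollectE exE conjE)
           (simp_all add: mult_single distrib_left distrib_right left_diff_distrib
             right_diff_distrib pair_eval_diff pair_eval_single)
    next
      case (sum f g)
      then show ?case by (simp add: algebra_simps pair_eval_add)
    qed
  next
    case (sum f g)
    then show ?case by (simp add: algebra_simps pair_eval_add)
  qed
next
  case zero
  then show ?case by (simp add: pair_eval_def)
next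
  case (add a b)
  then show ?case by (simp add: algebra_simps pair_eval_add)
next
  case (left a r)
  from left.IH[of "g * r" h] show ?case by (simp add: mult.assoc)
next
  case (right a r)
  from right.IH[of g "r * h"] show ?case by (simp add: mult.assoc)
qed

instantiation tensor :: (real_algebra_1, real_algebra_1) ring_1
begin
lift_definition zero_tensor :: "('a, 'b) tensor" is 0 .
lift_definition one_tensor :: "('a, 'b) tensor" is 1 .
lift_definition plus_tensor :: "('a, 'b) tensor \<Rightarrow> ('a, 'b) tensor \<Rightarrow> ('a, 'b) tensor" is "(+)"
  by (rule ideal_cong_add)
lift_definition minus_tensor :: "('a, 'b) tensor \<Rightarrow> ('a, 'b) tensor \<Rightarrow> ('a, 'b) tensor" is "(-)"
  by (rule ideal_cong_diff)
lift_definition uminus_tensor :: "('a, 'b) tensor \<Rightarrow> ('a, 'b) tensor" is uminus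
  by (rule ideal_cong_minus)
lift_definition times_tensor :: "('a, 'b) tensor \<Rightarrow> ('a, 'b) tensor \<Rightarrow> ('a, 'b) tensor" is "(*)"
  by (rule ideal_cong_mult)
instance
proof
  have refl: "f = g \<Longrightarrow> ideal_cong tensor_relations f g" for f g :: "('a, 'b) pair_ring"
    by (simp add: ideal_cong_def two_sided_ideal.zero)
  fix a b c :: "('a, 'b) tensor"
  show "a + b + c = a + (b + c)" by transfer (rule refl, simp add: algebra_simps)
  show "a + b = b + a" by transfer (rule refl, simp add: algebra_simps)
  show "0 + a = a" by transfer (rule refl, simp)
  show "- a + a = 0" by transfer (rule refl, simp)
  show "a - b = a + - b" by transfer (rule refl, simp)
  show "a * b * c = a * (b * c)" by transfer (rule refl, simp add: algebra_simps)
  show "(a + b) * c = a * c + b * c" by transfer (rule refl, simp add: algebra_simps)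
  show "a * (b + c) = a * b + a * c" by transfer (rule refl, simp add: algebra_simps)
  show "1 * a = a" by transfer (rule refl, simp)
  show "a * 1 = a" by transfer (rule refl, simp)
  show "(0 :: ('a, 'b) tensor) \<noteq> 1"
  proof transfer
    obtain \<phi> :: "'a \<Rightarrow> real" where \<phi>: "linear \<phi>" "\<phi> 1 = 1" using linear_functional_one by blast
    obtain \<psi> :: "'b \<Rightarrow> real" where \<psi>: "linear \<psi>" "\<psi> 1 = 1" using linear_functional_one by blast
    have one: "pair_eval (\<lambda>a b. \<phi> a * \<psi> b) 1 = 1"
      using pair_eval_single[of "\<lambda>a b. \<phi> a * \<psi> b" 1 1 1] \<phi> \<psi>
      by (simp flip: single_one zero_pair_monoid_def)
    show "\<not> ideal_cong tensor_relations (0 :: ('a, 'b) pair_ring) 1"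
      using pair_eval_ideal[OF \<phi>(1) \<psi>(1), of "- 1" 1 1] one
      by (auto simp: ideal_cong_def pair_eval_minus)
  qed
qed
end

type_synonym 'v radialB = "(coeff, 'v radial) tensor"

definition scal :: "coeff \<Rightarrow> 'v radialB" where
  "scal b = tens b 1"

definition var :: "'v \<Rightarrow> 'v radialB" where
  "var v = tens 1 (radial_var v)"

definition wedgeB :: "'v list \<Rightarrow> 'v radialB" where
  "wedgeB us = tens 1 (wedge us)"

inductive_set subalg :: "'v radialB set \<Rightarrow> 'v radialB set" for G :: "'v radialB set" where
  scal: "scal b \<in> subalg G"
| gen: "g \<in> G \<Longrightarrow> g \<in> subalg G"
| add: "f \<in> subalg G \<Longrightarrow> g \<in> subalg G \<Longrightarrow> f + g \<in> subalg G"
| mult: "f \<in> subalg G \<Longrightarrow> g \<in> subalg G \<Longrightarrow> f * g \<in> subalg G"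

text \<open>\<open>R\<^sub>\<bbbB>(V)\<close> for a set \<open>V\<close> of variables, identified with its image in the full algebra (sending
  the other variables to 0 shows that the canonical map is injective).\<close>
definition radial_on :: "'v set \<Rightarrow> 'v radialB set" where
  "radial_on V = subalg (var ` V)"

text \<open>From here on a finite set \<open>Y = {y\<^sub>1, \<dots>, y\<^sub>N}\<close> is given by its enumeration, a distinct
  list \<open>ys\<close>; \<^term>\<open>subseqs ys\<close> then lists the increasing index tuples \<open>I\<close> in the form
  \<open>[y\<^sub>i | i \<in> I]\<close>.\<close>

definition r_of :: "'v \<Rightarrow> 'v radialB" where
  "r_of x = var x ^ 2"

definition s_of :: "'v \<Rightarrow> 'v \<Rightarrow> 'v radialB" where
  "s_of x y = anticommutator (var x) (var y)"

definition c_gens :: "'v list \<Rightarrow> 'v radialB set" where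
  "c_gens ys = {anticommutator (var y) (var y') | y y'. y \<in> set ys \<and> y' \<in> set ys}"

definition scalar_gens :: "'v \<Rightarrow> 'v list \<Rightarrow> 'v radialB set" where
  "scalar_gens x ys = {r_of x} \<union> s_of x ` set ys \<union> c_gens ys"

text \<open>\<open>\<A>\<^sub>x(Y)\<close>\<close>
definition scalars :: "'v \<Rightarrow> 'v list \<Rightarrow> 'v radialB set" where
  "scalars x ys = subalg (scalar_gens x ys)"

text \<open>\<open>\<T>\<^sub>Y\<close>\<close>
definition c_scalars :: "'v list \<Rightarrow> 'v radialB set" where
  "c_scalars ys = subalg (c_gens ys)"


section \<open>Jackson operators and the vector derivative\<close>

text \<open>The definite descriptions in this and the next section determine their objects because
  \<open>\<A>\<^sub>x(Y)\<close> is a polynomial algebra on its generators and \<open>R\<^sub>\<bbbB>({x} \<union> Y)\<close> is free over it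
  on the elements \<open>y\<^sub>I\<close>, \<open>x \<and> y\<^sub>I\<close>. Operators on a subset are made unique as functions by
  taking them in \<^const>\<open>PiE\<close>, i.e. \<^const>\<open>undefined\<close> outside the subset.\<close>

definition B_linear_on :: "'v radialB set \<Rightarrow> ('v radialB \<Rightarrow> 'v radialB) \<Rightarrow> bool" where
  "B_linear_on M D \<longleftrightarrow>
     (\<forall>F\<in>M. \<forall>G\<in>M. D (F + G) = D F + D G) \<and> (\<forall>b. \<forall>F\<in>M. D (scal b * F) = scal b * D F)"

text \<open>Substitution \<open>f(u) \<mapsto> f(Pu)\<close> in the polynomial algebra on the generators \<open>\<G>\<close>: the
  \<open>\<bbbB>\<close>-algebra endomorphism that scales the generator \<open>u\<close> by \<open>P\<close> and fixes the others.\<close>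
definition jackson_shift ::
    "'v radialB set \<Rightarrow> coeff \<Rightarrow> 'v radialB \<Rightarrow> 'v radialB \<Rightarrow> 'v radialB" where
  "jackson_shift \<G> P u = (THE T. T \<in> subalg \<G> \<rightarrow>\<^sub>E subalg \<G> \<and> B_linear_on (subalg \<G>) T \<and>
     T 1 = 1 \<and> (\<forall>f\<in>subalg \<G>. \<forall>g\<in>subalg \<G>. T (f * g) = T f * T g) \<and>
     T u = scal P * u \<and> (\<forall>v\<in>\<G> - {u}. T v = v))"

text \<open>The quotient \<open>(f(u) - f(Pu)) / ((1-P)u)\<close>, which is exact.\<close>
definition jackson_diff ::
    "'v radialB set \<Rightarrow> coeff \<Rightarrow> 'v radialB \<Rightarrow> 'v radialB \<Rightarrow> 'v radialB" where
  "jackson_diff \<G> P u f =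
     (THE g. g \<in> subalg \<G> \<and> scal (1 - P) * u * g = f - jackson_shift \<G> P u f)"

definition scalar_deriv :: "'v \<Rightarrow> 'v list \<Rightarrow> 'v radialB \<Rightarrow> 'v radialB" where
  "scalar_deriv x ys A =
     scal (1 + q_ind) * var x * jackson_diff (scalar_gens x ys) (q_ind\<^sup>2) (r_of x) A +
     2 * (\<Sum>y\<in>set ys. var y *
       jackson_shift (scalar_gens x ys) (q_ind\<^sup>2) (r_of x)
         (jackson_diff (scalar_gens x ys) q_ind (s_of x y) A))"

definition vector_deriv_on :: "'v \<Rightarrow> 'v list \<Rightarrow> 'v radialB \<Rightarrow> 'v radialB" where
  "vector_deriv_on x ys = (THE D.
     D \<in> radial_on (insert x (set ys)) \<rightarrow>\<^sub>E radial_on (insert x (set ys)) \<and>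
     B_linear_on (radial_on (insert x (set ys))) D \<and>
     (\<forall>I\<in>set (subseqs ys). \<forall>A\<in>scalars x ys.
        D (wedgeB I * A) = wedgeB I * scalar_deriv x ys A) \<and>
     (\<forall>I\<in>set (subseqs ys). \<forall>B\<in>scalars x ys.
        D (wedgeB (x # I) * B) =
          scal ((-1) ^ length I * q_m_number (- int (length I))) * wedgeB I * B +
          scal (q_m_pow (- int (length I))) * wedgeB (x # I) * scalar_deriv x ys B))"

definition vector_deriv :: "'v \<Rightarrow> 'v radialB \<Rightarrow> 'v radialB" where
  "vector_deriv x F = (THE G. \<exists>ys. distinct ys \<and> x \<notin> set ys \<and>
     F \<in> radial_on (insert x (set ys)) \<and> G = vector_deriv_on x ys F)"


section \<open>Determinants\<close>

text \<open>The monomials \<open>r\<^sup>a s\<^sup>\<beta>\<close> of \<open>x\<close>-degree \<open>n\<close>; \<open>\<beta>\<close> is the list of exponents of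
  \<open>s\<^sub>1, \<dots>, s\<^sub>N\<close>.\<close>
definition rs_monomials :: "'v \<Rightarrow> 'v list \<Rightarrow> nat \<Rightarrow> 'v radialB list" where
  "rs_monomials x ys n =
     [r_of x ^ a * prod_list (map2 (\<lambda>y b. s_of x y ^ b) ys \<beta>).
        a \<leftarrow> [0..<Suc n], \<beta> \<leftarrow> List.n_lists (length ys) [0..<Suc n], 2 * a + sum_list \<beta> = n]"

text \<open>The basis of the degree \<open>n\<close> component \<open>H\<^sup>Y\<^sub>n\<close> over \<open>\<T>\<^sub>Y\<close>.\<close>
definition H_basis :: "'v \<Rightarrow> 'v list \<Rightarrow> nat \<Rightarrow> 'v radialB list" where
  "H_basis x ys n =
     [wedgeB I * f. I \<leftarrow> subseqs ys, f \<leftarrow> rs_monomials x ys n] @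
     (case n of 0 \<Rightarrow> [] | Suc n' \<Rightarrow>
       [wedgeB (x # I) * f. I \<leftarrow> subseqs ys, f \<leftarrow> rs_monomials x ys n'])"

text \<open>The matrix of \<open>\<K>\<^sup>Y\<^sub>k : F \<mapsto> \<partial>(F x)\<close> on \<open>H\<^sup>Y\<^sub>k\<close>, with entries in \<open>\<T>\<^sub>Y\<close>.\<close>
definition K_matrix :: "'v \<Rightarrow> 'v list \<Rightarrow> nat \<Rightarrow> 'v radialB central mat" where
  "K_matrix x ys k = (let bs = H_basis x ys k; d = length bs in
     THE M. M \<in> carrier_mat d d \<and>
       (\<forall>i<d. \<forall>j<d. of_central (M $$ (i, j)) \<in> c_scalars ys) \<and>
       (\<forall>j<d. vector_deriv_on x ys (bs ! j * var x) =
          (\<Sum>i<d. bs ! i * of_central (M $$ (i, j)))))"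

definition K_det :: "'v \<Rightarrow> 'v list \<Rightarrow> nat \<Rightarrow> 'v radialB central" where
  "K_det x ys k = det (K_matrix x ys k)"

inductive_set mult_closure :: "'a::monoid_mult set \<Rightarrow> 'a set" for G :: "'a set" where
  one: "1 \<in> mult_closure G"
| gen: "g \<in> G \<Longrightarrow> g \<in> mult_closure G"
| mult: "a \<in> mult_closure G \<Longrightarrow> b \<in> mult_closure G \<Longrightarrow> a * b \<in> mult_closure G"

definition Omega_mon :: "'v \<Rightarrow> 'v radialB central set" where
  "Omega_mon x = mult_closure {K_det x ys k | ys k. distinct ys \<and> x \<notin> set ys}"


section \<open>Localization at central elements\<close>

text \<open>Elements of the localization are equivalence classes of pairs \<open>(F, s)\<close>, read as \<open>s\<inverse>F\<close>;
  the unions below are the usual operations on representatives.\<close>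

definition loc_rel ::
    "'a::ring_1 central set \<Rightarrow> (('a \<times> 'a central) \<times> ('a \<times> 'a central)) set" where
  "loc_rel \<Omega> = {((F, s), (G, t)). s \<in> \<Omega> \<and> t \<in> \<Omega> \<and>
     (\<exists>u\<in>\<Omega>. of_central u * (of_central t * F - of_central s * G) = 0)}"

definition loc_frac ::
    "'a::ring_1 central set \<Rightarrow> 'a \<Rightarrow> 'a central \<Rightarrow> ('a \<times> 'a central) set" where
  "loc_frac \<Omega> F s = loc_rel \<Omega> `` {(F, s)}"

definition localization :: "'a::ring_1 central set \<Rightarrow> ('a \<times> 'a central) set ring" where
  "localization \<Omega> =
    \<lparr>carrier = (UNIV \<times> \<Omega>) // loc_rel \<Omega>,
     mult = (\<lambda>X Y. \<Union>(F, s)\<in>X. \<Union>(G, t)\<in>Y. loc_frac \<Omega> (F * G) (s * t)),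
     one = loc_frac \<Omega> 1 1,
     zero = loc_frac \<Omega> 0 1,
     add = (\<lambda>X Y. \<Union>(F, s)\<in>X. \<Union>(G, t)\<in>Y.
              loc_frac \<Omega> (of_central t * F + of_central s * G) (s * t))\<rparr>"

definition loc_extend :: "'a::ring_1 central set \<Rightarrow> ('a \<Rightarrow> 'a) \<Rightarrow>
    ('a \<times> 'a central) set \<Rightarrow> ('a \<times> 'a central) set" where
  "loc_extend \<Omega> D X = (\<Union>(F, s)\<in>X. loc_frac \<Omega> (D F) s)"

definition internal_direct_sum :: "('a, 'm) ring_scheme \<Rightarrow> 'a set \<Rightarrow> 'a set \<Rightarrow> bool" where
  "internal_direct_sum M K L \<longleftrightarrow> additive_subgroup K M \<and> additive_subgroup L M \<and>
     (\<forall>F\<in>carrier M. \<exists>!p. p \<in> K \<times> L \<and> F = fst p \<oplus>\<^bsub>M\<^esub> snd p)"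

end

theory Submission
  imports Defs "HOL-Library.Uprod"
begin

text \<open>Grade by the \<open>x\<close>-degree. On each homogeneous component over a finite set \<open>Y\<close> the map
  \<open>F \<mapsto> \<partial>(F x)\<close> is an endomorphism of a free module of finite rank whose determinant is inverted,
  so by Cramer's rule it becomes bijective. Hence \<open>\<partial>F = \<partial>(E x)\<close> has exactly one solution \<open>E\<close> after
  localization, and \<open>F = (F - E x) + E x\<close> is the decomposition.

  That all the operators exist rests on the radial algebra being free over the polynomial ring of
  its scalars. This is read off from a right action, by Clifford-type operators, on the alternating
  functions of a list of variables with polynomial values: evaluating \<open>\<phi> \<cdot> (u\<^sub>1 \<and> \<dots> \<and> u\<^sub>p)\<close>
  at the empty list gives \<open>\<phi> [u\<^sub>1, \<dots>, u\<^sub>p]\<close>, which separates the basis elements. Using alternating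
  functions instead of a basis of the exterior algebra avoids ordering the variables.\<close>

\<comment> \<open>The Jackson operators, the vector derivative and the matrices are definite
  descriptions, so nothing can be computed with them before existence and uniqueness are settled;
  coordinates provide both. The action has this origin: \<open>u v\<close> is
  \<open>u \<and> v\<close> plus half of \<open>{u, v}\<close>, and in general left multiplication
  by a variable prepends a letter to a wedge and adds half of a contraction. Transposed to functions
  of the letters this reverses products, hence a right action, and coefficients can be read off
  before the wedges are known to be independent. The determinant in degree k serves the component of
  degree k + 1, because the derivative lowers the degree by one; degree 0 is killed. Cramer's rule
  is run over a polynomial ring and then carried into the centre. Adjugate entries are polynomials
  in the matrix entries, so they involve only anticommutators free of \<open>x\<close>, and over
  these the derivative is linear.\<close>
alias lookup = Poly_Mapping.lookup
alias keys = Poly_Mapping.keys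
alias single = Poly_Mapping.single

section \<open>Alternating sums and antisymmetrized products\<close>

text \<open>Each letter in turn is taken out and the rest kept in order, with sign (-1)^j at
  position j, as \<open>alt_sum_nth\<close> spells out. The recursion keeps indices out of most
  proofs.\<close>

fun alt_sum :: "('v \<Rightarrow> 'v list \<Rightarrow> 'r::ab_group_add) \<Rightarrow> 'v list \<Rightarrow> 'r" where
  "alt_sum f [] = 0"
| "alt_sum f (v # us) = f v us - alt_sum (\<lambda>u rs. f u (v # rs)) us"

lemma alt_sum_add: "alt_sum (\<lambda>u r. f u r + g u r) us = alt_sum f us + alt_sum g us"
  by (induction us arbitrary: f g) (simp_all add: algebra_simps)

lemma alt_sum_zero [simp]: "alt_sum (\<lambda>u r. 0) us = 0"
  by (induction us) simp_all

lemma alt_sum_hom: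
  assumes "\<And>a b. h (a - b) = h a - h b"
  shows "h (alt_sum f us) = alt_sum (\<lambda>u r. h (f u r)) us"
proof (induction us arbitrary: f)
  case Nil
  show ?case using assms[of 0 0] by simp
next
  case (Cons v us)
  then show ?case by (simp add: assms)
qed

lemma alt_sum_diff: "alt_sum (\<lambda>u r. f u r - g u r) us = alt_sum f us - alt_sum g us"
  by (induction us arbitrary: f g) (simp_all add: algebra_simps)

lemma alt_sum_minus: "alt_sum (\<lambda>u r. - f u r) us = - alt_sum f us"
  using alt_sum_diff[of "\<lambda>u r. 0" f] by simp

text \<open>Only pairs arising from a removal matter. The multiset equation is enough to recover
  lengths, membership and multiplicities, which is all that later uses ask for.\<close>

lemma alt_sum_cong:
  assumes "\<And>u r. mset us = add_mset u (mset r) \<Longrightarrow> f u r = g u r"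
  shows "alt_sum f us = alt_sum g us"
  using assms
proof (induction us arbitrary: f g)
  case (Cons v us)
  have "f v us = g v us" using Cons.prems by simp
  moreover have "alt_sum (\<lambda>u r. f u (v # r)) us = alt_sum (\<lambda>u r. g u (v # r)) us"
    by (rule Cons.IH) (simp add: Cons.prems)
  ultimately show ?case by simp
qed simp

text \<open>Both sides remove two letters. Exchanging the order of removal shifts exactly one of the
  two positions by one, which flips the sign.\<close>

lemma alt_sum_swap:
  "alt_sum (\<lambda>a r. alt_sum (\<lambda>b s. g a b s) r) us = - alt_sum (\<lambda>a r. alt_sum (\<lambda>b s. g b a s) r) us"
proof (induction us arbitrary: g)
  case (Cons v us)
  show ?case
    using Cons.IH[of "\<lambda>a b s. g a b (v # s)"] by (simp add: alt_sum_diff)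
qed simp

lemma alt_sum_nth:
  fixes f :: "'v \<Rightarrow> 'v list \<Rightarrow> 'r::ring_1"
  shows "alt_sum f us = (\<Sum>j<length us. (-1) ^ j * f (us ! j) (take j us @ drop (Suc j) us))"
proof (induction us arbitrary: f)
  case (Cons v us)
  show ?case
    unfolding length_Cons sum.lessThan_Suc_shift
    by (simp add: Cons.IH sum_negf)
qed simp

text \<open>Adjacent exchanges are what the recursions produce. Vanishing on repeated letters is not
  built in; it depends on the absence of 2-torsion, see
  \<open>alternating_not_distinct\<close>.\<close>

definition alternating :: "('v list \<Rightarrow> 'r::ab_group_add) \<Rightarrow> bool" where
  "alternating \<phi> \<longleftrightarrow> (\<forall>us a b vs. \<phi> (us @ a # b # vs) = - \<phi> (us @ b # a # vs))"

lemma alternatingD: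
  assumes "alternating \<phi>"
  shows "\<phi> (us @ a # b # vs) = - \<phi> (us @ b # a # vs)"
  by (rule assms[unfolded alternating_def, rule_format, of us a b vs])

lemma alternatingI:
  assumes "\<And>us a b vs. \<phi> (us @ a # b # vs) = - \<phi> (us @ b # a # vs)"
  shows "alternating \<phi>"
  unfolding alternating_def by (intro allI assms)

lemma alternating_Cons:
  assumes "alternating \<phi>"
  shows "alternating (\<lambda>us. \<phi> (v # us))"
  by (rule alternatingI) (rule alternatingD[OF assms, of "v # us" for us, simplified append_Cons])

text \<open>When two neighbours are exchanged, the two terms that remove one of them trade places
  with opposite signs; every other term inherits its sign from \<open>f\<close>.\<close>

lemma alternating_alt_sum:
  assumes "\<And>u. alternating (f u)"
  shows "alternating (alt_sum f)"
proof -
  have "alt_sum f (us @ a # b # vs) = - alt_sum f (us @ b # a # vs)" for us a b vs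
    using assms
  proof (induction us arbitrary: f)
    case Nil
    have "alt_sum (\<lambda>c r. f c (a # b # r)) vs = alt_sum (\<lambda>c r. - f c (b # a # r)) vs"
    proof (rule alt_sum_cong)
      fix c r
      show "f c (a # b # r) = - f c (b # a # r)"
        using alternatingD[OF Nil, of c "[]" a b r] by simp
    qed
    then show ?case by (simp add: alt_sum_minus)
  next
    case (Cons w us)
    have "alt_sum (\<lambda>u r. f u (w # r)) (us @ a # b # vs)
        = - alt_sum (\<lambda>u r. f u (w # r)) (us @ b # a # vs)"
      by (rule Cons.IH) (rule alternating_Cons[OF Cons.prems])
    with alternatingD[OF Cons.prems, of w us a b vs] show ?case by simp
  qed
  then show ?thesis by (rule alternatingI)
qed

lemma alternating_move_front:
  "alternating \<phi> \<Longrightarrow> \<phi> (us @ a # vs) = (-1) ^ length us * \<phi> (a # us @ vs)"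
  for \<phi> :: "'v list \<Rightarrow> 'r::ring_1"
proof (induction us arbitrary: \<phi>)
  case (Cons w us)
  have "\<phi> (w # us @ a # vs) = (-1) ^ length us * \<phi> (w # a # us @ vs)"
    by (rule Cons.IH) (rule alternating_Cons[OF Cons.prems])
  with alternatingD[OF Cons.prems, of "[]" w a "us @ vs"] show ?case by simp
qed simp

text \<open>The sign is fixed before \<phi>. This uniformity allows \<open>vderiv_wedgeB_any\<close>
  to apply one sign both to a wedge and to the same wedge with \<open>x\<close> in front.\<close>

lemma alternating_reorder:
  assumes "mset us = mset vs"
  shows "\<exists>s::'r::ring_1. (s = 1 \<or> s = - 1) \<and> (\<forall>\<phi>::'v list \<Rightarrow> 'r. alternating \<phi> \<longrightarrow> \<phi> us = s * \<phi> vs)"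
  using assms
proof (induction us arbitrary: vs)
  case Nil
  then show ?case by auto
next
  case (Cons a us)
  then obtain xs ys where vs: "vs = xs @ a # ys"
    by (metis list.set_intros(1) mset_eq_setD split_list)
  with Cons.prems have "mset us = mset (xs @ ys)" by simp
  from Cons.IH[OF this] obtain s :: 'r where
    s: "s = 1 \<or> s = - 1" "\<And>\<phi>. alternating \<phi> \<Longrightarrow> \<phi> us = s * \<phi> (xs @ ys)" by blast
  let ?t = "s * (-1) ^ length xs"
  have "?t = 1 \<or> ?t = - 1"
    using s(1) by (cases "even (length xs)") auto
  moreover have "\<phi> (a # us) = ?t * \<phi> vs" if \<phi>: "alternating \<phi>" for \<phi> :: "'v list \<Rightarrow> 'r"
  proof -
    have "\<phi> (a # us) = s * \<phi> (a # xs @ ys)"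
      by (rule s(2)) (rule alternating_Cons[OF \<phi>])
    also have "\<phi> (a # xs @ ys) = (-1) ^ length xs * \<phi> vs"
      unfolding vs alternating_move_front[OF \<phi>]
      by (cases "even (length xs)") simp_all
    finally show ?thesis by (simp add: mult.assoc)
  qed
  ultimately show ?case by blast
qed

text \<open>Two equal letters are brought to the front; exchanging them shows that the value is its
  own negative.\<close>

lemma alternating_not_distinct:
  fixes \<phi> :: "'v list \<Rightarrow> 'r::ring_1"
  assumes \<phi>: "alternating \<phi>" and torsion: "\<And>a::'r. a + a = 0 \<Longrightarrow> a = 0"
    and "\<not> distinct us"
  shows "\<phi> us = 0"
proof -
  obtain a xs ys zs where us: "us = xs @ [a] @ ys @ [a] @ zs"
    using not_distinct_decomp[OF assms(3)] by blast
  have "mset us = mset (a # a # xs @ ys @ zs)" unfolding us by simp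
  from alternating_reorder[OF this] obtain s :: 'r where
    "\<phi> us = s * \<phi> (a # a # xs @ ys @ zs)" using \<phi> by blast
  moreover have "\<phi> (a # a # xs @ ys @ zs) = 0"
    using alternatingD[OF \<phi>, of "[]" a a "xs @ ys @ zs"] torsion
    by (metis add.right_inverse append_Nil)
  ultimately show ?thesis by simp
qed

text \<open>Expansion of the antisymmetrized product along its first factor. The counter \<open>n\<close> makes
  the value vanish on lists of the wrong length, so that the function is alternating on all lists.\<close>

fun alt_prod :: "('v \<Rightarrow> 'r::ring_1) \<Rightarrow> nat \<Rightarrow> 'v list \<Rightarrow> 'r" where
  "alt_prod f 0 us = (if us = [] then 1 else 0)"
| "alt_prod f (Suc n) us = alt_sum (\<lambda>u r. f u * alt_prod f n r) us"

lemma alternating_mult_left: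
  assumes "alternating \<phi>"
  shows "alternating (\<lambda>us. (c::'r::ring) * \<phi> us)"
proof (rule alternatingI)
  fix us a b vs
  show "c * \<phi> (us @ a # b # vs) = - (c * \<phi> (us @ b # a # vs))"
    unfolding alternatingD[OF assms, of us a b vs] by simp
qed

lemma alternating_alt_prod: "alternating (alt_prod f n)"
proof (induction n)
  case 0
  show ?case by (simp add: alternating_def)
next
  case (Suc n)
  have "alternating (alt_sum (\<lambda>u r. f u * alt_prod f n r))"
    by (intro alternating_alt_sum alternating_mult_left Suc)
  then show ?case by (simp add: fun_eq_iff[symmetric])
qed

text \<open>Laplace expansion along the first factor: permutations are grouped by
  \<open>\<pi> 0 = j\<close>, and \<open>permutation_insert 0 j\<close> identifies each group with
  the permutations of one letter fewer, at the cost of the sign (-1)^j.\<close>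

lemma antisymmetrization_alt_prod:
  assumes "length us = n"
  shows "(\<Sum>\<pi> | \<pi> permutes {..<n}. of_int (sign \<pi>) * prod_list (map (\<lambda>i. f (us ! \<pi> i)) [0..<n]))
    = (alt_prod f n us :: 'r::ring_1)"
  using assms
proof (induction n arbitrary: us)
  case 0
  have "{\<pi>. \<pi> permutes ({}::nat set)} = {id}" by (auto simp: permutes_empty)
  with 0 show ?case by simp
next
  case (Suc n)
  let ?t = "\<lambda>m us \<pi>. of_int (sign \<pi>) * prod_list (map (\<lambda>i. f (us ! \<pi> i)) [0..<m]) :: 'r"
  let ?P = "\<lambda>m. {\<pi>. \<pi> permutes {0..<m::nat}}"
  let ?del = "\<lambda>j. take j us @ drop (Suc j) us"
  have un: "?P (Suc n) = (\<Union>j\<in>{..<Suc n}. {\<pi>. \<pi> permutes {0..<Suc n} \<and> \<pi> 0 = j})"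
    by (auto dest: permutes_in_image[where x = 0])
  have "(\<Sum>\<pi>\<in>?P (Suc n). ?t (Suc n) us \<pi>)
      = (\<Sum>j<Suc n. \<Sum>\<pi> | \<pi> permutes {0..<Suc n} \<and> \<pi> 0 = j. ?t (Suc n) us \<pi>)"
    unfolding un
    by (rule sum.UNION_disjoint) (auto intro: finite_subset[OF _ finite_permutations[of "{0..<Suc n}"]])
  also have "\<dots> = (\<Sum>j<Suc n. (-1) ^ j * (f (us ! j) * alt_prod f n (?del j)))"
  proof (rule sum.cong[OF refl])
    fix j assume "j \<in> {..<Suc n}"
    then have j: "j < Suc n" by simp
    have len: "length (?del j) = n" using Suc.prems j by simp
    have "(\<Sum>\<pi> | \<pi> permutes {0..<Suc n} \<and> \<pi> 0 = j. ?t (Suc n) us \<pi>)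
        = (\<Sum>\<pi>\<in>?P n. ?t (Suc n) us (permutation_insert 0 j \<pi>))"
      unfolding permutation_fix[OF zero_less_Suc j]
      by (subst sum.reindex[OF permutation_insert_inj_on[OF zero_less_Suc j]]) simp
    also have "\<dots> = (\<Sum>\<pi>\<in>?P n. (-1) ^ j * (f (us ! j) * ?t n (?del j) \<pi>))"
    proof (rule sum.cong[OF refl])
      fix \<pi> assume "\<pi> \<in> ?P n"
      then have \<pi>: "\<pi> permutes {0..<n}" by simp
      have sgn: "(of_int (sign (permutation_insert 0 j \<pi>)) :: 'r) = (-1) ^ j * of_int (sign \<pi>)"
        using signof_permutation_insert[OF \<pi> zero_less_Suc j, where 'a = 'r] by simp
      have "map (\<lambda>i. f (us ! permutation_insert 0 j \<pi> i)) [0..<Suc n]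
          = f (us ! j) # map (\<lambda>i. f (?del j ! \<pi> i)) [0..<n]"
      proof -
        have "us ! permutation_insert 0 j \<pi> (Suc i) = ?del j ! \<pi> i" if "i < n" for i
        proof -
          have "\<pi> i < n" using permutes_in_image[OF \<pi>, of i] that by simp
          then show ?thesis
            using Suc.prems j by (auto simp: permutation_insert_expand nth_append min_def)
        qed
        then show ?thesis
          by (subst upt_conv_Cons)
             (auto simp: map_Suc_upt[symmetric] simp del: upt_Suc)
      qed
      then show "?t (Suc n) us (permutation_insert 0 j \<pi>) = (-1) ^ j * (f (us ! j) * ?t n (?del j) \<pi>)"
        unfolding sgn
        by (simp add: mult.assoc) (metis (no_types, lifting) mult.assoc mult_of_int_commute)
    qed
    also have "\<dots> = (-1) ^ j * (f (us ! j) * alt_prod f n (?del j))"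
      unfolding Suc.IH[OF len, unfolded lessThan_atLeast0, symmetric] sum_distrib_left ..
    finally show "(\<Sum>\<pi> | \<pi> permutes {0..<Suc n} \<and> \<pi> 0 = j. ?t (Suc n) us \<pi>) =
      (-1) ^ j * (f (us ! j) * alt_prod f n (?del j))" .
  qed
  also have "\<dots> = alt_prod f (Suc n) us"
    by (simp only: alt_prod.simps alt_sum_nth Suc.prems)
  finally show ?case by (simp only: lessThan_atLeast0)
qed

text \<open>Multiplied by two, so that the statement makes sense in every ring.\<close>

lemma alt_prod_Cons:
  fixes f :: "'v \<Rightarrow> 'r::ring_1"
  assumes central: "\<And>u w z. (f u * f w + f w * f u) * f z = f z * (f u * f w + f w * f u)"
  shows "2 * alt_prod f (Suc n) (v # us) = of_nat (2 * Suc n) * (f v * alt_prod f n us)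
    - of_nat (n * Suc n) * alt_sum (\<lambda>u r. (f v * f u + f u * f v) * alt_prod f (n - 1) r) us"
proof (induction n arbitrary: us)
  case 0
  show ?case by (simp add: alt_sum_minus mult.assoc)
next
  case (Suc n)
  let ?c = "\<lambda>u. f v * f u + f u * f v"
  have anticomm: "f u * (?c w * z) = ?c w * (f u * z)" for u w z
    by (metis central mult.assoc)
  have nc: "z * (of_nat k * y) = of_nat k * (z * y)" for z y :: 'r and k
    by (metis mult.assoc mult_of_nat_commute)
  \<comment> \<open>The induction hypothesis is applied behind \<open>f u\<close>, and then
    \<open>f u\<close> is moved past \<open>f v\<close> at the price of the central element
    \<open>?c u\<close>.\<close>
  have one: "2 * (f u * alt_prod f (Suc n) (v # r)) =
      of_nat (2 * Suc n) * (?c u * alt_prod f n r) - of_nat (2 * Suc n) * (f v * (f u * alt_prod f n r))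
      - of_nat (n * Suc n) * alt_sum (\<lambda>w s. ?c w * (f u * alt_prod f (n - 1) s)) r" for u r
  proof -
    have "2 * (f u * alt_prod f (Suc n) (v # r)) = f u * (2 * alt_prod f (Suc n) (v # r))"
      by (metis mult.assoc mult_2 mult_2_right)
    also have "\<dots> = f u * (of_nat (2 * Suc n) * (f v * alt_prod f n r))
      - f u * (of_nat (n * Suc n) * alt_sum (\<lambda>u r. ?c u * alt_prod f (n - 1) r) r)"
      unfolding Suc.IH by (simp only: right_diff_distrib)
    also have "f u * (of_nat (2 * Suc n) * (f v * alt_prod f n r))
       = of_nat (2 * Suc n) * (f u * f v * alt_prod f n r)"
      by (simp only: nc mult.assoc)
    also have "f u * f v = ?c u - f v * f u" by simp
    also have "f u * (of_nat (n * Suc n) * alt_sum (\<lambda>u r. ?c u * alt_prod f (n - 1) r) r)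
      = of_nat (n * Suc n) * (f u * alt_sum (\<lambda>u r. ?c u * alt_prod f (n - 1) r) r)"
      by (rule nc)
    also have "f u * alt_sum (\<lambda>u r. ?c u * alt_prod f (n - 1) r) r
       = alt_sum (\<lambda>w s. ?c w * (f u * alt_prod f (n - 1) s)) r"
      by (subst alt_sum_hom[where h = "\<lambda>z. f u * z"]) (simp_all add: right_diff_distrib anticomm)
    finally show ?thesis by (simp only: left_diff_distrib right_diff_distrib mult.assoc)
  qed
  \<comment> \<open>Swapping the two removals exchanges the roles of \<open>u\<close> and
    \<open>w\<close>. The central factor then leaves the inner sum, which closes up to
    \<open>alt_prod f n\<close> by its recursion.\<close>
  have dbl: "(of_nat (n * Suc n) :: 'r) * alt_sum (\<lambda>u r. alt_sum (\<lambda>w s. ?c w * (f u * alt_prod f (n - 1) s)) r) us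
     = - of_nat (n * Suc n) * alt_sum (\<lambda>u r. ?c u * alt_prod f n r) us"
  proof (cases n)
    case (Suc m)
    have "alt_sum (\<lambda>u r. alt_sum (\<lambda>w s. ?c w * (f u * alt_prod f (n - 1) s)) r) us
       = - alt_sum (\<lambda>u r. alt_sum (\<lambda>w s. ?c u * (f w * alt_prod f (n - 1) s)) r) us"
      by (rule alt_sum_swap)
    also have "(\<lambda>u r. alt_sum (\<lambda>w s. ?c u * (f w * alt_prod f (n - 1) s)) r)
       = (\<lambda>u r. ?c u * alt_prod f n r)"
      unfolding Suc
      by (intro ext) (simp add: alt_sum_hom[where h = "\<lambda>z. ?c _ * z"] right_diff_distrib)
    finally show ?thesis by (simp only: mult_minus_left mult_minus_right)
  qed simp
  have pull: "alt_sum (\<lambda>u r. k * g u r) us = k * alt_sum g us" for k :: 'r and g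
    by (subst alt_sum_hom[where h = "\<lambda>z. k * z"]) (simp_all add: right_diff_distrib)
  have "2 * alt_prod f (Suc (Suc n)) (v # us) = 2 * (f v * alt_prod f (Suc n) us)
     - alt_sum (\<lambda>u r. 2 * (f u * alt_prod f (Suc n) (v # r))) us"
    by (simp only: alt_prod.simps(2)[of f "Suc n"] alt_sum.simps right_diff_distrib pull)
  also have "alt_sum (\<lambda>u r. 2 * (f u * alt_prod f (Suc n) (v # r))) us
     = of_nat (2 * Suc n) * alt_sum (\<lambda>u r. ?c u * alt_prod f n r) us
      - of_nat (2 * Suc n) * (f v * alt_prod f (Suc n) us)
      + of_nat (n * Suc n) * alt_sum (\<lambda>u r. ?c u * alt_prod f n r) us"
    unfolding one alt_sum_diff pull dbl unfolding alt_prod.simps(2)[of f n]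
    by (simp only: mult_minus_left diff_minus_eq_add)
  \<comment> \<open>The coefficients add up as 2 + 2(n+1) = 2(n+2) and 2(n+1) + n(n+1) = (n+1)(n+2),
    which is the claim for n + 1.\<close>
  also have "2 * a - (of_nat (2 * Suc n) * S - of_nat (2 * Suc n) * a + of_nat (n * Suc n) * S)
     = of_nat (2 * Suc (Suc n)) * a - of_nat (Suc n * Suc (Suc n)) * S" for a S :: 'r
    by (simp add: algebra_simps mult_2 mult_2_right)
  finally show ?case by (simp only: diff_Suc_1)
qed

lemma wedge_alt_prod: "wedge us = (1 / fact (length us)) *\<^sub>R alt_prod radial_var (length us) us"
  unfolding wedge_def by (subst antisymmetrization_alt_prod) auto

section \<open>Wedge products in the radial algebra\<close>

definition pm_eval :: "('c::zero \<Rightarrow> 'r::ring_1) \<Rightarrow> ('k \<Rightarrow> 'r) \<Rightarrow> ('k \<Rightarrow>\<^sub>0 'c) \<Rightarrow> 'r" where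
  "pm_eval h g f = (\<Sum>k\<in>keys f. h (lookup f k) * g k)"

text \<open>Universal property of a monoid algebra, used for the free algebra, the ring of pairs and
  polynomials. Two of the targets are rings of endomorphisms, so commutation of coefficients with
  monoid elements has to be assumed.\<close>

locale pm_hom =
  fixes h :: "'c::semiring_1 \<Rightarrow> 'r::ring_1" and g :: "'k::monoid_add \<Rightarrow> 'r"
  assumes h_add: "h (a + b) = h a + h b" and h_mult: "h (a * b) = h a * h b" and h_one: "h 1 = 1"
    and g_zero: "g 0 = 1" and g_add: "g (k + l) = g k * g l"
    and commute: "g k * h c = h c * g k"
begin

lemma h_zero: "h 0 = 0"
  using h_add[of 0 0] by simp

lemma eval_add: "pm_eval h g (f + f') = pm_eval h g f + pm_eval h g f'"
proof -
  let ?A = "keys f \<union> keys f'"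
  have sup: "pm_eval h g e = (\<Sum>k\<in>?A. h (lookup e k) * g k)"
    if "keys e \<subseteq> ?A" for e
    unfolding pm_eval_def
    by (rule sum.mono_neutral_left) (use that in \<open>auto simp: in_keys_iff h_zero\<close>)
  show ?thesis
    using keys_add[of f f']
    by (simp add: sup lookup_add h_add distrib_right sum.distrib)
qed

lemma eval_single: "pm_eval h g (single k c) = h c * g k"
  by (simp add: pm_eval_def h_zero)

lemma eval_one: "pm_eval h g 1 = 1"
  using eval_single[of 0 1] by (simp add: h_one g_zero)

lemma eval_zero: "pm_eval h g 0 = 0"
  by (simp add: pm_eval_def)

lemma eval_mult: "pm_eval h g (f * f') = pm_eval h g f * pm_eval h g f'"
proof (induction f rule: poly_mapping_sum_induct)
  case (single k c)
  show ?case
  proof (induction f' rule: poly_mapping_sum_induct)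
    case (single l d)
    show ?case
      by (simp add: mult_single eval_single h_mult g_add) (metis commute mult.assoc)
  next
    case (sum f g)
    then show ?case by (simp add: distrib_left eval_add)
  qed
next
  case (sum f g)
  then show ?case by (simp add: distrib_right eval_add)
qed

end

section \<open>Generators of the scalar extension and its central anticommutators\<close>

lemma tens_mult: "tens a b * tens c d = tens (a * c) (b * d)"
  by transfer (simp add: pair_gen_def mult_single ideal_cong_def two_sided_ideal.zero)

lemma tens_one: "tens 1 1 = 1"
  by transfer (simp add: pair_gen_def ideal_cong_def two_sided_ideal.zero flip: zero_pair_monoid_def)

lemma tens_add_left: "tens (a + a') b = tens a b + tens a' b"
  by transfer (unfold ideal_cong_def tensor_relations_def diff_diff_eq[symmetric],
      rule two_sided_ideal.gen, blast)

lemma tens_add_right: "tens a (b + b') = tens a b + tens a b'"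
  by transfer (unfold ideal_cong_def tensor_relations_def diff_diff_eq[symmetric],
      rule two_sided_ideal.gen, blast)

lemma tens_scaleR: "tens (c *\<^sub>R a) b = tens a (c *\<^sub>R b)"
  by transfer (unfold ideal_cong_def tensor_relations_def, rule two_sided_ideal.gen, blast)

lemma tens_zero_left [simp]: "tens 0 b = 0"
  using tens_add_left[of 0 0 b] by simp

lemma tens_zero_right [simp]: "tens b 0 = 0"
  using tens_add_right[of b 0 0] by simp

lemma tens_minus_left: "tens (- a) b = - tens a b"
  using tens_add_left[of "- a" a b] by (simp add: eq_neg_iff_add_eq_0)

lemma tens_minus_right: "tens a (- b) = - tens a b"
  using tens_add_right[of a "- b" b] by (simp add: eq_neg_iff_add_eq_0)

lemma tens_diff_right: "tens a (b - b') = tens a b - tens a b'"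
  using tens_add_right[of a b "- b'"] by (simp add: tens_minus_right)

text \<open>The underlying ring of pairs has integer coefficients; a multiple is reached by adding
  pure tensors one at a time, a negative sign being absorbed into the first factor.\<close>

lemma tensor_induct:
  assumes tens: "\<And>a b. P (tens a b)" and add: "\<And>F G. P F \<Longrightarrow> P G \<Longrightarrow> P (F + G)"
  shows "P F"
proof (induction F rule: tensor.abs_induct)
  case (1 f)
  show ?case
  proof (induction f rule: poly_mapping_sum_induct)
    case (single k n)
    obtain a b where k: "k = Pr a b" by (cases k)
    have step: "abs_tensor (single k (m + l)) =
        abs_tensor (single k m) + abs_tensor (single k l)" for m l
      by (simp add: single_add plus_tensor.abs_eq)
    have plus: "abs_tensor (single k 1) = tens a b"
      by (simp add: tens.abs_eq pair_gen_def k)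
    have minus: "abs_tensor (single k (- 1)) = tens (- a) b"
      unfolding tens_minus_left plus[symmetric] by (simp add: uminus_tensor.abs_eq single_uminus)
    show ?case
    proof (induction n rule: int_induct[where k = 0])
      case base
      have "abs_tensor 0 = tens (a - a) b" by (simp add: zero_tensor.abs_eq[symmetric])
      then show ?case using tens[of "a - a" b] by simp
    next
      case (step1 i)
      then show ?case unfolding step plus by (intro add tens)
    next
      case (step2 i)
      then show ?case unfolding diff_conv_add_uminus step minus by (intro add tens)
    qed
  next
    case (sum f g)
    then show ?case using add by (simp add: plus_tensor.abs_eq[symmetric])
  qed
qed

lemma abs_radial_single:
  "abs_radial (single (Wd ws) c) = c *\<^sub>R prod_list (map radial_var ws)"
proof (induction ws)
  case Nil
  have "abs_radial (single 0 c) = c *\<^sub>R (1 :: 'a radial)"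
    unfolding one_radial.abs_eq scaleR_radial.abs_eq by simp
  then show ?case by (simp add: zero_word_monoid_def)
next
  case (Cons v ws)
  have "single (Wd (v # ws)) c = free_var v * single (Wd ws) c"
    by (simp add: free_var_def mult_single)
  then have "abs_radial (single (Wd (v # ws)) c)
      = radial_var v * abs_radial (single (Wd ws) c)"
    by (simp add: times_radial.abs_eq radial_var.abs_eq)
  with Cons show ?case by simp
qed

lemma radial_induct:
  assumes "P 1" "\<And>v. P (radial_var v)" "\<And>a b. P a \<Longrightarrow> P b \<Longrightarrow> P (a + b)"
    "\<And>a b. P a \<Longrightarrow> P b \<Longrightarrow> P (a * b)" "\<And>c a. P a \<Longrightarrow> P (c *\<^sub>R a)"
  shows "P a"
proof (induction a rule: radial.abs_induct)
  case (1 f)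
  show ?case
  proof (induction f rule: poly_mapping_sum_induct)
    case (single k c)
    obtain ws where k: "k = Wd ws" by (cases k)
    have "P (prod_list (map radial_var ws))" by (induction ws) (auto intro: assms)
    then show ?case unfolding k abs_radial_single by (rule assms)
  next
    case (sum f g)
    then show ?case using assms(3) by (simp add: plus_radial.abs_eq[symmetric])
  qed
qed

lemma scal_add: "scal (a + b) = scal a + scal b"
  and scal_mult: "scal (a * b) = scal a * scal b"
  and scal_one [simp]: "scal 1 = 1" and scal_zero [simp]: "scal 0 = 0"
  and scal_minus: "scal (- a) = - scal a"
  by (simp_all add: scal_def tens_add_left tens_mult tens_one tens_minus_left)

lemma radialB_induct [case_names scal var add mult]:
  fixes F :: "'v radialB"
  assumes scal: "\<And>b. P (scal b)" and var: "\<And>v. P (var v)"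
    and add: "\<And>F G. P F \<Longrightarrow> P G \<Longrightarrow> P (F + G)" and mult: "\<And>F G. P F \<Longrightarrow> P G \<Longrightarrow> P (F * G)"
  shows "P F"
proof (induction F rule: tensor_induct)
  case (1 a b)
  have eq: "tens a b = scal a * tens 1 b" for a and b :: "'v radial"
    by (simp add: scal_def tens_mult)
  have "P (tens 1 b)"
  proof (induction b rule: radial_induct)
    case 1
    show ?case using scal[of 1] by (simp add: scal_def)
  next
    case (2 v)
    show ?case using var[of v] by (simp add: var_def)
  next
    case (3 a b)
    then show ?case by (simp add: tens_add_right add)
  next
    case (4 a b)
    then show ?case using mult[of "tens 1 a" "tens 1 b"] by (simp add: tens_mult)
  next
    case (5 c a)
    have "tens 1 (c *\<^sub>R a) = scal (c *\<^sub>R 1) * tens 1 a"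
      using eq[of "c *\<^sub>R 1" a] by (simp add: tens_scaleR)
    then show ?case using mult[OF scal 5] by simp
  qed
  then show ?case unfolding eq[of a b] by (intro mult scal)
qed (rule add)

lemma scal_central: "scal b * F = F * scal b"
proof (induction F rule: tensor_induct)
  case (1 a c)
  show ?case by (simp add: scal_def tens_mult mult.commute)
qed (simp add: algebra_simps)

lemma radial_var_central:
  "(radial_var u * radial_var w + radial_var w * radial_var u) * radial_var z
    = radial_var z * (radial_var u * radial_var w + radial_var w * radial_var u)"
  by transfer (auto simp: ideal_cong_def radial_relations_def commutator_def anticommutator_def
      intro!: two_sided_ideal.gen)

lemma commute_mult:
  fixes c F G :: "'r::semigroup_mult"
  shows "c * F = F * c \<Longrightarrow> c * G = G * c \<Longrightarrow> c * (F * G) = F * G * c"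
  by (metis mult.assoc)

lemma var_central:
  "(var u * var w + var w * var u) * F = F * (var u * var w + var w * var u)"
proof (induction F rule: radialB_induct)
  case (scal b)
  show ?case by (rule scal_central[symmetric])
next
  case (var v)
  show ?case
    unfolding var_def tens_mult tens_add_right[symmetric] by (simp add: radial_var_central)
next
  case (add F G)
  then show ?case by (simp add: distrib_left distrib_right)
next
  case (mult F G)
  from commute_mult[OF this] show ?case .
qed

definition c_pair :: "'v \<Rightarrow> 'v \<Rightarrow> 'v radialB central" where
  "c_pair u w = to_central (anticommutator (var u) (var w))"

lemma of_central_c_pair: "of_central (c_pair u w) = anticommutator (var u) (var w)"
  unfolding c_pair_def anticommutator_def
  by (rule to_central_inverse, rule CollectI, rule allI, rule var_central)

text \<open>Indexing by unordered pairs builds the symmetry \<open>{u, w} = {w, u}\<close> into the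
  index, so that the same pairs can later serve as algebraically independent indeterminates.\<close>

lift_definition anticomm :: "'v uprod \<Rightarrow> 'v radialB central" is "\<lambda>(u, w). c_pair u w"
  by (auto simp: c_pair_def anticommutator_def add.commute)

lemma of_central_anticomm: "of_central (anticomm (Upair u w)) = var u * var w + var w * var u"
proof -
  have "anticomm (Upair u w) = c_pair u w" by transfer simp
  then show ?thesis by (simp add: of_central_c_pair anticommutator_def)
qed

lemma of_central_commute: "of_central z * w = w * of_central z"
  using of_central[of z] by blast

lemmas of_central_hom = plus_central.rep_eq times_central.rep_eq minus_central.rep_eq
  zero_central.rep_eq one_central.rep_eq uminus_central.rep_eq

definition rscal :: "real \<Rightarrow> 'v radialB" where
  "rscal a = scal (a *\<^sub>R 1)"

lemma rscal_mult: "rscal a * rscal b = rscal (a * b)"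
  by (simp add: rscal_def scal_mult[symmetric] mult.commute)

lemma rscal_of_nat: "rscal (of_nat n) = of_nat n"
  by (induction n) (simp_all add: rscal_def scal_add scaleR_add_left)

lemma wedgeB_alt_prod:
  fixes us :: "'v list"
  shows "wedgeB us = rscal (1 / fact (length us)) * alt_prod var (length us) us"
proof -
  have "tens 1 (alt_prod radial_var n us) = alt_prod var n us" for n and us :: "'v list"
  proof (induction n arbitrary: us)
    case 0
    show ?case by (simp add: tens_one)
  next
    case (Suc n)
    have "tens 1 (alt_sum (\<lambda>u r. radial_var u * alt_prod radial_var n r) us)
        = alt_sum (\<lambda>u r. tens 1 (radial_var u * alt_prod radial_var n r)) us"
      by (rule alt_sum_hom) (rule tens_diff_right)
    also have "\<dots> = alt_sum (\<lambda>u r. var u * alt_prod var n r) us"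
    proof (rule alt_sum_cong)
      fix u :: 'v and r
      have "tens 1 (radial_var u * alt_prod radial_var n r)
        = var u * tens 1 (alt_prod radial_var n r)"
        by (simp add: var_def tens_mult)
      then show "tens 1 (radial_var u * alt_prod radial_var n r) = var u * alt_prod var n r"
        by (simp add: Suc)
    qed
    finally show ?case by simp
  qed
  moreover have "tens a b = scal a * tens 1 b" for a and b :: "'v radial"
    by (simp add: scal_def tens_mult)
  ultimately show ?thesis
    unfolding wedgeB_def wedge_alt_prod tens_scaleR[symmetric] rscal_def by metis
qed

lemma alternating_wedgeB: "alternating wedgeB"
proof (rule alternatingI)
  fix us vs :: "'v list" and a b
  show "wedgeB (us @ a # b # vs) = - wedgeB (us @ b # a # vs)"
    unfolding wedgeB_alt_prod alternatingD[OF alternating_alt_prod, of _ _ us a b vs] by simp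
qed

lemma wedgeB_Nil [simp]: "wedgeB [] = 1"
  by (simp add: wedgeB_alt_prod rscal_def)

text \<open>Division of \<open>alt_prod_Cons\<close> by twice the factorial of n + 1 turns both
  integer factors into the normalizations of the shorter wedges. Only 1/2 survives, independently of
  the length. The action \<open>rvar\<close> is modelled on this recursion.\<close>

lemma wedgeB_Cons:
  "wedgeB (v # us) = var v * wedgeB us
    - rscal (1 / 2) * alt_sum (\<lambda>u r. of_central (anticomm (Upair v u)) * wedgeB r) us"
proof -
  let ?n = "length us"
  let ?S = "alt_sum (\<lambda>u r. of_central (anticomm (Upair v u)) * alt_prod var (?n - 1) r) us"
  have comm: "rscal a * z = z * rscal a" for a and z :: "'a radialB"
    unfolding rscal_def by (rule scal_central)
  have "2 * alt_prod var (Suc ?n) (v # us)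
      = of_nat (2 * Suc ?n) * (var v * alt_prod var ?n us) - of_nat (?n * Suc ?n) * ?S"
    unfolding of_central_anticomm by (rule alt_prod_Cons) (rule var_central)
  then have "rscal (1 / fact (Suc ?n) / 2) * (2 * alt_prod var (Suc ?n) (v # us))
     = rscal (1 / fact (Suc ?n) / 2) * rscal (of_nat (2 * Suc ?n)) * (var v * alt_prod var ?n us)
      - rscal (1 / fact (Suc ?n) / 2) * rscal (of_nat (?n * Suc ?n)) * ?S"
    unfolding rscal_of_nat by (simp only: right_diff_distrib mult.assoc)
  also have "rscal (1 / fact (Suc ?n) / 2) * (2 * alt_prod var (Suc ?n) (v # us))
      = rscal (1 / fact (Suc ?n) / 2) * rscal (of_nat 2) * alt_prod var (Suc ?n) (v # us)"
    unfolding rscal_of_nat by (simp add: mult.assoc)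
  also have "\<dots> = wedgeB (v # us)"
    unfolding wedgeB_alt_prod rscal_mult by simp
  also have "rscal (1 / fact (Suc ?n) / 2) * rscal (of_nat (2 * Suc ?n)) * (var v * alt_prod var ?n us)
      = var v * wedgeB us"
  proof -
    have "1 / fact (Suc ?n) / 2 * of_nat (2 * Suc ?n) = (1 / fact ?n :: real)"
      by (simp only: fact_Suc of_nat_mult) (simp del: of_nat_Suc)
    then show ?thesis
      unfolding rscal_mult wedgeB_alt_prod by (metis comm mult.assoc)
  qed
  also have "rscal (1 / fact (Suc ?n) / 2) * rscal (of_nat (?n * Suc ?n)) * ?S
      = rscal (1 / 2) * alt_sum (\<lambda>u r. of_central (anticomm (Upair v u)) * wedgeB r) us"
  proof (cases "?n")
    case (Suc m)
    \<comment> \<open>For n = m + 1 the factor n(n+1) / (2 (n+1)!) is 1 / (2 m!), and m is the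
      length of the lists that remain after a removal. For n = 0 the sum is empty.\<close>
    have "1 / fact (Suc ?n) / 2 * of_nat (?n * Suc ?n) = (1 / 2 * (1 / fact m) :: real)"
      unfolding Suc by (simp only: fact_Suc of_nat_mult) (simp del: of_nat_Suc)
    then have "rscal (1 / fact (Suc ?n) / 2) * rscal (of_nat (?n * Suc ?n)) * ?S
        = rscal (1 / 2) * (rscal (1 / fact m) * ?S)"
      unfolding rscal_mult by (simp only: rscal_mult[symmetric] mult.assoc)
    also have "rscal (1 / fact m) * ?S
       = alt_sum (\<lambda>u r. rscal (1 / fact m) * (of_central (anticomm (Upair v u)) * alt_prod var (?n - 1) r)) us"
      by (rule alt_sum_hom) (rule right_diff_distrib)
    also have "\<dots> = alt_sum (\<lambda>u r. of_central (anticomm (Upair v u)) * wedgeB r) us"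
    proof (rule alt_sum_cong)
      fix u r
      assume "mset us = add_mset u (mset r)"
      then have "length r = m" using Suc by (metis Suc_inject size_add_mset size_mset)
      then show "rscal (1 / fact m) * (of_central (anticomm (Upair v u)) * alt_prod var (?n - 1) r)
          = of_central (anticomm (Upair v u)) * wedgeB r"
        unfolding wedgeB_alt_prod Suc mult.assoc[symmetric] by (simp add: comm)
    qed
    finally show ?thesis .
  qed simp
  finally show ?thesis .
qed

section \<open>A faithful right action on alternating functions\<close>

text \<open>The indeterminate indexed by the pair of \<open>u\<close> and \<open>w\<close> stands for the anticommutator
  \<open>{u, w}\<close>. The one indexed by the pair of \<open>x\<close> and \<open>x\<close> is therefore \<open>2 r\<close>, which is where the powers
  of two below come from.\<close>

type_synonym 'v pol = "('v uprod \<Rightarrow>\<^sub>0 nat) \<Rightarrow>\<^sub>0 coeff"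

definition pvar :: "'v uprod \<Rightarrow> 'v pol" where
  "pvar k = single (single k 1) 1"

definition pconst :: "coeff \<Rightarrow> 'v pol" where
  "pconst b = single 0 b"

lemma pconst_add: "pconst (a + b) = pconst a + pconst b"
  and pconst_mult: "pconst (a * b) = pconst a * pconst b"
  and pconst_one [simp]: "pconst 1 = 1" and pconst_zero [simp]: "pconst 0 = 0"
  by (simp_all add: pconst_def single_add mult_single)

abbreviation half :: "'v pol" where
  "half \<equiv> pconst ((1 / 2) *\<^sub>R 1)"

lemma half_add: "half * a + half * a = a"
proof -
  have "half + half = (1 :: 'a pol)"
    unfolding pconst_add[symmetric] by (simp flip: scaleR_add_left)
  then show ?thesis by (simp flip: distrib_right)
qed

lemma alternating_add:
  assumes "alternating \<phi>" "alternating \<psi>"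
  shows "alternating (\<lambda>us. \<phi> us + \<psi> us)"
proof (rule alternatingI)
  fix us a b vs
  show "\<phi> (us @ a # b # vs) + \<psi> (us @ a # b # vs) = - (\<phi> (us @ b # a # vs) + \<psi> (us @ b # a # vs))"
    unfolding alternatingD[OF assms(1), of us a b vs] alternatingD[OF assms(2), of us a b vs] by simp
qed

lemma alternating_uminus:
  assumes "alternating \<phi>"
  shows "alternating (\<lambda>us. - \<phi> us)"
proof (rule alternatingI)
  fix us a b vs
  show "- \<phi> (us @ a # b # vs) = - (- \<phi> (us @ b # a # vs))"
    unfolding alternatingD[OF assms(1), of us a b vs] by simp
qed

lifting_forget coeff.lifting
lifting_forget uprod.lifting
lifting_forget poly_mapping.lifting

section \<open>The module of alternating functions and its operators\<close>

typedef 'v altf = "{\<phi> :: 'v list \<Rightarrow> 'v pol. alternating \<phi>}"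
  by (rule exI[of _ "\<lambda>_. 0"]) (simp add: alternating_def)

setup_lifting type_definition_altf

instantiation altf :: (type) ab_group_add
begin
lift_definition zero_altf :: "'a altf" is "\<lambda>_. 0" by (simp add: alternating_def)
lift_definition plus_altf :: "'a altf \<Rightarrow> 'a altf \<Rightarrow> 'a altf" is "\<lambda>\<phi> \<psi> us. \<phi> us + \<psi> us"
  by (rule alternating_add)
lift_definition uminus_altf :: "'a altf \<Rightarrow> 'a altf" is "\<lambda>\<phi> us. - \<phi> us"
  by (rule alternating_uminus)
definition minus_altf :: "'a altf \<Rightarrow> 'a altf \<Rightarrow> 'a altf" where "minus_altf a b = a + - b"
instance
proof
  fix a b c :: "'a altf"
  show "a + b + c = a + (b + c)" by transfer (simp add: add.assoc)
  show "a + b = b + a" by transfer (simp add: add.commute)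
  show "0 + a = a" by transfer simp
  show "- a + a = 0" by transfer simp
  show "a - b = a + - b" by (rule minus_altf_def)
qed
end

lift_definition smul :: "'v pol \<Rightarrow> 'v altf \<Rightarrow> 'v altf" is "\<lambda>p \<phi> us. p * \<phi> us"
  by (rule alternating_mult_left)

lemma smul_simps:
  "smul p (a + b) = smul p a + smul p b" "smul (p + q) a = smul p a + smul q a"
  "smul p (smul q a) = smul (p * q) a" "smul 1 a = a" "smul 0 a = 0"
  by (transfer; simp add: algebra_simps)+

lemma smul_minus: "smul p (- a) = - smul p a"
  by transfer simp

text \<open>The transpose of left multiplication by \<open>v\<close> on wedges:
  \<open>wedgeB_Cons\<close> solved for \<open>var v * wedgeB us\<close>, with \<phi> in place of
  the wedge and indeterminates in place of the anticommutators.\<close>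

lift_definition rvar :: "'v \<Rightarrow> 'v altf \<Rightarrow> 'v altf" is
  "\<lambda>v \<phi> us. \<phi> (v # us) + half * alt_sum (\<lambda>u r. pvar (Upair v u) * \<phi> r) us"
  by (intro alternating_add alternating_Cons alternating_mult_left alternating_alt_sum)

lemma alt_sum_mult_left: "alt_sum (\<lambda>u r. c * f u r) us = c * alt_sum f us" for c :: "'r::ring"
  by (rule alt_sum_hom[symmetric]) (rule right_diff_distrib)

lemma rvar_add: "rvar v (a + b) = rvar v a + rvar v b"
  by transfer (simp add: algebra_simps alt_sum_add)

lemma rvar_smul: "rvar v (smul p a) = smul p (rvar v a)"
proof transfer
  fix v :: 'v and p :: "'v pol" and \<phi> :: "'v list \<Rightarrow> 'v pol"
  have "alt_sum (\<lambda>u r. pvar (Upair v u) * (p * \<phi> r)) us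
      = p * alt_sum (\<lambda>u r. pvar (Upair v u) * \<phi> r) us" for us
    unfolding alt_sum_mult_left[symmetric] by (rule alt_sum_cong) (rule mult.left_commute)
  then show "(\<lambda>us. p * \<phi> (v # us) + half * alt_sum (\<lambda>u r. pvar (Upair v u) * (p * \<phi> r)) us)
      = (\<lambda>us. p * (\<phi> (v # us) + half * alt_sum (\<lambda>u r. pvar (Upair v u) * \<phi> r) us))"
    by (simp add: algebra_simps)
qed

text \<open>The Clifford relation. The prepending parts cancel because \<phi> alternates, the double
  contractions cancel by \<open>alt_sum_swap\<close>, and of the mixed terms only two halves of one
  indeterminate remain; they agree because the pair is unordered.\<close>

lemma rvar_anticommute:
  fixes a :: "'v altf"
  shows "rvar w (rvar u a) + rvar u (rvar w a) = smul (pvar (Upair u w)) a"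
proof (rule Rep_altf_inject[THEN iffD1])
  define \<phi> where "\<phi> = Rep_altf a"
  have \<phi>: "alternating \<phi>" using Rep_altf[of a] by (simp add: \<phi>_def)
  define S where "S v \<phi> us = alt_sum (\<lambda>a r. pvar (Upair v a) * \<phi> r) us"
    for v and \<phi> :: "'v list \<Rightarrow> 'v pol" and us
  define T where "T u w us = alt_sum (\<lambda>a r. alt_sum (\<lambda>b s. pvar (Upair w a) * (pvar (Upair u b) * \<phi> s)) r) us"
    for u w us
  have S_S: "S w (\<lambda>us. \<phi> (u # us) + half * S u \<phi> us) us
      = S w (\<lambda>us. \<phi> (u # us)) us + half * T u w us" for u w us
  proof -
    have "S w (\<lambda>us. half * f us) us = half * S w f us" for f
      unfolding S_def alt_sum_mult_left[symmetric] by (rule alt_sum_cong) (rule mult.left_commute)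
    moreover have "S w (S u \<phi>) us = T u w us"
      unfolding S_def T_def by (intro alt_sum_cong) (rule alt_sum_mult_left[symmetric])
    ultimately show ?thesis by (simp add: S_def distrib_left alt_sum_add)
  qed
  have S_Cons: "S u \<phi> (w # us) = pvar (Upair u w) * \<phi> us - S u (\<lambda>us. \<phi> (w # us)) us" for u w us
    by (simp add: S_def)
  have T_swap: "T u w us = - T w u us" for us
    unfolding T_def
    by (subst alt_sum_swap) (simp add: mult.left_commute)
  have "\<phi> (u # w # us) + half * S u \<phi> (w # us) + half * S w (\<lambda>us. \<phi> (u # us) + half * S u \<phi> us) us
    + (\<phi> (w # u # us) + half * S w \<phi> (u # us) + half * S u (\<lambda>us. \<phi> (w # us) + half * S w \<phi> us) us)
    = pvar (Upair u w) * \<phi> us" for us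
  proof -
    have "Upair w u = Upair u w" by simp
    then show ?thesis
      unfolding S_S S_Cons T_swap[of us]
      using alternatingD[OF \<phi>, of "[]" u w us] half_add[of "pvar (Upair u w) * \<phi> us"]
      by (simp only: append_Nil) (simp add: distrib_left right_diff_distrib)
  qed
  then show "Rep_altf (rvar w (rvar u a) + rvar u (rvar w a)) = Rep_altf (smul (pvar (Upair u w)) a)"
    by (intro ext) (simp only: plus_altf.rep_eq rvar.rep_eq smul.rep_eq S_def \<phi>_def)
qed

text \<open>Linearity over all polynomials makes every \<open>epol p\<close> central, which is
  exactly what the defining relations of the radial algebra demand of anticommutators.\<close>

typedef 'v endo = "{f :: 'v altf \<Rightarrow> 'v altf. (\<forall>a b. f (a + b) = f a + f b) \<and> (\<forall>p a. f (smul p a) = smul p (f a))}"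
  by (rule exI[of _ id]) simp

setup_lifting type_definition_endo

text \<open>The vacuum vector: it shows that \<open>0\<close> and \<open>1\<close> differ in
  \<open>endo\<close>, and acting on it recovers a polynomial from the scalar that it represents
  (\<open>tauB_inj\<close>).\<close>

lift_definition delta_nil :: "'v altf" is "\<lambda>us. if us = [] then 1 else 0"
  by (rule alternatingI) simp

text \<open>Products are composed in reversed order, so that the radial algebra acts from the right.\<close>

instantiation endo :: (type) ring_1
begin
lift_definition zero_endo :: "'a endo" is "\<lambda>_. 0"
  by (simp add: smul_simps(5)) (transfer, simp)
lift_definition one_endo :: "'a endo" is "\<lambda>a. a" by simp
lift_definition plus_endo :: "'a endo \<Rightarrow> 'a endo \<Rightarrow> 'a endo" is "\<lambda>f g a. f a + g a"
  by (simp add: algebra_simps smul_simps)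
lift_definition uminus_endo :: "'a endo \<Rightarrow> 'a endo" is "\<lambda>f a. - f a"
  by (simp add: smul_minus)
definition minus_endo :: "'a endo \<Rightarrow> 'a endo \<Rightarrow> 'a endo" where "minus_endo f g = f + - g"
lift_definition times_endo :: "'a endo \<Rightarrow> 'a endo \<Rightarrow> 'a endo" is "\<lambda>f g a. g (f a)" by simp
instance
proof
  fix a b c :: "'a endo"
  show "a + b + c = a + (b + c)" by transfer (simp add: add.assoc)
  show "a + b = b + a" by transfer (simp add: add.commute)
  show "0 + a = a" by transfer simp
  show "- a + a = 0" by transfer simp
  show "a - b = a + - b" by (rule minus_endo_def)
  show "a * b * c = a * (b * c)" by transfer simp
  show "1 * a = a" by transfer simp
  show "a * 1 = a" by transfer simp
  show "(a + b) * c = a * c + b * c" by transfer simp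
  show "a * (b + c) = a * b + a * c" by transfer simp
  have "Rep_altf (delta_nil :: 'a altf) [] \<noteq> Rep_altf 0 []"
    by (simp add: delta_nil.rep_eq zero_altf.rep_eq)
  then have "(delta_nil :: 'a altf) \<noteq> 0" by metis
  then show "(0 :: 'a endo) \<noteq> 1"
    by transfer (auto dest: fun_cong[where x = delta_nil])
qed
end

lift_definition evar :: "'v \<Rightarrow> 'v endo" is rvar
  by (simp add: rvar_add rvar_smul)

lift_definition epol :: "'v pol \<Rightarrow> 'v endo" is smul
  by (simp add: smul_simps mult.commute)

lemma epol_commute: "epol p * f = f * epol p"
  by transfer simp

lemma epol_add: "epol (p + p') = epol p + epol p'"
  and epol_mult: "epol (p * p') = epol p * epol p'"
  and epol_one: "epol 1 = 1" and epol_zero: "epol 0 = 0"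
  by (transfer; simp add: smul_simps mult.commute fun_eq_iff)+

lemma evar_anticommute: "evar u * evar w + evar w * evar u = epol (pvar (Upair u w))"
  by transfer (simp add: rvar_anticommute fun_eq_iff)

fun word_act :: "'v word_monoid \<Rightarrow> 'v endo" where
  "word_act (Wd ws) = prod_list (map evar ws)"

section \<open>Descent of the action through both quotients\<close>

interpretation free: pm_hom "\<lambda>c. epol (pconst (c *\<^sub>R 1))" word_act
proof
  fix k l :: "'v word_monoid" and a b :: real
  show "word_act (k + l) = word_act k * word_act l" by (cases k; cases l) simp
  show "epol (pconst ((a * b) *\<^sub>R 1)) = epol (pconst (a *\<^sub>R 1)) * epol (pconst (b *\<^sub>R 1))"
    by (simp add: epol_mult[symmetric] pconst_mult[symmetric] mult.commute)
qed (simp_all add: zero_word_monoid_def epol_one epol_commute epol_add[symmetric]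
    pconst_add[symmetric] scaleR_add_left)

definition free_act :: "'v free_algebra \<Rightarrow> 'v endo" where
  "free_act = pm_eval (\<lambda>c. epol (pconst (c *\<^sub>R 1))) word_act"

lemma free_act_simps:
  "free_act (f + g) = free_act f + free_act g" "free_act (f * g) = free_act f * free_act g"
  "free_act 1 = 1" "free_act 0 = 0" "free_act (free_var v) = evar v"
  "free_act (single 0 c) = epol (pconst (c *\<^sub>R 1))"
  unfolding free_act_def free_var_def
  by (simp_all add: free.eval_add free.eval_mult free.eval_one free.eval_zero free.eval_single
      epol_one zero_word_monoid_def)

lemma free_act_diff: "free_act (f - g) = free_act f - free_act g"
  using free_act_simps(1)[of "f - g" g] by simp

text \<open>Anticommutators of variables act as polynomials, and these commute with every
  endomorphism.\<close>

lemma free_act_ideal: "f \<in> two_sided_ideal radial_relations \<Longrightarrow> free_act f = 0"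
proof (induction rule: two_sided_ideal.induct)
  case (gen f)
  then obtain u v w where f: "f = commutator (anticommutator (free_var u) (free_var v)) (free_var w)"
    by (auto simp: radial_relations_def)
  show ?case
    unfolding f commutator_def anticommutator_def free_act_diff free_act_simps evar_anticommute
    by (simp add: epol_commute)
qed (simp_all add: free_act_simps)

lift_definition ract :: "'v radial \<Rightarrow> 'v endo" is free_act
  using free_act_ideal free_act_diff by (metis eq_iff_diff_eq_0 ideal_cong_def)

lemma ract_add: "ract (a + b) = ract a + ract b"
  and ract_mult: "ract (a * b) = ract a * ract b"
  and ract_one: "ract 1 = 1"
  and ract_var: "ract (radial_var v) = evar v"
  and ract_scaleR: "ract (c *\<^sub>R a) = epol (pconst (c *\<^sub>R 1)) * ract a"
  by (transfer; simp add: free_act_simps)+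

fun pair_act :: "(coeff, 'v radial) pair_monoid \<Rightarrow> 'v endo" where
  "pair_act (Pr a b) = epol (pconst a) * ract b"

interpretation pair: pm_hom "of_int :: int \<Rightarrow> 'v endo" pair_act
proof
  fix k l :: "(coeff, 'v radial) pair_monoid" and c :: int
  show "pair_act (k + l) = pair_act k * pair_act l"
  proof (cases k; cases l)
    fix a a' :: coeff and b b' :: "'v radial"
    assume kl: "k = Pr a b" "l = Pr a' b'"
    have "epol (pconst a) * (epol (pconst a') * (ract b * ract b'))
        = epol (pconst a) * (ract b * (epol (pconst a') * ract b'))"
      by (metis epol_commute mult.assoc)
    then show ?thesis unfolding kl by (simp add: epol_mult pconst_mult ract_mult mult.assoc)
  qed
  show "pair_act k * of_int c = of_int c * pair_act k" by (rule mult_of_int_commute[symmetric])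
qed (simp_all add: zero_pair_monoid_def epol_one ract_one)

definition pair_eval_act :: "(coeff, 'v radial) pair_ring \<Rightarrow> 'v endo" where
  "pair_eval_act = pm_eval of_int pair_act"

lemma pair_eval_act_simps:
  "pair_eval_act (f + g) = pair_eval_act f + pair_eval_act g"
  "pair_eval_act (f * g) = pair_eval_act f * pair_eval_act g"
  "pair_eval_act 1 = 1" "pair_eval_act 0 = 0"
  "pair_eval_act (pair_gen a b) = epol (pconst a) * ract b"
  unfolding pair_eval_act_def pair_gen_def
  by (simp_all add: pair.eval_add pair.eval_mult pair.eval_one pair.eval_zero pair.eval_single)

lemma pair_eval_act_diff: "pair_eval_act (f - g) = pair_eval_act f - pair_eval_act g"
  using pair_eval_act_simps(1)[of "f - g" g] by simp

lemma epol_scaleR: "epol (pconst (c *\<^sub>R a)) = epol (pconst a) * epol (pconst (c *\<^sub>R 1))"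
  unfolding epol_mult[symmetric] pconst_mult[symmetric] by simp

lemma pair_eval_act_ideal: "f \<in> two_sided_ideal tensor_relations \<Longrightarrow> pair_eval_act f = 0"
proof (induction rule: two_sided_ideal.induct)
  case (gen f)
  then show ?case
    unfolding tensor_relations_def
  proof (elim UnE CollectE exE conjE)
    fix a a' b
    assume f: "f = pair_gen (a + a') b - pair_gen a b - pair_gen a' b"
    show ?thesis
      unfolding f by (simp add: pair_eval_act_diff pair_eval_act_simps pconst_add epol_add algebra_simps)
  next
    fix a b b'
    assume f: "f = pair_gen a (b + b') - pair_gen a b - pair_gen a b'"
    show ?thesis
      unfolding f by (simp add: pair_eval_act_diff pair_eval_act_simps ract_add algebra_simps)
  next
    fix a b and c :: real
    assume f: "f = pair_gen (c *\<^sub>R a) b - pair_gen a (c *\<^sub>R b)"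
    show ?thesis
      unfolding f pair_eval_act_diff pair_eval_act_simps ract_scaleR epol_scaleR[of c a]
      by (simp add: mult.assoc)
  qed
qed (simp_all add: pair_eval_act_simps)

lift_definition act :: "'v radialB \<Rightarrow> 'v endo" is pair_eval_act
  using pair_eval_act_ideal pair_eval_act_diff by (metis eq_iff_diff_eq_0 ideal_cong_def)

lemma act_add: "act (F + G) = act F + act G"
  and act_mult: "act (F * G) = act F * act G"
  and act_one: "act 1 = 1" and act_zero: "act 0 = 0"
  and act_tens: "act (tens a b) = epol (pconst a) * ract b"
  by (transfer; simp add: pair_eval_act_simps)+

lemma act_scal: "act (scal b) = epol (pconst b)"
  and act_var: "act (var v) = evar v"
  by (simp_all add: scal_def var_def act_tens ract_one ract_var epol_one)

lemma act_anticomm: "act (of_central (anticomm k)) = epol (pvar k)"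
  by (cases k) (simp add: of_central_anticomm act_add act_mult act_var evar_anticommute)

section \<open>Polynomials as central scalars\<close>

lift_definition scal_c :: "coeff \<Rightarrow> 'v radialB central" is scal
  by (rule scal_central)

definition monom_c :: "('v uprod \<Rightarrow>\<^sub>0 nat) \<Rightarrow> 'v radialB central" where
  "monom_c m = (\<Prod>k\<in>keys m. anticomm k ^ lookup m k)"

lemma monom_c_add: "monom_c (m + m') = monom_c m * monom_c m'"
proof -
  let ?A = "keys m \<union> keys m'"
  have sup: "monom_c n = (\<Prod>k\<in>?A. anticomm k ^ lookup n k)"
    if "keys n \<subseteq> ?A" for n
    unfolding monom_c_def
    by (rule prod.mono_neutral_left) (use that in \<open>auto simp: in_keys_iff\<close>)
  show ?thesis
    using keys_add[of m m'] by (simp add: sup lookup_add power_add prod.distrib)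
qed

lemma monom_c_single: "monom_c (single k n) = anticomm k ^ n"
  by (simp add: monom_c_def)

interpretation tau: pm_hom scal_c monom_c
proof
  fix a b :: coeff
  show "scal_c (a + b) = (scal_c a + scal_c b :: 'v radialB central)"
    by transfer (rule scal_add)
  show "scal_c (a * b) = (scal_c a * scal_c b :: 'v radialB central)"
    by transfer (rule scal_mult)
  show "scal_c 1 = (1 :: 'v radialB central)"
    by transfer (rule scal_one)
  show "monom_c 0 = (1 :: 'v radialB central)"
    by (simp add: monom_c_def)
qed (simp_all add: monom_c_add mult.commute)

text \<open>The substitution of anticommutators for indeterminates. Values lie in the type of
  central elements so that \<open>tau\<close> is a homomorphism of commutative rings and transports
  determinants; \<open>tauB\<close> is the same map seen in the whole algebra.\<close>

definition tau :: "'v pol \<Rightarrow> 'v radialB central" where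
  "tau = pm_eval scal_c monom_c"

definition tauB :: "'v pol \<Rightarrow> 'v radialB" where
  "tauB p = of_central (tau p)"

lemma tauB_add: "tauB (p + p') = tauB p + tauB p'"
  and tauB_mult: "tauB (p * p') = tauB p * tauB p'"
  and tauB_one [simp]: "tauB 1 = 1" and tauB_zero [simp]: "tauB 0 = 0"
  and tauB_pvar: "tauB (pvar k) = of_central (anticomm k)"
  and tauB_pconst: "tauB (pconst b) = scal b"
  unfolding tauB_def tau_def pvar_def pconst_def
  by (simp_all add: tau.eval_add tau.eval_mult tau.eval_one tau.eval_zero tau.eval_single
      of_central_hom tau.h_one monom_c_single tau.g_zero scal_c.rep_eq)

lemma tauB_minus: "tauB (- p) = - tauB p"
  using tauB_add[of "- p" p] by (simp add: eq_neg_iff_add_eq_0)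

lemma tauB_diff: "tauB (p - p') = tauB p - tauB p'"
  using tauB_add[of "p - p'" p'] by simp

lemma tauB_power: "tauB (p ^ n) = tauB p ^ n"
  by (induction n) (simp_all add: tauB_mult)

lemma tauB_sum: "tauB (sum f A) = (\<Sum>a\<in>A. tauB (f a))"
  by (induction A rule: infinite_finite_induct) (simp_all add: tauB_add)

lemma tauB_commute: "tauB p * F = F * tauB p"
  by (simp add: tauB_def of_central_commute)

lemma pvar_power: "pvar k ^ n = single (single k n) 1"
  by (induction n) (simp_all add: pvar_def mult_single flip: single_add)

lemma act_tauB: "act (tauB p) = epol p"
proof (induction p rule: poly_mapping_sum_induct)
  case (single m c)
  have "act (of_central (monom_c m)) = epol (single m 1)"
  proof (induction m rule: poly_mapping_sum_induct)
    case (single k n)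
    have "act (of_central (anticomm k ^ n)) = epol (pvar k ^ n)"
      by (induction n) (simp_all add: of_central_hom act_one act_mult act_anticomm epol_one epol_mult)
    then show ?case by (simp add: monom_c_single pvar_power)
  next
    case (sum m m')
    have "single (m + m') (1::coeff) = single m 1 * single m' 1"
      by (simp add: mult_single)
    with sum show ?case by (simp add: monom_c_add of_central_hom act_mult epol_mult)
  qed
  moreover have "tauB (single m c) = scal c * of_central (monom_c m)"
    unfolding tauB_def tau_def by (simp add: tau.eval_single of_central_hom scal_c.rep_eq)
  moreover have "single m c = pconst c * single m 1"
    by (simp add: pconst_def mult_single)
  ultimately show ?case by (simp add: act_mult act_scal epol_mult)
next
  case (sum f g)
  then show ?case by (simp add: tauB_add act_add epol_add)
qed

text \<open>A coefficient functional: for \<phi> = \<open>delta J\<close> it returns the coefficient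
  of \<open>wedgeB J\<close> (\<open>ev_canonical\<close>).\<close>

definition ev :: "'v altf \<Rightarrow> 'v radialB \<Rightarrow> 'v pol" where
  "ev \<phi> F = Rep_altf (Rep_endo (act F) \<phi>) []"

lemma ev_add: "ev \<phi> (F + G) = ev \<phi> F + ev \<phi> G"
  by (simp add: ev_def act_add plus_endo.rep_eq plus_altf.rep_eq)

lemma ev_zero [simp]: "ev \<phi> 0 = 0"
  using ev_add[of \<phi> 0 0] by simp

lemma ev_diff: "ev \<phi> (F - G) = ev \<phi> F - ev \<phi> G"
  using ev_add[of \<phi> "F - G" G] by simp

lemma ev_sum: "ev \<phi> (sum f A) = (\<Sum>a\<in>A. ev \<phi> (f a))"
  by (induction A rule: infinite_finite_induct) (simp_all add: ev_add)

lemma ev_mult: "ev \<phi> (F * G) = ev (Rep_endo (act F) \<phi>) G"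
  by (simp add: ev_def act_mult times_endo.rep_eq)

lemma ev_tauB: "ev \<phi> (F * tauB p) = p * ev \<phi> F"
  by (simp add: ev_def act_mult times_endo.rep_eq act_tauB epol.rep_eq smul.rep_eq)

lemma ev_tauB_left: "ev \<phi> (tauB p * F) = p * ev \<phi> F"
  by (simp add: tauB_commute ev_tauB)

text \<open>The contractions in \<open>wedgeB_Cons\<close> and in \<open>rvar\<close> cancel and the
  prepended letter remains. The induction is on the length, because a contraction removes a letter
  from the interior of the list.\<close>

lemma ev_wedgeB: "ev \<phi> (wedgeB us) = Rep_altf \<phi> us"
proof (induction us arbitrary: \<phi> rule: length_induct)
  case (1 us)
  show ?case
  proof (cases us)
    case Nil
    then show ?thesis by (simp add: ev_def act_one one_endo.rep_eq)
  next
    case (Cons v vs)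
    have "ev \<phi> (alt_sum (\<lambda>u r. of_central (anticomm (Upair v u)) * wedgeB r) vs)
        = alt_sum (\<lambda>u r. ev \<phi> (of_central (anticomm (Upair v u)) * wedgeB r)) vs"
      by (rule alt_sum_hom) (rule ev_diff)
    also have "\<dots> = alt_sum (\<lambda>u r. pvar (Upair v u) * Rep_altf \<phi> r) vs"
    proof (rule alt_sum_cong)
      fix u r
      assume "mset vs = add_mset u (mset r)"
      then have "length r < length us" using Cons by (metis length_Cons less_SucI less_Suc_eq size_add_mset size_mset)
      with 1 show "ev \<phi> (of_central (anticomm (Upair v u)) * wedgeB r) = pvar (Upair v u) * Rep_altf \<phi> r"
        by (simp add: tauB_pvar[symmetric] ev_tauB_left)
    qed
    finally have "ev \<phi> (rscal (1 / 2) * alt_sum (\<lambda>u r. of_central (anticomm (Upair v u)) * wedgeB r) vs)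
       = half * alt_sum (\<lambda>u r. pvar (Upair v u) * Rep_altf \<phi> r) vs"
      by (simp add: rscal_def tauB_pconst[symmetric] ev_tauB_left)
    moreover have "ev \<phi> (var v * wedgeB vs) = Rep_altf (rvar v \<phi>) vs"
      using 1 Cons by (simp add: ev_mult act_var evar.rep_eq)
    ultimately show ?thesis
      unfolding Cons wedgeB_Cons ev_diff by (simp add: rvar.rep_eq)
  qed
qed

lemma tauB_inj:
  fixes p p' :: "'v pol"
  shows "tauB p = tauB p' \<Longrightarrow> p = p'"
  using ev_tauB[of "delta_nil :: 'v altf" 1 p] ev_tauB[of delta_nil 1 p']
    ev_wedgeB[of "delta_nil :: 'v altf" "[]"]
  by (simp add: delta_nil.rep_eq)

text \<open>A determinant of Kronecker deltas expanded along the first entry of \<open>I\<close>,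
  that is, for distinct \<open>I\<close> the sign of the rearrangement from \<open>I\<close> to
  \<open>us\<close> and 0 if there is none. In this form it alternates by
  \<open>alternating_alt_sum\<close>.\<close>

fun delta_fun :: "'v list \<Rightarrow> 'v list \<Rightarrow> 'v pol" where
  "delta_fun [] us = (if us = [] then 1 else 0)"
| "delta_fun (v # I) us = alt_sum (\<lambda>u r. if u = v then delta_fun I r else 0) us"

lift_definition delta :: "'v list \<Rightarrow> 'v altf" is delta_fun
proof -
  fix I :: "'v list"
  show "alternating (delta_fun I)"
  proof (induction I)
    case Nil
    show ?case by (rule alternatingI) simp
  next
    case (Cons v I)
    have "alternating (alt_sum (\<lambda>u r. if u = v then delta_fun I r else 0))"
    proof (rule alternating_alt_sum)
      fix u
      show "alternating (\<lambda>r. if u = v then delta_fun I r else 0)"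
        using Cons by (cases "u = v") (auto intro: alternatingI)
    qed
    then show ?case by (simp add: fun_eq_iff[symmetric])
  qed
qed

lemma delta_fun_eq_zero: "mset us \<noteq> mset I \<Longrightarrow> delta_fun I us = 0"
proof (induction I arbitrary: us)
  case (Cons v I)
  have "alt_sum (\<lambda>u r. if u = v then delta_fun I r else 0) us = alt_sum (\<lambda>u r. 0) us"
    by (rule alt_sum_cong) (use Cons in auto)
  then show ?case by simp
qed simp

lemma delta_fun_self: "distinct I \<Longrightarrow> delta_fun I I = 1"
proof (induction I)
  case (Cons v I)
  have "alt_sum (\<lambda>u r. if u = v then delta_fun I (v # r) else 0) I = alt_sum (\<lambda>u r. 0) I"
    by (rule alt_sum_cong) (use Cons.prems in \<open>auto dest: mset_eq_setD[of _ "_ # _", simplified]\<close>)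
  with Cons show ?case by simp
qed simp

section \<open>Jackson operators on the scalars\<close>

lemma lookup_pconst_mult: "lookup (pconst b * f) m = b * lookup f m"
  by (induction f rule: poly_mapping_sum_induct)
     (auto simp: pconst_def mult_single lookup_single when_def distrib_left lookup_add)

lemma lookup_mono_mult:
  fixes f :: "'v pol"
  shows "lookup (single n 1 * f) (n + m) = lookup f m"
  by (induction f rule: poly_mapping_sum_induct)
     (auto simp: mult_single lookup_single when_def distrib_left lookup_add)

lemma lookup_pvar_mult_zero:
  fixes f :: "'v pol"
  assumes "lookup m k = 0"
  shows "lookup (pvar k * f) m = 0"
proof (induction f rule: poly_mapping_sum_induct)
  case (single n c)
  have "single k 1 + n \<noteq> m"
    using assms by (metis add_is_0 lookup_add lookup_single_eq one_neq_zero)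
  then show ?case by (simp add: pvar_def mult_single lookup_single)
qed (simp add: distrib_left lookup_add)

lemma split_monomial:
  fixes m :: "'k \<Rightarrow>\<^sub>0 nat"
  assumes "lookup m k \<noteq> 0"
  shows "single k 1 + (m - single k 1) = m"
  using assms
  by (intro poly_mapping_eqI) (auto simp: lookup_add lookup_minus lookup_single when_def)

section \<open>Polynomial models of the Jackson operators\<close>

definition q_nat :: "coeff \<Rightarrow> nat \<Rightarrow> coeff" where
  "q_nat P n = (\<Sum>i<n. P ^ i)"

definition shift :: "'v uprod \<Rightarrow> coeff \<Rightarrow> 'v pol \<Rightarrow> 'v pol" where
  "shift k P = Poly_Mapping.mapp (\<lambda>m c. P ^ lookup m k * c)"

text \<open>The Jackson difference quotient without a division: the exponent n of \<open>k\<close>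
  drops by one and the coefficient gains the q-number [n] for the parameter \<open>P\<close>.
  Pulling back along addition of one unit at \<open>k\<close> is what lowers the exponent.\<close>

definition qdiff :: "'v uprod \<Rightarrow> coeff \<Rightarrow> 'v pol \<Rightarrow> 'v pol" where
  "qdiff k P f = Poly_Mapping.map_key (\<lambda>m. single k 1 + m)
     (Poly_Mapping.mapp (\<lambda>m c. q_nat P (lookup m k) * c) f)"

lemma lookup_shift: "lookup (shift k P f) m
    = P ^ lookup m k * lookup f m"
  by (simp add: shift_def lookup_mapp when_def in_keys_iff)

lemma lookup_qdiff: "lookup (qdiff k P f) m
    = q_nat P (Suc (lookup m k)) * lookup f (single k 1 + m)"
  unfolding qdiff_def
  by (subst map_key.rep_eq) (auto simp: inj_def lookup_mapp when_def in_keys_iff lookup_add)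

lemma shift_add: "shift k P (f + g) = shift k P f + shift k P g"
  and qdiff_add: "qdiff k P (f + g) = qdiff k P f + qdiff k P g"
  by (rule poly_mapping_eqI; simp add: lookup_shift lookup_qdiff lookup_add distrib_left)+

lemma shift_single: "shift k P (single m c)
    = single m (P ^ lookup m k * c)"
  by (rule poly_mapping_eqI) (simp add: lookup_shift lookup_single when_def)

text \<open>At exponent 0 the truncated difference leaves \<open>m\<close> unchanged, but then
  \<open>q_nat P 0 = 0\<close> makes the term vanish.\<close>

lemma qdiff_single: "qdiff k P (single m c)
    = single (m - single k 1) (q_nat P (lookup m k) * c)"
proof (rule poly_mapping_eqI)
  fix n
  show "lookup (qdiff k P (single m c)) n = lookup
     (single (m - single k 1) (q_nat P (lookup m k) * c)) n"
  proof (cases "lookup m k = 0")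
    case True
    then have "m \<noteq> single k 1 + n"
      by (metis add_is_0 lookup_add lookup_single_eq one_neq_zero)
    with True show ?thesis by (simp add: lookup_qdiff lookup_single q_nat_def)
  next
    case False
    from split_monomial[OF this] have "m = single k 1 + n \<longleftrightarrow> m - single k 1 = n"
      by (metis add_left_cancel)
    then show ?thesis using False
      by (auto simp: lookup_qdiff lookup_single when_def lookup_add lookup_minus)
  qed
qed

lemma shift_mult: "shift k P (f * g) = shift k P f * shift k P g"
proof (induction f rule: poly_mapping_sum_induct)
  case (single m c)
  show ?case
  proof (induction g rule: poly_mapping_sum_induct)
    case (single m' c')
    show ?case by (simp add: mult_single shift_single lookup_add power_add ac_simps)
  qed (simp add: distrib_left shift_add)
qed (simp add: distrib_right shift_add)

lemma shift_pconst [simp]: "shift k P (pconst b) = pconst b"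
  by (simp add: pconst_def shift_single)

lemma shift_one [simp]: "shift k P 1 = 1"
  using shift_pconst[of k P 1] by (simp del: shift_pconst)

lemma shift_pvar: "shift k P (pvar l) = (if l = k then pconst P * pvar k else pvar l)"
  by (simp add: pvar_def shift_single pconst_def mult_single lookup_single)

text \<open>Coefficientwise the geometric sum (1 - P)(1 + P + ... + P^(n-1)) = 1 - P^n; at exponent
  0 both sides vanish.\<close>

lemma pvar_mult_qdiff: "pconst (1 - P) * (pvar k * qdiff k P f) = f - shift k P f"
proof (rule poly_mapping_eqI)
  fix m
  show "lookup (pconst (1 - P) * (pvar k * qdiff k P f)) m = lookup (f - shift k P f) m"
  proof (cases "lookup m k = 0")
    case True
    then show ?thesis
      by (simp add: lookup_pconst_mult lookup_pvar_mult_zero lookup_minus lookup_shift)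
  next
    case False
    let ?n = "m - single k 1"
    note m = split_monomial[OF False]
    have "lookup (pvar k * qdiff k P f) m = lookup (qdiff k P f) ?n"
      using lookup_mono_mult[of "single k 1" "qdiff k P f" ?n]
      unfolding m pvar_def .
    also have "\<dots> = q_nat P (lookup m k) * lookup f m"
      unfolding lookup_qdiff m using False by (simp add: lookup_minus)
    finally have "lookup (pconst (1 - P) * (pvar k * qdiff k P f)) m
        = (1 - P) * q_nat P (lookup m k) * lookup f m"
      by (simp only: lookup_pconst_mult mult.assoc)
    also have "(1 - P) * q_nat P (lookup m k) = 1 - P ^ lookup m k"
      by (simp only: q_nat_def one_diff_power_eq)
    finally show ?thesis by (simp add: lookup_minus lookup_shift left_diff_distrib)
  qed
qed

lemma pvar_mult_cancel: "pvar k * f = pvar k * g \<Longrightarrow> f = g"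
proof (rule poly_mapping_eqI)
  fix m
  assume "pvar k * f = pvar k * g"
  then show "lookup f m = lookup g m"
    using lookup_mono_mult[of "single k 1" f m]
      lookup_mono_mult[of "single k 1" g m] by (simp add: pvar_def)
qed

lemma pconst_mult_cancel: "b \<noteq> 0 \<Longrightarrow> pconst b * f = pconst b * g \<Longrightarrow> f = g"
  by (rule poly_mapping_eqI) (metis lookup_pconst_mult mult_left_cancel)

text \<open>Both sides agree after multiplication by \<open>1 - P\<close> and the indeterminate,
  where only multiplicativity of \<open>shift\<close> is involved; both factors can be
  cancelled.\<close>

lemma qdiff_mult_const:
  assumes "P \<noteq> 1" "shift k P t = t"
  shows "qdiff k P (t * f) = t * qdiff k P f"
proof (rule pvar_mult_cancel, rule pconst_mult_cancel)
  have "pconst (1 - P) * (pvar k * qdiff k P (t * f)) = t * (f - shift k P f)"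
    unfolding pvar_mult_qdiff by (simp add: shift_mult assms right_diff_distrib)
  also have "\<dots> = t * (pconst (1 - P) * (pvar k * qdiff k P f))"
    by (simp only: pvar_mult_qdiff)
  also have "\<dots> = pconst (1 - P) * (pvar k * (t * qdiff k P f))"
    by (simp only: ac_simps)
  finally show "pconst (1 - P) * (pvar k * qdiff k P (t * f)) = pconst (1 - P) * (pvar k * (t * qdiff k P f))" .
qed (use assms in simp)

definition pol_on :: "'v uprod set \<Rightarrow> 'v pol set" where
  "pol_on K = {p. \<forall>m\<in>keys p. keys m \<subseteq> K}"

lemma pol_on_single: "keys m \<subseteq> K \<Longrightarrow> single m c \<in> pol_on K"
  by (auto simp: pol_on_def)

lemma pol_on_add: "p \<in> pol_on K \<Longrightarrow> p' \<in> pol_on K \<Longrightarrow> p + p' \<in> pol_on K"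
  using keys_add[of p p'] by (auto simp: pol_on_def)

lemma pol_on_zero [simp]: "0 \<in> pol_on K"
  by (simp add: pol_on_def)

lemma pol_on_pconst [simp]: "pconst b \<in> pol_on K"
  by (simp add: pol_on_single pconst_def)

lemma pol_on_one [simp]: "1 \<in> pol_on K"
  using pol_on_pconst[of 1] by simp

lemma pol_on_pvar: "k \<in> K \<Longrightarrow> pvar k \<in> pol_on K"
  by (simp add: pvar_def pol_on_single)

lemma pol_on_sum: "(\<And>a. a \<in> A \<Longrightarrow> f a \<in> pol_on K) \<Longrightarrow> sum f A \<in> pol_on K"
  by (induction A rule: infinite_finite_induct) (auto intro: pol_on_add)

lemma pol_on_mult:
  assumes "p \<in> pol_on K" "p' \<in> pol_on K"
  shows "p * p' \<in> pol_on K"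
proof -
  have "keys m \<subseteq> K" if "m \<in> keys (p * p')" for m
  proof -
    from that keys_mult[of p p'] obtain a b where
      "m = a + b" "a \<in> keys p" "b \<in> keys p'" by blast
    with assms keys_add[of a b] show ?thesis unfolding pol_on_def by blast
  qed
  then show ?thesis by (simp add: pol_on_def)
qed

lemma pol_on_mono: "p \<in> pol_on K \<Longrightarrow> K \<subseteq> L \<Longrightarrow> p \<in> pol_on L"
  by (auto simp: pol_on_def)

lemma pol_on_induct [consumes 1, case_names single sum]:
  assumes "p \<in> pol_on K"
    and single: "\<And>m c. keys m \<subseteq> K \<Longrightarrow> Q (single m c)"
    and sum: "\<And>p p'. Q p \<Longrightarrow> Q p' \<Longrightarrow> Q (p + p')"
  shows "Q p"
  using assms(1)
proof (induction p rule: update_induct)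
  case const
  show ?case using single[of 0 0] by simp
next
  case (update f a b)
  have eq: "Poly_Mapping.update a b f = single a b + f"
    using update by (intro poly_mapping_eqI)
      (auto simp: lookup_add lookup_single lookup_update in_keys_iff when_def)
  have keys: "keys (Poly_Mapping.update a b f) = insert a (keys f)"
    using update by (simp add: keys_update)
  show ?case unfolding eq
    by (intro sum single update.IH) (use update.prems keys in \<open>auto simp: pol_on_def\<close>)
qed

lemma shift_pol_on: "p \<in> pol_on K \<Longrightarrow> shift k P p \<in> pol_on K"
  by (induction rule: pol_on_induct) (auto simp: shift_single shift_add intro: pol_on_single pol_on_add)

lemma qdiff_pol_on: "p \<in> pol_on K \<Longrightarrow> qdiff k P p \<in> pol_on K"
proof (induction rule: pol_on_induct)
  case (single m c)
  have "keys (m - single k 1) \<subseteq> keys m"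
    by (auto simp: in_keys_iff lookup_minus)
  with single show ?case unfolding qdiff_single by (intro pol_on_single) blast
qed (simp add: qdiff_add pol_on_add)

lemma shift_trivial: "p \<in> pol_on K \<Longrightarrow> k \<notin> K \<Longrightarrow> shift k P p = p"
proof (induction rule: pol_on_induct)
  case (single m c)
  then have "lookup m k = 0" by (auto simp: in_keys_iff)
  then show ?case by (simp add: shift_single)
qed (simp add: shift_add)

lemma qdiff_trivial: "p \<in> pol_on K \<Longrightarrow> k \<notin> K \<Longrightarrow> qdiff k P p = 0"
proof (induction rule: pol_on_induct)
  case (single m c)
  then have "lookup m k = 0" by (auto simp: in_keys_iff)
  then show ?case by (simp add: qdiff_single q_nat_def)
qed (simp add: qdiff_add)

section \<open>Generated subalgebras as images of polynomial rings\<close>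

lemma subalg_zero: "0 \<in> subalg G"
  using subalg.scal[of 0 G] by simp

lemma subalg_one: "1 \<in> subalg G"
  using subalg.scal[of 1 G] by simp

lemma subalg_prod: "(\<And>a. a \<in> A \<Longrightarrow> of_central (f a) \<in> subalg G) \<Longrightarrow> of_central (prod f A) \<in> subalg G"
  by (induction A rule: infinite_finite_induct) (auto simp: of_central_hom intro: subalg_one subalg.mult)

lemma subalg_mono: "F \<in> subalg G \<Longrightarrow> G \<subseteq> subalg H \<Longrightarrow> F \<in> subalg H"
  by (induction rule: subalg.induct) (auto intro: subalg.intros)

lemma tauB_single: "tauB (single m c) = scal c * of_central (monom_c m)"
  unfolding tauB_def tau_def by (simp add: tau.eval_single of_central_hom scal_c.rep_eq)

lemma tauB_in_subalg:
  assumes "p \<in> pol_on K" and anticomm: "\<And>k. k \<in> K \<Longrightarrow> of_central (anticomm k) \<in> subalg G"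
  shows "tauB p \<in> subalg G"
  using assms(1)
proof (induction rule: pol_on_induct)
  case (single m c)
  have "of_central (anticomm k ^ n) \<in> subalg G" if "k \<in> K" for k n
    by (induction n) (auto simp: of_central_hom intro: subalg_one subalg.mult anticomm that)
  then have "of_central (monom_c m) \<in> subalg G"
    unfolding monom_c_def by (intro subalg_prod) (use single in auto)
  then show ?case unfolding tauB_single by (intro subalg.mult subalg.scal)
next
  case (sum p p')
  then show ?case unfolding tauB_add by (rule subalg.add)
qed

text \<open>Each side only has to contain the generators of the other, so rescaled generators such
  as \<open>r\<close> are covered.\<close>

lemma subalg_eq_tauB_image:
  assumes "\<And>g. g \<in> G \<Longrightarrow> g \<in> tauB ` pol_on K"
    and "\<And>k. k \<in> K \<Longrightarrow> of_central (anticomm k) \<in> subalg G"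
  shows "subalg G = tauB ` pol_on K"
proof (intro equalityI subsetI)
  fix F assume "F \<in> subalg G"
  then show "F \<in> tauB ` pol_on K"
  proof (induction rule: subalg.induct)
    case (scal b)
    show ?case by (metis image_eqI pol_on_pconst tauB_pconst)
  next
    case (add f g)
    then show ?case by (auto simp flip: tauB_add intro: imageI pol_on_add)
  next
    case (mult f g)
    then show ?case by (auto simp flip: tauB_mult intro: imageI pol_on_mult)
  qed (rule assms)
qed (auto intro: tauB_in_subalg assms(2))

definition pairs :: "'v set \<Rightarrow> 'v uprod set" where
  "pairs V = {Upair u w | u w. u \<in> V \<and> w \<in> V}"

lemma pairs_mono: "V \<subseteq> W \<Longrightarrow> pairs V \<subseteq> pairs W"
  by (auto simp: pairs_def)

lemma Upair_in_pairs [simp]: "Upair u w \<in> pairs V \<longleftrightarrow> u \<in> V \<and> w \<in> V"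
  by (auto simp: pairs_def)

abbreviation two :: coeff where "two \<equiv> 2 *\<^sub>R 1"

lemma r_of_eq: "r_of x = tauB (half * pvar (Upair x x))"
proof -
  have "tauB (half * pvar (Upair x x)) + tauB (half * pvar (Upair x x)) = r_of x + r_of x"
    unfolding tauB_add[symmetric] half_add tauB_pvar of_central_anticomm by (simp add: r_of_def power2_eq_square)
  then have "tauB half * (tauB (half * pvar (Upair x x)) + tauB (half * pvar (Upair x x)))
      = tauB half * (r_of x + r_of x)" by (rule arg_cong)
  moreover have "tauB half * (F + F) = F" for F :: "'a radialB"
  proof -
    have "tauB half * (F + F) = (tauB half + tauB half) * F"
      by (simp only: distrib_left distrib_right)
    also have "tauB half + tauB half = (1 :: 'a radialB)"
      using half_add[of "1 :: 'a pol"] by (simp flip: tauB_add)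
    finally show ?thesis by simp
  qed
  ultimately show ?thesis by metis
qed

lemma s_of_eq: "s_of x y = tauB (pvar (Upair x y))"
  by (simp add: s_of_def anticommutator_def tauB_pvar of_central_anticomm)

lemma c_gens_eq: "c_gens ys = (\<lambda>k. tauB (pvar k)) ` pairs (set ys)"
proof -
  have "anticommutator (var y) (var y') = tauB (pvar (Upair y y'))" for y y' :: 'a
    by (simp add: anticommutator_def tauB_pvar of_central_anticomm)
  then show ?thesis unfolding c_gens_def pairs_def by auto
qed

lemma anticomm_xx: "of_central (anticomm (Upair x x)) = scal two * r_of x"
proof -
  have "pconst two * (half * pvar (Upair x x)) = pvar (Upair x x)"
    by (simp add: mult.assoc[symmetric] pconst_mult[symmetric])
  then show ?thesis
    by (simp add: tauB_pvar[symmetric] r_of_eq tauB_pconst[symmetric] tauB_mult[symmetric])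
qed

lemma c_scalars_eq: "c_scalars ys = tauB ` pol_on (pairs (set ys))"
  unfolding c_scalars_def
  by (rule subalg_eq_tauB_image) (auto simp: c_gens_eq tauB_pvar[symmetric] intro: subalg.gen pol_on_pvar)

lemma scalars_eq: "subalg (scalar_gens x ys) = tauB ` pol_on (pairs (insert x (set ys)))"
proof (rule subalg_eq_tauB_image)
  fix g assume "g \<in> scalar_gens x ys"
  then show "g \<in> tauB ` pol_on (pairs (insert x (set ys)))"
    by (auto simp: scalar_gens_def r_of_eq s_of_eq c_gens_eq intro!: imageI pol_on_mult pol_on_pvar
        intro: subsetD[OF pairs_mono[OF subset_insertI]])
next
  fix k assume "k \<in> pairs (insert x (set ys))"
  then obtain u w where k: "k = Upair u w" "u \<in> insert x (set ys)" "w \<in> insert x (set ys)"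
    by (auto simp: pairs_def)
  consider "k = Upair x x" | y where "y \<in> set ys" "k = Upair x y" | "k \<in> pairs (set ys)"
    using k by auto
  then show "of_central (anticomm k) \<in> subalg (scalar_gens x ys)"
  proof cases
    case 1
    show ?thesis
      unfolding 1 anticomm_xx
      by (rule subalg.mult, rule subalg.scal, rule subalg.gen) (simp add: scalar_gens_def)
  next
    case 2
    then show ?thesis
      by (auto simp: tauB_pvar[symmetric] s_of_eq[symmetric] scalar_gens_def intro!: subalg.gen)
  next
    case 3
    then show ?thesis
      by (auto simp: tauB_pvar[symmetric] c_gens_eq scalar_gens_def intro!: subalg.gen)
  qed
qed

text \<open>Existence is the polynomial shift transported along the injective \<open>tauB\<close>;
  uniqueness is an induction over the generated subalgebra. Generators may be scalar multiples of
  indeterminates, since scaling \<open>u\<close> by \<open>P\<close> amounts to scaling its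
  indeterminate by \<open>P\<close>.\<close>

lemma jackson_shift_tauB:
  assumes sub: "subalg G = tauB ` pol_on K"
    and u: "u \<in> G" "u = tauB (pconst a * pvar k)"
    and others: "\<forall>v\<in>G - {u}. \<exists>b l. l \<noteq> k \<and> v = tauB (pconst b * pvar l)"
    and p: "p \<in> pol_on K"
  shows "jackson_shift G P u (tauB p) = tauB (shift k P p)"
proof -
  define T where "T = (\<lambda>F\<in>subalg G. tauB (shift k P (the_inv tauB F)))"
  have inv: "the_inv tauB (tauB p) = p" for p :: "'a pol"
    by (rule the_inv_f_f) (rule injI, rule tauB_inj)
  have T: "T (tauB p) = tauB (shift k P p)" if "p \<in> pol_on K" for p
    using that by (simp add: T_def sub inv)
  have scal: "scal b * tauB p = tauB (pconst b * p)" for b and p :: "'a pol"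
    by (simp add: tauB_mult tauB_pconst)
  let ?spec = "\<lambda>T. T \<in> subalg G \<rightarrow>\<^sub>E subalg G \<and> B_linear_on (subalg G) T \<and>
     T 1 = 1 \<and> (\<forall>f\<in>subalg G. \<forall>g\<in>subalg G. T (f * g) = T f * T g) \<and>
     T u = scal P * u \<and> (\<forall>v\<in>G - {u}. T v = v)"
  have spec: "?spec T"
  proof (intro conjI ballI)
    show "T \<in> subalg G \<rightarrow>\<^sub>E subalg G"
      unfolding T_def by (auto simp: sub inv shift_pol_on)
    show "B_linear_on (subalg G) T"
      unfolding B_linear_on_def sub
      by (auto simp: scal T shift_add shift_mult pol_on_mult pol_on_add simp flip: tauB_add)
    show "T 1 = 1" using T[of 1] by simp
    show "T (f * g) = T f * T g" if "f \<in> subalg G" "g \<in> subalg G" for f g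
      using that unfolding sub by (auto simp: T pol_on_mult shift_mult simp flip: tauB_mult)
    \<comment> \<open>A generator has some preimage in \<open>pol_on K\<close>. By injectivity of
      \<open>tauB\<close> this preimage is the given multiple of an indeterminate, so the formula
      for \<open>T\<close> applies to it.\<close>
    have in_sub: "v \<in> tauB ` pol_on K" if "v \<in> G" for v
      using subalg.gen[OF that] by (simp add: sub)
    from in_sub[OF u(1)] show "T u = scal P * u"
      by (auto simp: u(2) T scal shift_mult shift_pvar dest!: tauB_inj intro!: arg_cong[of _ _ tauB])
    show "T v = v" if v: "v \<in> G - {u}" for v
    proof -
      from bspec[OF others v] obtain b l where l: "l \<noteq> k" "v = tauB (pconst b * pvar l)" by blast
      from in_sub[of v] v obtain p where "v = tauB p" "p \<in> pol_on K" by blast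
      with l show ?thesis by (auto simp: T shift_mult shift_pvar dest!: tauB_inj)
    qed
  qed
  have "jackson_shift G P u = T"
    unfolding jackson_shift_def
  proof (rule the_equality[where P = ?spec, OF spec])
    fix T'
    assume spec': "?spec T'"
    have "T' F = T F" if "F \<in> subalg G" for F
      using that
    proof (induction rule: subalg.induct)
      case (scal b)
      have "T'' (scal b) = scal b" if "B_linear_on (subalg G) T''" "T'' 1 = 1" for T''
        using that subalg_one[of G] unfolding B_linear_on_def by (metis mult.right_neutral)
      with spec spec' show ?case by metis
    next
      case (gen g)
      with spec spec' show ?case by (metis DiffI singletonD)
    next
      case (add f g)
      with spec spec' show ?case by (simp add: B_linear_on_def)
    next
      case (mult f g)
      with spec spec' show ?case by simp
    qed
    moreover have "T' F = T F" if "F \<notin> subalg G" for F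
      using spec spec' that by (metis PiE_arb)
    ultimately show "T' = T" by blast
  qed
  with T[OF p] show ?thesis by simp
qed

text \<open>The quotient by \<open>u\<close> is the quotient by the indeterminate divided by
  \<open>a\<close>; the inverse \<open>a'\<close> is passed explicitly because the coefficients do
  not form a field. Uniqueness comes from cancelling \<open>1 - P\<close> and the
  indeterminate.\<close>

lemma jackson_diff_tauB:
  assumes sub: "subalg G = tauB ` pol_on K"
    and u: "u \<in> G" "u = tauB (pconst a * pvar k)" and a: "a * a' = 1"
    and others: "\<forall>v\<in>G - {u}. \<exists>b l. l \<noteq> k \<and> v = tauB (pconst b * pvar l)"
    and P: "P \<noteq> 1" and p: "p \<in> pol_on K"
  shows "jackson_diff G P u (tauB p) = tauB (pconst a' * qdiff k P p)"
  unfolding jackson_diff_def jackson_shift_tauB[OF sub u others p]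
proof (rule the_equality)
  have aa: "pconst a * (pconst a' * f) = f" for f :: "'a pol"
    by (simp add: mult.assoc[symmetric] pconst_mult[symmetric] a)
  have eq: "scal (1 - P) * u * tauB g = tauB (pconst (1 - P) * (pvar k * (pconst a * g)))" for g
    by (simp add: u(2) tauB_mult tauB_pconst mult.assoc) (metis mult.assoc tauB_commute tauB_pconst)
  show "tauB (pconst a' * qdiff k P p) \<in> subalg G \<and>
      scal (1 - P) * u * tauB (pconst a' * qdiff k P p) = tauB p - tauB (shift k P p)"
    unfolding eq aa pvar_mult_qdiff sub by (simp add: tauB_diff pol_on_mult qdiff_pol_on p)
  fix g assume g: "g \<in> subalg G \<and> scal (1 - P) * u * g = tauB p - tauB (shift k P p)"
  then obtain h where h: "g = tauB h" by (auto simp: sub)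
  with g have "tauB (pconst (1 - P) * (pvar k * (pconst a * h))) = tauB (pconst (1 - P) * (pvar k * qdiff k P p))"
    unfolding pvar_mult_qdiff tauB_diff by (simp only: eq)
  from tauB_inj[OF this] have "pvar k * (pconst a * h) = pvar k * qdiff k P p"
    by (rule pconst_mult_cancel[rotated]) (use P in simp)
  from pvar_mult_cancel[OF this] have "pconst a' * qdiff k P p = pconst a' * (pconst a * h)" by simp
  also have "\<dots> = h" by (simp only: mult.left_commute[of "pconst a'"] aa)
  finally show "g = tauB (pconst a' * qdiff k P p)" by (simp add: h)
qed

lemma q_ind_neq_one: "q_ind \<noteq> 1" and q_ind_square_neq_one: "q_ind\<^sup>2 \<noteq> 1"
proof -
  have q: "q_frac ^ 2 = Fraction_Field.Fract ([:[:0, 1:]:]\<^sup>2) 1"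
    by (simp add: q_frac_def power2_eq_square)
  have "q_frac\<^sup>2 \<noteq> 1"
    unfolding q One_fract_def by (simp add: eq_fract power2_eq_square one_pCons)
  then show "q_ind\<^sup>2 \<noteq> 1"
    by (simp add: power2_eq_square Rep_coeff_inject[symmetric] times_coeff.rep_eq one_coeff.rep_eq q_ind.rep_eq)
  then show "q_ind \<noteq> 1" by auto
qed

text \<open>The factor \<open>two\<close> compensates for \<open>r\<close> being half of the
  indeterminate at \<open>Upair x x\<close>; the 2 in front of the sum belongs to the derivative
  itself.\<close>

definition pol_deriv :: "'v \<Rightarrow> 'v list \<Rightarrow> 'v pol \<Rightarrow> 'v radialB" where
  "pol_deriv x ys p = scal (1 + q_ind) * var x * tauB (pconst two * qdiff (Upair x x) (q_ind\<^sup>2) p)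
    + 2 * (\<Sum>y\<in>set ys. var y * tauB (shift (Upair x x) (q_ind\<^sup>2) (qdiff (Upair x y) q_ind p)))"

lemma scalar_deriv_tauB:
  assumes x: "x \<notin> set ys" and p: "p \<in> pol_on (pairs (insert x (set ys)))"
  shows "scalar_deriv x ys (tauB p) = pol_deriv x ys p"
proof -
  let ?G = "scalar_gens x ys"
  \<comment> \<open>The implications record which generator owns which indeterminate. Read
    contrapositively, a generator other than \<open>r\<close> or a given \<open>s_i\<close> is a
    multiple of some other indeterminate.\<close>
  have gens: "\<exists>b l. (l = Upair x x \<longrightarrow> v = r_of x) \<and> (\<forall>y. l = Upair x y \<longrightarrow> y \<noteq> x \<longrightarrow> v = s_of x y) \<and>
      v = tauB (pconst b * pvar l)" if v: "v \<in> ?G" for v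
  proof -
    consider "v = r_of x" | y where "y \<in> set ys" "v = s_of x y" | k where "k \<in> pairs (set ys)" "v = tauB (pvar k)"
      using v unfolding scalar_gens_def c_gens_eq by blast
    then show ?thesis
    proof cases
      case 1
      then show ?thesis
        by (intro exI[of _ "(1 / 2) *\<^sub>R 1"] exI[of _ "Upair x x"]) (auto simp: r_of_eq)
    next
      case 2
      then show ?thesis using x
        by (intro exI[of _ 1] exI[of _ "Upair x y"]) (auto simp: s_of_eq)
    next
      case 3
      then show ?thesis using x
        by (intro exI[of _ 1] exI[of _ k]) (auto simp: pairs_def)
    qed
  qed
  have r: "r_of x \<in> ?G" "r_of x = tauB (half * pvar (Upair x x))"
    by (simp_all add: scalar_gens_def r_of_eq)
  have r_others: "\<forall>v\<in>?G - {r_of x}. \<exists>b l. l \<noteq> Upair x x \<and> v = tauB (pconst b * pvar l)"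
    using gens by blast
  have s: "s_of x y \<in> ?G" "s_of x y = tauB (pconst 1 * pvar (Upair x y))" if "y \<in> set ys" for y
    using that by (simp_all add: scalar_gens_def s_of_eq)
  have s_others: "\<forall>v\<in>?G - {s_of x y}. \<exists>b l. l \<noteq> Upair x y \<and> v = tauB (pconst b * pvar l)"
    if "y \<in> set ys" for y
    using gens that x by blast
  have "(1 / 2) *\<^sub>R 1 * two = (1::coeff)" by simp
  note R = jackson_diff_tauB[OF scalars_eq r this r_others q_ind_square_neq_one p]
  have S: "jackson_shift ?G (q_ind\<^sup>2) (r_of x) (jackson_diff ?G q_ind (s_of x y) (tauB p))
      = tauB (shift (Upair x x) (q_ind\<^sup>2) (qdiff (Upair x y) q_ind p))" if "y \<in> set ys" for y
  proof -
    have "jackson_diff ?G q_ind (s_of x y) (tauB p) = tauB (pconst 1 * qdiff (Upair x y) q_ind p)"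
      by (rule jackson_diff_tauB[OF scalars_eq s[OF that] _ s_others[OF that] q_ind_neq_one p]) simp_all
    then show ?thesis
      by (simp add: jackson_shift_tauB[OF scalars_eq r r_others] qdiff_pol_on p)
  qed
  show ?thesis
    unfolding scalar_deriv_def pol_deriv_def R by (simp add: S)
qed

section \<open>Grading, spanning and the vector derivative\<close>

text \<open>Homogeneity as a closure property that also records the variables in use. That
  homogeneous elements of different degrees cannot cancel is not visible here; it is proved as
  \<open>homog_direct\<close>.\<close>

inductive homog :: "'v \<Rightarrow> 'v set \<Rightarrow> nat \<Rightarrow> 'v radialB \<Rightarrow> bool" for x V where
  scal: "homog x V 0 (scal b)"
| var: "y \<in> V \<Longrightarrow> homog x V (of_bool (y = x)) (var y)"
| zero: "homog x V n 0"
| add: "homog x V n F \<Longrightarrow> homog x V n G \<Longrightarrow> homog x V n (F + G)"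
| mult: "homog x V n F \<Longrightarrow> homog x V k G \<Longrightarrow> homog x V (n + k) (F * G)"

lemma homog_scal_mult: "homog x V n F \<Longrightarrow> homog x V n (scal b * F)"
  using homog.mult[OF homog.scal] by fastforce

lemma homog_minus: "homog x V n F \<Longrightarrow> homog x V n (- F)"
  using homog_scal_mult[of x V n F "- 1"] by (simp add: scal_minus)

lemma homog_diff: "homog x V n F \<Longrightarrow> homog x V n G \<Longrightarrow> homog x V n (F - G)"
  using homog.add[OF _ homog_minus, of x V n F G] by simp

lemma homog_sum:
  "(\<And>a. a \<in> A \<Longrightarrow> homog x V n (f a)) \<Longrightarrow> homog x V n (sum f A)"
  by (induction A rule: infinite_finite_induct) (auto intro: homog.zero homog.add)

lemma homog_one: "homog x V 0 1"
  using homog.scal[of x V 1] by simp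

lemma homog_cc:
  assumes "u \<in> V" "w \<in> V"
  shows "homog x V (of_bool (u = x) + of_bool (w = x)) (of_central (anticomm (Upair u w)))"
  unfolding of_central_anticomm
  using homog.mult[OF homog.var homog.var, OF assms]
    homog.mult[OF homog.var homog.var, OF assms(2,1)]
  by (intro homog.add) (simp_all add: add.commute)

text \<open>The number of occurrences of \<open>x\<close> in the pair, so that the anticommutator of
  \<open>x\<close> with itself has degree 2.\<close>

definition pair_deg :: "'v \<Rightarrow> 'v uprod \<Rightarrow> nat" where
  "pair_deg x k = (if k = Upair x x then 2 else if x \<in> set_uprod k then 1 else 0)"

lemma pair_deg_Upair: "pair_deg x (Upair u w) = of_bool (u = x) + of_bool (w = x)"
  by (auto simp: pair_deg_def)

definition x_deg :: "'v \<Rightarrow> ('v uprod \<Rightarrow>\<^sub>0 nat) \<Rightarrow> nat" where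
  "x_deg x m = (\<Sum>k\<in>keys m. lookup m k * pair_deg x k)"

lemma x_deg_superset:
  assumes "finite A" "keys m \<subseteq> A"
  shows "x_deg x m = (\<Sum>k\<in>A. lookup m k * pair_deg x k)"
  unfolding x_deg_def
  by (rule sum.mono_neutral_left) (use assms in \<open>auto simp: in_keys_iff\<close>)

lemma x_deg_add: "x_deg x (m + m') = x_deg x m + x_deg x m'"
  using keys_add[of m m']
  by (simp add: x_deg_superset[of "keys m \<union> keys m'"] lookup_add
      distrib_right sum.distrib)

lemma x_deg_single: "x_deg x (single k n) = n * pair_deg x k"
  by (simp add: x_deg_def)

lemma homog_monomial:
  assumes "keys m \<subseteq> pairs V"
  shows "homog x V (x_deg x m) (tauB (single m c))"
proof -
  have pow: "homog x V (n * pair_deg x k) (of_central (anticomm k ^ n))" if "k \<in> pairs V" for k n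
  proof (induction n)
    case 0
    show ?case by (simp add: of_central_hom homog_one)
  next
    case (Suc n)
    from that obtain u w where "k = Upair u w" "u \<in> V" "w \<in> V" by (auto simp: pairs_def)
    with homog.mult[OF homog_cc[of u V w x] Suc] show ?case
      by (simp add: of_central_hom pair_deg_Upair add.commute)
  qed
  have "homog x V (\<Sum>k\<in>A. lookup m k * pair_deg x k)
      (of_central (\<Prod>k\<in>A. anticomm k ^ lookup m k))" if "A \<subseteq> pairs V" for A
    using that
  proof (induction A rule: infinite_finite_induct)
    case (insert k A)
    then show ?case
      using homog.mult[OF pow] by (simp add: of_central_hom)
  qed (simp_all add: of_central_hom homog_one)
  from this[OF assms] show ?thesis
    unfolding tauB_single monom_c_def x_deg_def by (rule homog_scal_mult)
qed

lemma alt_sum_closed: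
  assumes "S 0" "\<And>a b. S a \<Longrightarrow> S b \<Longrightarrow> S (a - b)"
    and "\<And>u r. mset us = add_mset u (mset r) \<Longrightarrow> S (f u r)"
  shows "S (alt_sum f us)"
  using assms(3)
proof (induction us arbitrary: f)
  case (Cons v us)
  show ?case
    unfolding alt_sum.simps by (intro assms(2) Cons.IH Cons.prems) simp_all
qed (simp add: assms(1))

lemma count_list_remove:
  "mset us = add_mset u (mset r) \<Longrightarrow> count_list us x = of_bool (u = x) + count_list r x"
  by (simp flip: count_mset)

lemma homog_wedgeB:
  assumes "set us \<subseteq> V"
  shows "homog x V (count_list us x) (wedgeB us)"
proof -
  have "homog x V (count_list us x) (alt_prod var n us)" if "set us \<subseteq> V" for n us
    using that
  proof (induction n arbitrary: us)
    case 0
    then show ?case by (simp add: homog_one homog.zero)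
  next
    case (Suc n)
    show ?case
      unfolding alt_prod.simps
    proof (rule alt_sum_closed)
      fix u r
      assume us: "mset us = add_mset u (mset r)"
      then have "set us = insert u (set r)" by (metis set_mset_add_mset_insert set_mset_mset)
      with Suc.prems have "homog x V (of_bool (u = x) + count_list r x) (var u * alt_prod var n r)"
        by (intro homog.mult homog.var Suc.IH) auto
      then show "homog x V (count_list us x) (var u * alt_prod var n r)"
        by (simp add: count_list_remove[OF us])
    qed (auto intro: homog.zero homog_diff)
  qed
  then show ?thesis
    unfolding wedgeB_alt_prod rscal_def using assms by (intro homog_scal_mult) blast
qed

text \<open>A graded span built one term at a time. The admissible wedges \<open>U\<close> are a
  parameter: all words while products are formed, and only the subsequences of an enumeration after
  normalization.\<close>

inductive_set gspan :: "'v list set \<Rightarrow> 'v \<Rightarrow> 'v uprod set \<Rightarrow> nat \<Rightarrow> 'v radialB set" for U x K n where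
  zero: "0 \<in> gspan U x K n"
| add: "us \<in> U \<Longrightarrow> keys m \<subseteq> K \<Longrightarrow> count_list us x + x_deg x m = n \<Longrightarrow> F \<in> gspan U x K n
    \<Longrightarrow> wedgeB us * tauB (single m c) + F \<in> gspan U x K n"

lemma gspan_gen: "us \<in> U \<Longrightarrow> keys m \<subseteq> K \<Longrightarrow> count_list us x + x_deg x m = n
    \<Longrightarrow> wedgeB us * tauB (single m c) \<in> gspan U x K n"
  using gspan.add[OF _ _ _ gspan.zero] by fastforce

lemma gspan_add: "F \<in> gspan U x K n \<Longrightarrow> G \<in> gspan U x K n \<Longrightarrow> F + G \<in> gspan U x K n"
  by (induction rule: gspan.induct) (auto simp: add.assoc intro: gspan.add)

lemma gspan_minus: "F \<in> gspan U x K n \<Longrightarrow> - F \<in> gspan U x K n"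
proof (induction rule: gspan.induct)
  case (add us m F c)
  have "- (wedgeB us * tauB (single m c) + F)
      = wedgeB us * tauB (single m (- c)) + (- F)"
    by (simp add: single_uminus tauB_minus)
  then show ?case using add by (simp only: gspan.add)
qed (simp add: gspan.zero)

lemma gspan_diff: "F \<in> gspan U x K n \<Longrightarrow> G \<in> gspan U x K n \<Longrightarrow> F - G \<in> gspan U x K n"
  using gspan_add[OF _ gspan_minus, of F U x K n G] by simp

lemma gspan_pol_mult:
  assumes "F \<in> gspan U x K n" "keys m \<subseteq> K"
  shows "tauB (single m c) * F \<in> gspan U x K (x_deg x m + n)"
  using assms(1)
proof (induction rule: gspan.induct)
  case zero
  show ?case by (simp add: gspan.zero)
next
  case (add us m' F c')
  have "tauB (single m c) * (wedgeB us * tauB (single m' c') + F)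
      = wedgeB us * tauB (single (m + m') (c * c')) + tauB (single m c) * F"
    by (simp add: distrib_left mult_single[symmetric] tauB_mult mult.assoc[symmetric]
        tauB_commute[of _ "wedgeB us"])
  then show ?case
    using add assms(2) keys_add[of m m'] by (auto simp: x_deg_add intro!: gspan.add)
qed

lemma gspan_scal_mult:
  assumes "F \<in> gspan U x K n"
  shows "scal b * F \<in> gspan U x K n"
  using gspan_pol_mult[OF assms, of 0 b]
  by (simp add: pconst_def[symmetric] tauB_pconst x_deg_def)

text \<open>\<open>wedgeB_Cons\<close> read backwards: \<open>v\<close> times a wedge is a longer
  wedge plus half a contraction. The degree is kept because a letter removed from the wedge
  reappears in the anticommutator.\<close>

lemma gspan_var_mult:
  assumes v: "v \<in> V" and F: "F \<in> gspan {us. set us \<subseteq> V} x (pairs V) n"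
  shows "var v * F \<in> gspan {us. set us \<subseteq> V} x (pairs V) (of_bool (v = x) + n)"
  using F
proof (induction rule: gspan.induct)
  case zero
  show ?case by (simp add: gspan.zero)
next
  case (add us m F c)
  let ?t = "tauB (single m c)" and ?S = "\<lambda>n. gspan {us. set us \<subseteq> V} x (pairs V) n"
  let ?n = "of_bool (v = x) + n"
  have "alt_sum (\<lambda>u r. of_central (anticomm (Upair v u)) * wedgeB r) us * ?t
      = alt_sum (\<lambda>u r. of_central (anticomm (Upair v u)) * wedgeB r * ?t) us"
    by (rule alt_sum_hom) (rule left_diff_distrib)
  also have "\<dots> \<in> ?S ?n"
  proof (rule alt_sum_closed[where S = "\<lambda>F. F \<in> ?S ?n"])
    fix u r
    assume us: "mset us = add_mset u (mset r)"
    then have "set us = insert u (set r)" by (metis set_mset_add_mset_insert set_mset_mset)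
    with add have ur: "u \<in> V" "set r \<subseteq> V" by auto
    have "tauB (pvar (Upair v u)) * (wedgeB r * ?t)
        \<in> ?S (x_deg x (single (Upair v u) 1) + (count_list r x + x_deg x m))"
      unfolding pvar_def by (rule gspan_pol_mult, rule gspan_gen) (use ur add v in auto)
    also have "x_deg x (single (Upair v u) 1) + (count_list r x + x_deg x m) = ?n"
      using add(3) by (simp add: x_deg_single pair_deg_Upair count_list_remove[OF us])
    finally show "of_central (anticomm (Upair v u)) * wedgeB r * ?t \<in> ?S ?n"
      by (simp add: tauB_pvar mult.assoc)
  qed (auto intro: gspan.zero gspan_diff)
  finally have "rscal (1 / 2) * (alt_sum (\<lambda>u r. of_central (anticomm (Upair v u)) * wedgeB r) us * ?t) \<in> ?S ?n"
    unfolding rscal_def by (rule gspan_scal_mult)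
  moreover have "wedgeB (v # us) * ?t \<in> ?S ?n"
    by (rule gspan_gen) (use add v in auto)
  moreover have "var v * (wedgeB us * ?t + F) = wedgeB (v # us) * ?t
      + rscal (1 / 2) * (alt_sum (\<lambda>u r. of_central (anticomm (Upair v u)) * wedgeB r) us * ?t) + var v * F"
    unfolding wedgeB_Cons by (simp add: algebra_simps)
  ultimately show ?case using add.IH by (auto intro!: gspan_add)
qed

text \<open>The span absorbs homogeneous factors from the left, so \<open>homog_gspan\<close>
  follows by applying them to 1. Products of two wedges never have to be expanded.\<close>

lemma homog_mult_gspan:
  assumes "homog x V k G" "F \<in> gspan {us. set us \<subseteq> V} x (pairs V) n"
  shows "G * F \<in> gspan {us. set us \<subseteq> V} x (pairs V) (k + n)"
  using assms
proof (induction arbitrary: F n rule: homog.induct)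
  case (scal b)
  then show ?case by (simp add: gspan_scal_mult)
next
  case (var y)
  then show ?case by (intro gspan_var_mult)
next
  case (zero k)
  show ?case by (simp add: gspan.zero)
next
  case (add k G H)
  then show ?case by (simp add: distrib_right gspan_add)
next
  case (mult k G l H)
  then show ?case by (simp add: mult.assoc add.assoc)
qed

lemma radialB_torsion_free: "F + F = 0 \<Longrightarrow> F = 0" for F :: "'v radialB"
proof -
  assume "F + F = 0"
  moreover have "rscal (1 / 2) * (F + F) = F"
  proof -
    have "rscal (1 / 2) * (F + F) = (rscal (1 / 2) + rscal (1 / 2)) * F"
      by (simp only: distrib_left distrib_right)
    also have "rscal (1 / 2) + rscal (1 / 2) = (1 :: 'v radialB)"
      by (simp add: rscal_def flip: scal_add scaleR_add_left)
    finally show ?thesis by simp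
  qed
  ultimately show "F = 0" by simp
qed

lemma subseqs_set_inj:
  assumes "distinct zs" "I \<in> set (subseqs zs)" "J \<in> set (subseqs zs)" "set I = set J"
  shows "I = J"
proof -
  have "distinct (map set (subseqs zs))" by (rule distinct_set_subseqs[OF assms(1)])
  then have "inj_on set (set (subseqs zs))" by (simp add: distinct_map)
  from inj_onD[OF this assms(4,2,3)] show ?thesis .
qed

lemma subseqs_subset: "I \<in> set (subseqs zs) \<Longrightarrow> set I \<subseteq> set zs"
  using subseqs_powset[of zs] by blast

text \<open>A wedge with a repeated letter vanishes. Any other is, up to sign, the wedge of the one
  subsequence of \<open>zs\<close> with the same letters.\<close>

lemma gspan_canonical:
  assumes zs: "distinct zs" and F: "F \<in> gspan {us. set us \<subseteq> set zs} x K n"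
  shows "F \<in> gspan (set (subseqs zs)) x K n"
  using F
proof (induction rule: gspan.induct)
  case zero
  show ?case by (rule gspan.zero)
next
  case (add us m F c)
  have "wedgeB us * tauB (single m c) \<in> gspan (set (subseqs zs)) x K n"
  proof (cases "distinct us")
    case False
    have "wedgeB us = 0"
      using alternating_not_distinct[OF alternating_wedgeB radialB_torsion_free False] .
    then show ?thesis by (simp add: gspan.zero)
  next
    case True
    obtain J where J: "J \<in> set (subseqs zs)" "set J = set us"
      using add(1) subseqs_powset[of zs] by (metis (no_types, lifting) CollectD PowI imageE)
    then have "mset us = mset J"
      using True subseqs_distinctD[OF J(1) zs] by (simp add: set_eq_iff_mset_eq_distinct)
    from alternating_reorder[OF this] obtain s :: "'a radialB" where
      s: "s = 1 \<or> s = - 1" "wedgeB us = s * wedgeB J"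
      using alternating_wedgeB by blast
    have count: "count_list J x + x_deg x m = n"
      using add(3) \<open>mset us = mset J\<close> by (metis count_mset)
    have gen: "wedgeB J * tauB (single m c) \<in> gspan (set (subseqs zs)) x K n"
      using J count add(2) by (intro gspan_gen)
    show ?thesis
      using s gen gspan_minus[OF gen] by auto
  qed
  then show ?case using add.IH by (rule gspan_add)
qed

lemma homog_gspan:
  assumes "distinct zs" "homog x (set zs) n F"
  shows "F \<in> gspan (set (subseqs zs)) x (pairs (set zs)) n"
proof (rule gspan_canonical[OF assms(1)])
  have "1 \<in> gspan {us. set us \<subseteq> set zs} x (pairs (set zs)) 0"
    using gspan_gen[of "[]" "{us. set us \<subseteq> set zs}" 0 "pairs (set zs)" x 0 1]
    by (simp add: x_deg_def flip: pconst_def)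
  from homog_mult_gspan[OF assms(2) this]
  show "F \<in> gspan {us. set us \<subseteq> set zs} x (pairs (set zs)) n" by simp
qed

section \<open>Decomposition into homogeneous elements and finite support\<close>

lemma radial_on_mono: "F \<in> radial_on V \<Longrightarrow> V \<subseteq> W \<Longrightarrow> F \<in> radial_on W"
  unfolding radial_on_def by (erule subalg_mono) (auto intro: subalg.gen)

lemma radial_on_add: "F \<in> radial_on V \<Longrightarrow> G \<in> radial_on V \<Longrightarrow> F + G \<in> radial_on V"
  and radial_on_mult: "F \<in> radial_on V \<Longrightarrow> G \<in> radial_on V \<Longrightarrow> F * G \<in> radial_on V"
  and radial_on_scal: "scal b \<in> radial_on V"
  and radial_on_var: "v \<in> V \<Longrightarrow> var v \<in> radial_on V"
  and radial_on_zero: "0 \<in> radial_on V"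
  unfolding radial_on_def by (auto intro: subalg.intros subalg_zero)

lemma homog_radial_on: "homog x V n F \<Longrightarrow> F \<in> radial_on V"
  by (induction rule: homog.induct)
     (auto intro: radial_on_add radial_on_mult radial_on_scal radial_on_var radial_on_zero)

lemma radial_on_homog_sum:
  assumes "F \<in> radial_on V"
  shows "\<exists>N Fs. (\<forall>n. homog x V n (Fs n)) \<and> F = (\<Sum>n<N. Fs n)"
  using assms unfolding radial_on_def
proof (induction rule: subalg.induct)
  case (scal b)
  show ?case
    by (intro exI[of _ 1] exI[of _ "\<lambda>n. if n = 0 then scal b else 0"])
       (auto intro: homog.intros)
next
  case (gen g)
  then obtain y where y: "g = var y" "y \<in> V" by blast
  let ?Fs = "\<lambda>n. if n = of_bool (y = x) then var y else 0"
  have "homog x V n (?Fs n)" for n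
    using homog.var[OF y(2), of x] by (auto intro: homog.zero)
  moreover have "g = (\<Sum>n<2::nat. ?Fs n)" by (simp add: y numeral_2_eq_2)
  ultimately show ?case by (intro exI[of _ "2::nat"] exI[of _ ?Fs] conjI allI)
next
  case (add F G)
  then obtain N Fs M Gs where F: "\<And>n. homog x V n (Fs n)" "F = (\<Sum>n<N. Fs n)"
    and G: "\<And>n. homog x V n (Gs n)" "G = (\<Sum>n<M. Gs n)" by metis
  let ?Hs = "\<lambda>n. (if n < N then Fs n else 0) + (if n < M then Gs n else 0)"
  have "homog x V n (?Hs n)" for n
    by (intro homog.add) (auto intro: F G homog.zero)
  moreover have "F + G = (\<Sum>n<max N M. ?Hs n)"
    unfolding sum.distrib F(2) G(2)
    by (intro arg_cong2[where f = "(+)"] sum.mono_neutral_cong_left) auto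
  ultimately show ?case by (intro exI[of _ "max N M"] exI[of _ ?Hs] conjI allI)
next
  case (mult F G)
  then obtain N Fs M Gs where F: "\<And>n. homog x V n (Fs n)" "F = (\<Sum>n<N. Fs n)"
    and G: "\<And>n. homog x V n (Gs n)" "G = (\<Sum>n<M. Gs n)" by metis
  let ?S = "{..<N} \<times> {..<M}"
  let ?Hs = "\<lambda>n. \<Sum>p\<in>{p \<in> ?S. fst p + snd p = n}. Fs (fst p) * Gs (snd p)"
  have "homog x V n (?Hs n)" for n
    by (rule homog_sum) (auto intro: homog.mult F G)
  moreover have "F * G = (\<Sum>n<N + M. ?Hs n)"
  proof -
    have "F * G = (\<Sum>p\<in>?S. Fs (fst p) * Gs (snd p))"
      unfolding F(2) G(2) sum_product sum.cartesian_product by (simp add: case_prod_beta)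
    also have "\<dots> = (\<Sum>n<N + M. ?Hs n)"
      by (rule sum.group[symmetric]) auto
    finally show ?thesis .
  qed
  ultimately show ?case by (intro exI[of _ "N + M"] exI[of _ ?Hs] conjI allI)
qed

lemma radial_on_induct [consumes 2, case_names zero add]:
  assumes zs: "distinct zs" and F: "F \<in> radial_on (set zs)"
    and zero: "Q 0"
    and add: "\<And>J m c F. J \<in> set (subseqs zs) \<Longrightarrow> keys m \<subseteq> pairs (set zs) \<Longrightarrow>
      F \<in> radial_on (set zs) \<Longrightarrow> Q F \<Longrightarrow> Q (wedgeB J * tauB (single m c) + F)"
  shows "Q F"
proof -
  \<comment> \<open>Any distinguished letter will do, hence \<open>undefined\<close>: the degrees
    are discarded and only the spanning statement is used.\<close>
  obtain N Fs where Fs: "\<And>n. homog undefined (set zs) n (Fs n)" and F_eq: "F = (\<Sum>n<N. Fs n)"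
    using radial_on_homog_sum[OF F] by metis
  have gen: "wedgeB J * tauB (single m c) \<in> radial_on (set zs)"
    if "J \<in> set (subseqs zs)" "keys m \<subseteq> pairs (set zs)" for J m c
    using homog_wedgeB[OF subseqs_subset[OF that(1)]] homog_monomial[OF that(2)]
    by (blast intro: radial_on_mult homog_radial_on)
  have step: "G + H \<in> radial_on (set zs) \<and> Q (G + H)"
    if "G \<in> gspan (set (subseqs zs)) x (pairs (set zs)) n" "H \<in> radial_on (set zs)" "Q H" for x n G H
    using that
  proof (induction rule: gspan.induct)
    case (add us m F c)
    then have "F + H \<in> radial_on (set zs)" "Q (F + H)" by simp_all
    with add(1,2) show ?case
      unfolding add.assoc using gen by (auto intro: radial_on_add assms(4))
  qed simp
  have "(\<Sum>n<N. Fs n) \<in> radial_on (set zs) \<and> Q (\<Sum>n<N. Fs n)"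
  proof (induction N)
    case 0
    show ?case by (simp add: radial_on_zero zero)
  next
    case (Suc N)
    then show ?case
      unfolding sum.lessThan_Suc add.commute[of _ "Fs N"]
      using step[OF homog_gspan[OF zs Fs]] by blast
  qed
  then show ?thesis by (simp add: F_eq)
qed

lemma exists_finite_support:
  "\<exists>ys. distinct ys \<and> x \<notin> set ys \<and> F \<in> radial_on (insert x (set ys))"
proof -
  have "\<exists>V. finite V \<and> F \<in> radial_on V"
  proof (induction F rule: radialB_induct)
    case (scal b)
    show ?case by (intro exI[of _ "{}"]) (simp add: radial_on_scal)
  next
    case (var v)
    show ?case by (intro exI[of _ "{v}"]) (simp add: radial_on_var)
  next
    case (add F G)
    then obtain V W where "finite V" "F \<in> radial_on V" "finite W" "G \<in> radial_on W" by blast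
    then show ?case
      by (intro exI[of _ "V \<union> W"]) (auto intro!: radial_on_add intro: radial_on_mono)
  next
    case (mult F G)
    then obtain V W where "finite V" "F \<in> radial_on V" "finite W" "G \<in> radial_on W" by blast
    then show ?case
      by (intro exI[of _ "V \<union> W"]) (auto intro!: radial_on_mult intro: radial_on_mono)
  qed
  then obtain V where V: "finite V" "F \<in> radial_on V" by blast
  obtain ys where "distinct ys" "set ys = V - {x}"
    using finite_distinct_list[of "V - {x}"] V by auto
  then show ?thesis using V by (intro exI[of _ ys]) (auto intro: radial_on_mono)
qed

section \<open>The scalar derivative on polynomials\<close>

lemma pol_deriv_add: "pol_deriv x ys (p + p') = pol_deriv x ys p + pol_deriv x ys p'"
  by (simp add: pol_deriv_def qdiff_add shift_add tauB_add distrib_left sum.distrib)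

lemma shift_zero [simp]: "shift k P 0 = 0"
  using shift_add[of k P 0 0] by simp

lemma pol_deriv_zero [simp]: "pol_deriv x ys 0 = 0"
  using pol_deriv_add[of x ys 0 0] by simp

text \<open>Polynomials free of \<open>x\<close> are fixed by all the shifts involved, so they pass
  through the difference quotients.\<close>

lemma pol_deriv_mult_const:
  assumes "t \<in> pol_on (pairs W)" "x \<notin> W"
  shows "pol_deriv x ys (t * p) = tauB t * pol_deriv x ys p"
proof -
  have t: "shift (Upair x y) P t = t" for y P
    by (rule shift_trivial[OF assms(1)]) (use assms(2) in simp)
  have "F * tauB (t * p') = tauB t * (F * tauB p')" for F p'
    by (simp add: tauB_mult) (metis mult.assoc tauB_commute)
  moreover have "2 * (tauB t * F) = tauB t * (2 * F)" for F :: "'a radialB"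
    by (simp add: mult_2 distrib_left)
  ultimately show ?thesis
    unfolding pol_deriv_def qdiff_mult_const[OF q_ind_square_neq_one t]
      qdiff_mult_const[OF q_ind_neq_one t] shift_mult t
    by (simp add: mult.left_commute[of "pconst two" t] distrib_left sum_distrib_left)
qed

text \<open>A variable outside \<open>ys\<close> contributes 0, because \<open>p\<close> does not
  contain its indeterminate with \<open>x\<close>.\<close>

lemma pol_deriv_mono:
  assumes "p \<in> pol_on (pairs (insert x (set ys)))" "set ys \<subseteq> set zs" "x \<notin> set zs"
  shows "pol_deriv x zs p = pol_deriv x ys p"
proof -
  have "qdiff (Upair x y) q_ind p = 0" if "y \<in> set zs" "y \<notin> set ys" for y
    by (rule qdiff_trivial[OF assms(1)]) (use that assms(3) in auto)
  then have "(\<Sum>y\<in>set zs. var y * tauB (shift (Upair x x) (q_ind\<^sup>2) (qdiff (Upair x y) q_ind p)))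
    = (\<Sum>y\<in>set ys. var y * tauB (shift (Upair x x) (q_ind\<^sup>2) (qdiff (Upair x y) q_ind p)))"
    by (intro sum.mono_neutral_right) (use assms(2) in auto)
  then show ?thesis by (simp add: pol_deriv_def)
qed

text \<open>Each term trades one indeterminate containing \<open>x\<close> for a variable and so
  loses degree 1. The subtraction is truncated, so degree 0 needs the separate statement that the
  derivative vanishes there.\<close>

lemma pol_deriv_homog:
  assumes m: "keys m \<subseteq> pairs (insert x (set ys))" and x: "x \<notin> set ys"
  shows "x_deg x m = 0 \<Longrightarrow> pol_deriv x ys (single m c) = 0"
    and "homog x (insert x (set ys)) (x_deg x m - 1) (pol_deriv x ys (single m c))"
proof -
  let ?V = "insert x (set ys)"
  have vanish: "qdiff k P (single m c) = 0" if "lookup m k = 0" for k P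
    using that by (simp add: qdiff_single q_nat_def)
  have deg: "x_deg x m = pair_deg x k + x_deg x (m - single k 1)"
    if "lookup m k \<noteq> 0" for k
    using x_deg_add[of x "single k 1" "m - single k 1"]
    unfolding split_monomial[OF that] by (simp add: x_deg_single)
  have pos: "x_deg x m \<noteq> 0" if "lookup m (Upair x y) \<noteq> 0" for y
    using deg[OF that] by (simp add: pair_deg_Upair)
  have sub: "keys (m - single k 1) \<subseteq> pairs ?V" for k
    using m by (auto simp: in_keys_iff lookup_minus)
  show "pol_deriv x ys (single m c) = 0" if "x_deg x m = 0"
  proof -
    have "lookup m (Upair x y) = 0" for y
      using pos[of y] that by blast
    then show ?thesis by (simp add: pol_deriv_def vanish)
  qed
  have A: "homog x ?V (x_deg x m - 1)
      (scal (1 + q_ind) * var x * tauB (pconst two * qdiff (Upair x x) P (single m c)))" for P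
  proof (cases "lookup m (Upair x x) = 0")
    case True
    then show ?thesis by (simp add: vanish homog.zero)
  next
    case False
    let ?m = "m - single (Upair x x) 1"
    have "homog x ?V (0 + of_bool (x = x) + (0 + x_deg x ?m))
        (scal (1 + q_ind) * var x * (scal two * tauB (qdiff (Upair x x) P (single m c))))"
      unfolding qdiff_single
      by (intro homog.mult homog.scal homog.var homog_monomial sub) simp
    moreover have "0 + of_bool (x = x) + (0 + x_deg x ?m) = x_deg x m - 1"
      using deg[OF False] by (simp add: pair_deg_Upair)
    ultimately show ?thesis by (simp add: tauB_mult tauB_pconst)
  qed
  have B: "homog x ?V (x_deg x m - 1)
      (var y * tauB (shift (Upair x x) P (qdiff (Upair x y) P' (single m c))))"
    if y: "y \<in> set ys" for y P P'
  proof (cases "lookup m (Upair x y) = 0")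
    case True
    then show ?thesis by (simp add: vanish homog.zero)
  next
    case False
    let ?m = "m - single (Upair x y) 1"
    have "homog x ?V (of_bool (y = x) + x_deg x ?m)
      (var y * tauB (shift (Upair x x) P (qdiff (Upair x y) P' (single m c))))"
      unfolding qdiff_single shift_single
      by (intro homog.mult homog.scal homog.var homog_monomial sub) (simp add: y)
    moreover have "of_bool (y = x) + x_deg x ?m = x_deg x m - 1"
      using deg[OF False] x y by (auto simp: pair_deg_Upair)
    ultimately show ?thesis by simp
  qed
  show "homog x ?V (x_deg x m - 1) (pol_deriv x ys (single m c))"
    unfolding pol_deriv_def mult_2
    by (intro homog.add homog_sum A B)
qed

section \<open>The vector derivative in coordinates\<close>

abbreviation contr :: "'v list \<Rightarrow> 'v radialB" where
  "contr I \<equiv> scal ((-1) ^ length I * q_m_number (- int (length I)))"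

abbreviation twist :: "'v list \<Rightarrow> 'v radialB" where
  "twist I \<equiv> scal (q_m_pow (- int (length I)))"

text \<open>The required formulas applied to the coefficients \<open>ev (delta I) F\<close> and
  \<open>ev (delta (x # I)) F\<close>. This witness is total, so additivity has no side conditions;
  it is matched with the specified operator only on \<open>radial_on\<close>.\<close>

definition vderiv :: "'v \<Rightarrow> 'v list \<Rightarrow> 'v radialB \<Rightarrow> 'v radialB" where
  "vderiv x ys F = (\<Sum>I\<in>set (subseqs ys).
     wedgeB I * pol_deriv x ys (ev (delta I) F)
     + contr I * wedgeB I * tauB (ev (delta (x # I)) F)
     + twist I * wedgeB (x # I) * pol_deriv x ys (ev (delta (x # I)) F))"

lemma vderiv_add: "vderiv x ys (F + G) = vderiv x ys F + vderiv x ys G"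
  unfolding vderiv_def sum.distrib[symmetric]
  by (rule sum.cong) (simp_all add: ev_add pol_deriv_add tauB_add distrib_left algebra_simps)

lemma vderiv_zero [simp]: "vderiv x ys 0 = 0"
  using vderiv_add[of x ys 0 0] by simp

lemma vderiv_minus: "vderiv x ys (- F) = - vderiv x ys F"
  using vderiv_add[of x ys F "- F"] by (simp add: eq_neg_iff_add_eq_0 add.commute)

lemma vderiv_sum: "vderiv x ys (sum f A) = (\<Sum>a\<in>A. vderiv x ys (f a))"
  by (induction A rule: infinite_finite_induct) (simp_all add: vderiv_add)

lemma vderiv_mult_const:
  assumes "t \<in> pol_on (pairs W)" "x \<notin> W"
  shows "vderiv x ys (tauB t * F) = tauB t * vderiv x ys F"
proof -
  have "G * (tauB t * H) = tauB t * (G * H)" for G H :: "'a radialB"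
    by (metis mult.assoc tauB_commute)
  then show ?thesis
    unfolding vderiv_def sum_distrib_left
    by (simp add: ev_tauB_left pol_deriv_mult_const[OF assms] tauB_mult distrib_left)
qed

lemma delta_canonical:
  assumes "distinct zs" "I \<in> set (subseqs zs)" "J \<in> set (subseqs zs)"
  shows "Rep_altf (delta J) I = (if I = J then 1 else 0)"
proof (cases "I = J")
  case True
  then show ?thesis
    using subseqs_distinctD[OF assms(2,1)] by (simp add: delta.rep_eq delta_fun_self)
next
  case False
  then have "mset I \<noteq> mset J"
    using subseqs_set_inj[OF assms] by (metis mset_eq_setD)
  with False show ?thesis by (simp add: delta.rep_eq delta_fun_eq_zero)
qed

lemma ev_canonical:
  assumes "distinct zs" "I \<in> set (subseqs zs)" "J \<in> set (subseqs zs)"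
  shows "ev (delta J) (wedgeB I * tauB p) = (if I = J then p else 0)"
  by (simp add: ev_tauB ev_wedgeB delta_canonical[OF assms])

lemma subseqs_Cons: "set (subseqs (x # ys)) = (#) x ` set (subseqs ys) \<union> set (subseqs ys)"
  by (simp add: Let_def)

lemma vderiv_wedgeB:
  assumes ys: "distinct ys" "x \<notin> set ys" and I: "I \<in> set (subseqs ys)"
  shows "vderiv x ys (wedgeB I * tauB p) = wedgeB I * pol_deriv x ys p"
    and "vderiv x ys (wedgeB (x # I) * tauB p) =
      contr I * wedgeB I * tauB p
      + twist I * wedgeB (x # I) * pol_deriv x ys p"
proof -
  have d: "distinct (x # ys)" using ys by simp
  have mem: "J \<in> set (subseqs (x # ys))" "x # J \<in> set (subseqs (x # ys))"
    if "J \<in> set (subseqs ys)" for J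
    using that by (auto simp: subseqs_Cons simp del: subseqs.simps)
  have neq: "x # J \<noteq> I'" if "I' \<in> set (subseqs ys)" for I' J
    using subseqs_subset[OF that] ys by auto
  have ev: "ev (delta J) (wedgeB I * tauB p) = (if I = J then p else 0)"
    "ev (delta (x # J)) (wedgeB I * tauB p) = 0"
    "ev (delta J) (wedgeB (x # I) * tauB p) = 0"
    "ev (delta (x # J)) (wedgeB (x # I) * tauB p) = (if I = J then p else 0)"
    if J: "J \<in> set (subseqs ys)" for J
    unfolding ev_canonical[OF d mem(1)[OF I] mem(1)[OF J]] ev_canonical[OF d mem(1)[OF I] mem(2)[OF J]]
      ev_canonical[OF d mem(2)[OF I] mem(1)[OF J]] ev_canonical[OF d mem(2)[OF I] mem(2)[OF J]]
    using neq[OF I, of J] neq[OF J, of I] by auto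
  show "vderiv x ys (wedgeB I * tauB p) = wedgeB I * pol_deriv x ys p"
  proof -
    have "vderiv x ys (wedgeB I * tauB p) = (\<Sum>J\<in>set (subseqs ys). if I = J then wedgeB I * pol_deriv x ys p else 0)"
      unfolding vderiv_def
      by (rule sum.cong) (auto simp: ev)
    then show ?thesis using I by simp
  qed
  show "vderiv x ys (wedgeB (x # I) * tauB p) =
      contr I * wedgeB I * tauB p
      + twist I * wedgeB (x # I) * pol_deriv x ys p"
  proof -
    have "vderiv x ys (wedgeB (x # I) * tauB p) = (\<Sum>J\<in>set (subseqs ys). if I = J then
      contr I * wedgeB I * tauB p
      + twist I * wedgeB (x # I) * pol_deriv x ys p else 0)"
      unfolding vderiv_def
      by (rule sum.cong) (auto simp: ev)
    then show ?thesis using I by simp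
  qed
qed

text \<open>A subsequence of one enumeration may appear in another order inside a larger one. Both
  sides change by the same sign, which is shared by \<open>wedgeB us\<close> and
  \<open>wedgeB (x # us)\<close>.\<close>

lemma vderiv_wedgeB_any:
  assumes ys: "distinct ys" "x \<notin> set ys" and us: "distinct us" "set us \<subseteq> set ys"
  shows "vderiv x ys (wedgeB us * tauB p) = wedgeB us * pol_deriv x ys p"
    and "vderiv x ys (wedgeB (x # us) * tauB p) =
      contr us * wedgeB us * tauB p
      + twist us * wedgeB (x # us) * pol_deriv x ys p"
proof -
  obtain J where J: "J \<in> set (subseqs ys)" "set J = set us"
    using us(2) subseqs_powset[of ys] by (metis PowI imageE)
  then have m: "mset us = mset J"
    using us(1) subseqs_distinctD[OF J(1) ys(1)] by (simp add: set_eq_iff_mset_eq_distinct)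
  then have len: "length us = length J" by (metis size_mset)
  from alternating_reorder[OF m] obtain s :: "'a radialB" where
    s: "s = 1 \<or> s = - 1" "\<And>\<phi>. alternating \<phi> \<Longrightarrow> \<phi> us = s * \<phi> J" by blast
  note w = s(2)[OF alternating_wedgeB] s(2)[OF alternating_Cons[OF alternating_wedgeB], of x]
  note v = vderiv_wedgeB[OF ys J(1), of p]
  show "vderiv x ys (wedgeB us * tauB p) = wedgeB us * pol_deriv x ys p"
    unfolding w using s(1) by (auto simp: v vderiv_minus)
  show "vderiv x ys (wedgeB (x # us) * tauB p) =
      contr us * wedgeB us * tauB p
      + twist us * wedgeB (x # us) * pol_deriv x ys p"
    unfolding w len using s(1) by (auto simp: v vderiv_minus)
qed

text \<open>Compatibility under enlarging Y, checked on the spanning elements; it makes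
  \<open>vector_deriv\<close> independent of the chosen enumeration.\<close>

lemma vderiv_mono:
  assumes ys: "distinct ys" "x \<notin> set ys" and zs: "distinct zs" "x \<notin> set zs"
    and sub: "set ys \<subseteq> set zs" and F: "F \<in> radial_on (insert x (set ys))"
  shows "vderiv x zs F = vderiv x ys F"
proof -
  have "distinct (x # ys)" "F \<in> radial_on (set (x # ys))" using ys F by simp_all
  then show ?thesis
  proof (induction rule: radial_on_induct)
    case (add J m c F)
    let ?p = "single m c"
    have p: "?p \<in> pol_on (pairs (insert x (set ys)))"
      using add(2) by (intro pol_on_single) simp
    note pd = pol_deriv_mono[OF p sub zs(2)]
    have "vderiv x zs (wedgeB J * tauB ?p) = vderiv x ys (wedgeB J * tauB ?p)"
    proof -
      have *: "distinct I \<and> set I \<subseteq> set zs" if "I \<in> set (subseqs ys)" for I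
        using subseqs_distinctD[OF that ys(1)] subseqs_subset[OF that] sub by blast
      from add(1) consider "J \<in> set (subseqs ys)" | I where "I \<in> set (subseqs ys)" "J = x # I"
        unfolding subseqs_Cons by blast
      then show ?thesis
      proof cases
        case 1
        with *[OF 1] show ?thesis
          by (simp add: vderiv_wedgeB[OF ys] vderiv_wedgeB_any[OF zs] pd)
      next
        case 2
        with *[OF 2(1)] show ?thesis
          by (simp add: vderiv_wedgeB[OF ys] vderiv_wedgeB_any[OF zs] pd)
      qed
    qed
    then show ?case using add.IH by (simp add: vderiv_add)
  qed simp
qed

lemma vderiv_homog:
  assumes ys: "distinct ys" "x \<notin> set ys" and F: "homog x (insert x (set ys)) n F"
  shows "(n = 0 \<longrightarrow> vderiv x ys F = 0) \<and> homog x (insert x (set ys)) (n - 1) (vderiv x ys F)"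
proof -
  have "F \<in> gspan (set (subseqs (x # ys))) x (pairs (insert x (set ys))) n"
    using homog_gspan[of "x # ys" x n F] assms by simp
  then show ?thesis
  proof (induction rule: gspan.induct)
    case zero
    show ?case by (simp add: homog.zero)
  next
    case (add us m F c)
    let ?p = "single m c" and ?V = "insert x (set ys)"
    note pd = pol_deriv_homog[OF add(2) ys(2), of c]
    have "(n = 0 \<longrightarrow> vderiv x ys (wedgeB us * tauB ?p) = 0)
      \<and> homog x ?V (n - 1) (vderiv x ys (wedgeB us * tauB ?p))"
    proof -
      have hI: "homog x ?V 0 (wedgeB I)" and hxI: "homog x ?V 1 (wedgeB (x # I))"
        if "I \<in> set (subseqs ys)" for I
      proof -
        have sub: "set I \<subseteq> set ys" using that by (rule subseqs_subset)
        then have "count_list I x = 0" using ys(2) by (auto intro: count_notin)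
        then show "homog x ?V 0 (wedgeB I)" "homog x ?V 1 (wedgeB (x # I))"
          using homog_wedgeB[of I ?V x] homog_wedgeB[of "x # I" ?V x] sub by auto
      qed
      from add(1) consider "us \<in> set (subseqs ys)" | I where "I \<in> set (subseqs ys)" "us = x # I"
        unfolding subseqs_Cons by blast
      then show ?thesis
      proof cases
        case 1
        then have "count_list us x = 0"
          using ys(2) subseqs_subset[OF 1] by (auto intro: count_notin)
        then have n: "n = x_deg x m" using add(3) by simp
        show ?thesis
          using pd homog.mult[OF hI[OF 1] pd(2)] unfolding vderiv_wedgeB[OF ys 1] n by simp
      next
        case 2
        then have "count_list I x = 0"
          using ys(2) subseqs_subset[OF 2(1)] by (auto intro: count_notin)
        then have n: "n = Suc (x_deg x m)" using add(3) 2 by simp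
        have A: "homog x ?V (x_deg x m) (scal b * wedgeB I * tauB ?p)" for b
          unfolding mult.assoc
          using homog.mult[OF hI[OF 2(1)] homog_monomial[OF add(2), of x c]]
          by (intro homog_scal_mult) simp
        \<comment> \<open>The factor \<open>wedgeB (x # I)\<close> restores the degree that the
          derivative removes. In degree 0 the truncated subtraction would miscount, but there the
          derivative is 0.\<close>
        have B: "homog x ?V (x_deg x m) (scal b * wedgeB (x # I) * pol_deriv x ys ?p)" for b
        proof (cases "x_deg x m = 0")
          case True
          then show ?thesis using pd(1) by (simp add: homog.zero)
        next
          case False
          then show ?thesis
            unfolding mult.assoc
            using homog.mult[OF hxI[OF 2(1)] pd(2)]
            by (intro homog_scal_mult) simp
        qed
        show ?thesis
          unfolding 2(2) vderiv_wedgeB[OF ys 2(1)] n by (simp add: homog.add A B)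
      qed
    qed
    then show ?case using add.IH by (auto simp: vderiv_add intro: homog.add)
  qed
qed

lemma vderiv_radial_on:
  assumes ys: "distinct ys" "x \<notin> set ys" and F: "F \<in> radial_on (insert x (set ys))"
  shows "vderiv x ys F \<in> radial_on (insert x (set ys))"
proof -
  obtain N Fs where Fs: "\<And>n. homog x (insert x (set ys)) n (Fs n)" and F_eq: "F = (\<Sum>n<N. Fs n)"
    using radial_on_homog_sum[OF F] by metis
  have "vderiv x ys (\<Sum>n<N. Fs n) \<in> radial_on (insert x (set ys))"
    using vderiv_homog[OF ys Fs]
    by (induction N) (auto simp: vderiv_add intro: radial_on_zero radial_on_add homog_radial_on)
  then show ?thesis by (simp add: F_eq)
qed

text \<open>\<open>vderiv\<close> restricted to the subalgebra meets the specification. Any other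
  solution agrees with it on a spanning set, hence by additivity on the subalgebra, and both are
  \<open>undefined\<close> elsewhere.\<close>

lemma vector_deriv_on_eq:
  assumes ys: "distinct ys" "x \<notin> set ys" and F: "F \<in> radial_on (insert x (set ys))"
  shows "vector_deriv_on x ys F = vderiv x ys F"
proof -
  let ?R = "radial_on (insert x (set ys))"
  define spec where "spec D \<longleftrightarrow> D \<in> ?R \<rightarrow>\<^sub>E ?R \<and> B_linear_on ?R D \<and>
     (\<forall>I\<in>set (subseqs ys). \<forall>A\<in>scalars x ys.
        D (wedgeB I * A) = wedgeB I * scalar_deriv x ys A) \<and>
     (\<forall>I\<in>set (subseqs ys). \<forall>B\<in>scalars x ys.
        D (wedgeB (x # I) * B) =
          contr I * wedgeB I * B +
          twist I * wedgeB (x # I) * scalar_deriv x ys B)" for D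
  have in_R: "wedgeB J * tauB p \<in> ?R"
    if "J \<in> set (subseqs (x # ys))" "p \<in> pol_on (pairs (insert x (set ys)))" for J p
  proof (rule radial_on_mult)
    show "wedgeB J \<in> ?R"
      using homog_wedgeB[OF subseqs_subset[OF that(1)]] homog_radial_on by fastforce
    show "tauB p \<in> ?R"
      using that(2)
    proof (induction rule: pol_on_induct)
      case (single m c)
      then show ?case by (rule homog_radial_on[OF homog_monomial])
    qed (simp add: tauB_add radial_on_add)
  qed
  let ?D = "\<lambda>F\<in>?R. vderiv x ys F"
  have spec_D: "spec ?D"
    unfolding spec_def
  proof (intro conjI ballI)
    show "?D \<in> ?R \<rightarrow>\<^sub>E ?R" by (auto simp: vderiv_radial_on[OF ys])
    have "vderiv x ys (scal b * F) = scal b * vderiv x ys F" for b F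
      unfolding tauB_pconst[symmetric] by (rule vderiv_mult_const[of _ "{}"]) simp_all
    then show "B_linear_on ?R ?D"
      unfolding B_linear_on_def
      by (simp add: radial_on_add radial_on_mult radial_on_scal vderiv_add)
  next
    fix I A
    assume "I \<in> set (subseqs ys)" "A \<in> scalars x ys"
    then show "?D (wedgeB I * A) = wedgeB I * scalar_deriv x ys A"
      using in_R[of I, unfolded subseqs_Cons]
      by (auto simp: scalars_def scalars_eq scalar_deriv_tauB[OF ys(2)] vderiv_wedgeB[OF ys])
  next
    fix I B
    assume "I \<in> set (subseqs ys)" "B \<in> scalars x ys"
    then show "?D (wedgeB (x # I) * B) =
          contr I * wedgeB I * B +
          twist I * wedgeB (x # I) * scalar_deriv x ys B"
      using in_R[of "x # I", unfolded subseqs_Cons]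
      by (auto simp: scalars_def scalars_eq scalar_deriv_tauB[OF ys(2)] vderiv_wedgeB[OF ys])
  qed
  have unique: "D = ?D" if D: "spec D" for D
  proof
    have D_PiE: "D \<in> ?R \<rightarrow>\<^sub>E ?R" using D unfolding spec_def by (elim conjE)
    have D_lin: "B_linear_on ?R D" using D unfolding spec_def by (elim conjE)
    have D_I: "\<forall>I\<in>set (subseqs ys). \<forall>A\<in>scalars x ys. D (wedgeB I * A) = wedgeB I * scalar_deriv x ys A"
      using D unfolding spec_def by (elim conjE)
    have D_xI: "\<forall>I\<in>set (subseqs ys). \<forall>B\<in>scalars x ys. D (wedgeB (x # I) * B) =
          contr I * wedgeB I * B +
          twist I * wedgeB (x # I) * scalar_deriv x ys B"
      using D unfolding spec_def by (elim conjE)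
    have D_add: "D (F + G) = D F + D G" if "F \<in> ?R" "G \<in> ?R" for F G
      using D_lin that unfolding B_linear_on_def by simp
    fix F
    show "D F = ?D F"
    proof (cases "F \<in> ?R")
      case False
      then show ?thesis
        using PiE_arb[OF D_PiE False] by simp
    next
      case True
      then have "distinct (x # ys)" "F \<in> radial_on (set (x # ys))" using ys by simp_all
      then have "D F = vderiv x ys F"
      proof (induction rule: radial_on_induct)
        case zero
        have "D (0 + 0) = D 0 + D 0" by (intro D_add radial_on_zero)
        then show ?case by simp
      next
        case (add J m c F)
        let ?p = "single m c"
        have p: "?p \<in> pol_on (pairs (insert x (set ys)))"
          using add(2) by (intro pol_on_single) simp
        then have p': "tauB ?p \<in> scalars x ys" unfolding scalars_def scalars_eq by (rule imageI)
        have "D (wedgeB J * tauB ?p + F) = D (wedgeB J * tauB ?p) + D F"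
          using in_R[OF add(1) p] add(3) by (intro D_add) simp_all
        moreover have "D (wedgeB J * tauB ?p) = vderiv x ys (wedgeB J * tauB ?p)"
        proof -
          from add(1) consider "J \<in> set (subseqs ys)" | I where "I \<in> set (subseqs ys)" "J = x # I"
            unfolding subseqs_Cons by blast
          then show ?thesis
          proof cases
            case 1
            then have "D (wedgeB J * tauB ?p) = wedgeB J * scalar_deriv x ys (tauB ?p)"
              by (rule D_I[rule_format, OF _ p'])
            then show ?thesis
              by (simp add: vderiv_wedgeB[OF ys 1] scalar_deriv_tauB[OF ys(2) p])
          next
            case 2
            have "D (wedgeB (x # I) * tauB ?p) =
              contr I * wedgeB I * tauB ?p +
              twist I * wedgeB (x # I) * scalar_deriv x ys (tauB ?p)"
              by (rule D_xI[rule_format, OF 2(1) p'])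
            then show ?thesis
              by (simp add: 2 vderiv_wedgeB[OF ys 2(1)] scalar_deriv_tauB[OF ys(2) p])
          qed
        qed
        ultimately show ?case using add.IH by (simp add: vderiv_add)
      qed
      with True show ?thesis by simp
    qed
  qed
  have "vector_deriv_on x ys = (THE D. spec D)"
    unfolding vector_deriv_on_def spec_def ..
  also have "\<dots> = ?D" using spec_D unique by (rule the_equality)
  finally show ?thesis using F by simp
qed

lemma vector_deriv_eq:
  assumes ys: "distinct ys" "x \<notin> set ys" and F: "F \<in> radial_on (insert x (set ys))"
  shows "vector_deriv x F = vderiv x ys F"
  unfolding vector_deriv_def
proof (rule the_equality)
  show "\<exists>zs. distinct zs \<and> x \<notin> set zs \<and> F \<in> radial_on (insert x (set zs)) \<and>
      vderiv x ys F = vector_deriv_on x zs F"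
    using assms vector_deriv_on_eq[OF assms] by metis
  fix G
  assume "\<exists>zs. distinct zs \<and> x \<notin> set zs \<and> F \<in> radial_on (insert x (set zs)) \<and>
      G = vector_deriv_on x zs F"
  then obtain zs where zs: "distinct zs" "x \<notin> set zs" "F \<in> radial_on (insert x (set zs))"
    and G: "G = vector_deriv_on x zs F" by blast
  \<comment> \<open>Two enumerations need not be comparable, so each is compared with a common
    enlargement.\<close>
  let ?ws = "remdups (ys @ zs)"
  have ws: "distinct ?ws" "x \<notin> set ?ws" using ys zs by auto
  have "vderiv x ?ws F = vderiv x ys F"
    by (rule vderiv_mono[OF ys ws _ F]) simp
  moreover have "vderiv x ?ws F = vderiv x zs F"
    by (rule vderiv_mono[OF zs(1,2) ws _ zs(3)]) simp
  ultimately show "G = vderiv x ys F" using G vector_deriv_on_eq[OF zs] by simp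
qed

lemma common_finite_support:
  "\<exists>ys. distinct ys \<and> x \<notin> set ys \<and> F \<in> radial_on (insert x (set ys)) \<and> G \<in> radial_on (insert x (set ys))"
proof -
  obtain ys zs where "distinct ys" "x \<notin> set ys" "F \<in> radial_on (insert x (set ys))"
    "distinct zs" "x \<notin> set zs" "G \<in> radial_on (insert x (set zs))"
    using exists_finite_support[of x F] exists_finite_support[of x G] by blast
  then show ?thesis
    by (intro exI[of _ "remdups (ys @ zs)"]) (auto intro: radial_on_mono)
qed

lemma vector_deriv_add: "vector_deriv x (F + G) = vector_deriv x F + vector_deriv x G"
proof -
  obtain ys where "distinct ys" "x \<notin> set ys" "F \<in> radial_on (insert x (set ys))"
    "G \<in> radial_on (insert x (set ys))"
    using common_finite_support[of x F G] by blast
  then show ?thesis by (simp add: vector_deriv_eq radial_on_add vderiv_add)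
qed

lemma vector_deriv_mult_const:
  assumes "t \<in> pol_on (pairs W)" "x \<notin> W"
  shows "vector_deriv x (tauB t * F) = tauB t * vector_deriv x F"
proof -
  obtain ys where "distinct ys" "x \<notin> set ys" "F \<in> radial_on (insert x (set ys))"
    "tauB t \<in> radial_on (insert x (set ys))"
    using common_finite_support[of x F "tauB t"] by blast
  then show ?thesis by (simp add: vector_deriv_eq radial_on_mult vderiv_mult_const[OF assms])
qed

section \<open>The operators on the homogeneous components\<close>

lemma comprehension_product:
  "concat (map (\<lambda>a. concat (map (\<lambda>b. if P a b then [f a b] else []) B)) A)
    = map (\<lambda>(a, b). f a b) (filter (\<lambda>(a, b). P a b) (List.product A B))"
proof -
  have "concat (map (\<lambda>b. if P a b then [f a b] else []) B)
      = map (\<lambda>(a, b). f a b) (filter (\<lambda>(a, b). P a b) (map (Pair a) B))" for a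
    by (induction B) auto
  then show ?thesis by (induction A) simp_all
qed

lemma concat_map_product:
  "concat (map (\<lambda>a. map (f a) B) A) = map (\<lambda>(a, b). f a b) (List.product A B)"
  by (induction A) simp_all

lemma distinct_n_lists:
  assumes "distinct xs"
  shows "distinct (List.n_lists n xs)"
proof (induction n)
  case (Suc n)
  have "distinct (concat (map (\<lambda>ys. map (\<lambda>y. y # ys) xs) yss))" if "distinct yss" for yss
    using that
  proof (induction yss)
    case (Cons ys yss)
    then show ?case using assms by (auto simp: distinct_map inj_on_def)
  qed simp
  with Suc show ?case by simp
qed simp

lemma det_pol_on:
  assumes A: "A \<in> carrier_mat n n" and entries: "\<And>i j. i < n \<Longrightarrow> j < n \<Longrightarrow> A $$ (i, j) \<in> pol_on K"
  shows "det A \<in> pol_on K"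
proof -
  have uminus: "- p \<in> pol_on K" if "p \<in> pol_on K" for p :: "'a pol"
    using that by (simp add: pol_on_def)
  have prod: "prod f I \<in> pol_on K" if "\<And>i. i \<in> I \<Longrightarrow> f i \<in> pol_on K" for f :: "nat \<Rightarrow> 'a pol" and I
    using that by (induction I rule: infinite_finite_induct) (auto intro: pol_on_mult)
  show ?thesis
    unfolding det_def'[OF A]
  proof (rule pol_on_sum)
    fix \<pi> assume "\<pi> \<in> {\<pi>. \<pi> permutes {0..<n}}"
    then have \<pi>: "\<pi> i < n" if "i < n" for i
      using permutes_in_image[of \<pi> "{0..<n}" i] that by simp
    have "(\<Prod>i = 0..<n. A $$ (i, \<pi> i)) \<in> pol_on K"
      by (rule prod) (simp add: entries \<pi>)
    then show "signof \<pi> * (\<Prod>i = 0..<n. A $$ (i, \<pi> i)) \<in> pol_on K"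
      by (auto simp: sign_def uminus)
  qed
qed

text \<open>Cofactors are determinants of minors, so Cramer's rule stays within the coefficients
  over which the derivative is linear.\<close>

lemma adj_mat_pol_on:
  assumes A: "A \<in> carrier_mat n n" and entries: "\<And>i j. i < n \<Longrightarrow> j < n \<Longrightarrow> A $$ (i, j) \<in> pol_on K"
    and ij: "i < n" "j < n"
  shows "adj_mat A $$ (i, j) \<in> pol_on K"
proof -
  have "det (mat_delete A j i) \<in> pol_on K"
  proof (rule det_pol_on)
    show "mat_delete A j i \<in> carrier_mat (n - 1) (n - 1)" by (rule mat_delete_carrier[OF A])
    fix k l assume "k < n - 1" "l < n - 1"
    then show "mat_delete A j i $$ (k, l) \<in> pol_on K"
      using A by (auto simp: mat_delete_def intro!: entries)
  qed
  moreover have "(- 1) ^ (j + i) \<in> (pol_on K :: 'a pol set)"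
    by (cases "even (j + i)") (simp_all add: pol_on_def)
  ultimately show ?thesis
    using A ij by (simp add: adj_mat_def cofactor_def pol_on_mult)
qed

interpretation tau_hom: comm_ring_hom tau
  by unfold_locales
    (simp_all add: tau_def tau.eval_add tau.eval_mult tau.eval_one tau.eval_zero)

locale enumerated =
  fixes x :: 'v and ys :: "'v list"
  assumes ys: "distinct ys" "x \<notin> set ys"
begin

section \<open>Bases of the homogeneous components\<close>

definition vars :: "'v set" where "vars = insert x (set ys)"

text \<open>The indeterminates of \<open>r\<close> and the \<open>s_i\<close>, as opposed to those
  of the \<open>c_ij\<close> in \<open>y_pairs\<close>. Monomials split accordingly: the first part
  indexes the basis, the second is a coefficient.\<close>

definition x_pairs :: "'v uprod set" where "x_pairs = Upair x ` vars"

definition y_pairs :: "'v uprod set" where "y_pairs = pairs (set ys)"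

lemma pairs_vars: "pairs vars = x_pairs \<union> y_pairs"
  by (auto simp: pairs_def vars_def x_pairs_def y_pairs_def)

lemma x_pairs_y_pairs: "x_pairs \<inter> y_pairs = {}"
  using ys by (auto simp: pairs_def x_pairs_def y_pairs_def)

definition wedge_indices :: "'v list list" where "wedge_indices = subseqs (x # ys)"

lemma distinct_xys: "distinct (x # ys)" using ys by simp

lemma set_xys: "set (x # ys) = vars" by (simp add: vars_def)

definition rs_exponent :: "nat \<times> nat list \<Rightarrow> ('v uprod \<Rightarrow>\<^sub>0 nat)" where
  "rs_exponent = (\<lambda>(a, \<beta>). single (Upair x x) a
     + sum_list (map2 (\<lambda>y b. single (Upair x y) b) ys \<beta>))"

lemma lookup_s_exponent:
  assumes "length \<beta> = length zs" "distinct zs"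
  shows "i < length zs \<Longrightarrow> lookup
      (sum_list (map2 (\<lambda>y b. single (Upair x y) b) zs \<beta>)) (Upair x (zs ! i)) = \<beta> ! i"
    and "k \<notin> Upair x ` set zs \<Longrightarrow> lookup
      (sum_list (map2 (\<lambda>y b. single (Upair x y) b) zs \<beta>)) k = 0"
proof -
  let ?S = "\<lambda>zs \<beta>. sum_list (map2 (\<lambda>y b. single (Upair x y) b) zs \<beta>)"
  have *: "(\<forall>i<length zs. lookup (?S zs \<beta>) (Upair x (zs ! i)) = \<beta> ! i) \<and>
      (\<forall>k. k \<notin> Upair x ` set zs \<longrightarrow> lookup (?S zs \<beta>) k = 0)"
    using assms
  proof (induction \<beta> zs rule: list_induct2)
    case (Cons b \<beta> z zs)
    then have IH: "\<forall>i<length zs. lookup (?S zs \<beta>) (Upair x (zs ! i)) = \<beta> ! i"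
      "\<forall>k. k \<notin> Upair x ` set zs \<longrightarrow> lookup (?S zs \<beta>) k = 0" by auto
    have "Upair x z \<notin> Upair x ` set zs" using Cons.prems by auto
    with IH(2) have z: "lookup (?S zs \<beta>) (Upair x z) = 0" by blast
    show ?case
    proof (intro conjI allI impI)
      fix i assume i: "i < length (z # zs)"
      show "lookup (?S (z # zs) (b # \<beta>)) (Upair x ((z # zs) ! i)) = (b # \<beta>) ! i"
      proof (cases i)
        case 0
        with z show ?thesis by (simp add: lookup_add lookup_single)
      next
        case (Suc j)
        with i have "zs ! j \<noteq> z" using Cons.prems by (auto simp: in_set_conv_nth)
        then have "Upair x z \<noteq> Upair x (zs ! j)" by auto
        with Suc i IH(1) show ?thesis by (simp add: lookup_add lookup_single)
      qed
    next
      fix k assume "k \<notin> Upair x ` set (z # zs)"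
      with IH(2) show "lookup (?S (z # zs) (b # \<beta>)) k = 0"
        by (auto simp: lookup_add lookup_single when_def)
    qed
  qed simp
  show "i < length zs \<Longrightarrow> lookup (?S zs \<beta>) (Upair x (zs ! i)) = \<beta> ! i"
    and "k \<notin> Upair x ` set zs \<Longrightarrow> lookup (?S zs \<beta>) k = 0"
    using * by blast+
qed

lemma lookup_rs_exponent:
  assumes "length \<beta> = length ys"
  shows "lookup (rs_exponent (a, \<beta>)) (Upair x x) = a"
    and "i < length ys \<Longrightarrow> lookup (rs_exponent (a, \<beta>)) (Upair x (ys ! i)) = \<beta> ! i"
    and "k \<notin> x_pairs \<Longrightarrow> lookup (rs_exponent (a, \<beta>)) k = 0"
proof -
  note l = lookup_s_exponent[OF assms ys(1)]
  have "Upair x x \<notin> Upair x ` set ys" using ys by auto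
  then show "lookup (rs_exponent (a, \<beta>)) (Upair x x) = a"
    by (simp add: rs_exponent_def lookup_add l(2))
  show "lookup (rs_exponent (a, \<beta>)) (Upair x (ys ! i)) = \<beta> ! i" if "i < length ys"
  proof -
    have "ys ! i \<noteq> x" using that ys by auto
    then have "Upair x x \<noteq> Upair x (ys ! i)" by auto
    then show ?thesis using that by (simp add: rs_exponent_def lookup_add lookup_single l(1))
  qed
  show "lookup (rs_exponent (a, \<beta>)) k = 0" if "k \<notin> x_pairs"
  proof -
    have "k \<noteq> Upair x x" "k \<notin> Upair x ` set ys" using that by (auto simp: x_pairs_def vars_def)
    then show ?thesis by (simp add: rs_exponent_def lookup_add lookup_single l(2))
  qed
qed

lemma x_deg_x_pairs:
  assumes "keys m \<subseteq> x_pairs"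
  shows "x_deg x m = 2 * lookup m (Upair x x)
    + sum_list (map (\<lambda>y. lookup m (Upair x y)) ys)"
proof -
  have inj: "inj_on (Upair x) A" for A by (auto simp: inj_on_def)
  have "x_deg x m = (\<Sum>k\<in>x_pairs. lookup m k * pair_deg x k)"
    by (rule x_deg_superset[OF _ assms]) (simp add: x_pairs_def vars_def)
  also have "\<dots> = (\<Sum>y\<in>vars. lookup m (Upair x y) * pair_deg x (Upair x y))"
    unfolding x_pairs_def by (simp add: sum.reindex[OF inj])
  also have "\<dots> = 2 * lookup m (Upair x x)
      + (\<Sum>y\<in>set ys. lookup m (Upair x y) * pair_deg x (Upair x y))"
    using ys unfolding vars_def by (subst sum.insert) (simp_all add: pair_deg_Upair)
  also have "(\<Sum>y\<in>set ys. lookup m (Upair x y) * pair_deg x (Upair x y))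
      = (\<Sum>y\<in>set ys. lookup m (Upair x y))"
    using ys by (intro sum.cong) (auto simp: pair_deg_Upair)
  also have "\<dots> = sum_list (map (\<lambda>y. lookup m (Upair x y)) ys)"
    using ys by (simp add: sum_list_distinct_conv_sum_set)
  finally show ?thesis .
qed

definition rs_index :: "nat \<Rightarrow> (nat \<times> nat list) list" where
  "rs_index n = filter (\<lambda>(a, \<beta>). 2 * a + sum_list \<beta> = n)
     (List.product [0..<Suc n] (List.n_lists (length ys) [0..<Suc n]))"

definition rs_exponents :: "nat \<Rightarrow> ('v uprod \<Rightarrow>\<^sub>0 nat) list" where
  "rs_exponents n = map rs_exponent (rs_index n)"

lemma distinct_rs_exponents: "distinct (rs_exponents n)"
  unfolding rs_exponents_def distinct_map
proof
  show "distinct (rs_index n)"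
    unfolding rs_index_def by (intro distinct_filter distinct_product distinct_n_lists distinct_upt)
  show "inj_on rs_exponent (set (rs_index n))"
  proof (rule inj_onI, clarify)
    fix a \<beta> a' \<beta>'
    assume "(a, \<beta>) \<in> set (rs_index n)" "(a', \<beta>') \<in> set (rs_index n)"
      and eq: "rs_exponent (a, \<beta>) = rs_exponent (a', \<beta>')"
    then have len: "length \<beta> = length ys" "length \<beta>' = length ys"
      by (auto simp: rs_index_def set_n_lists)
    show "a = a' \<and> \<beta> = \<beta>'"
      using lookup_rs_exponent(1)[OF len(1), of a] lookup_rs_exponent(1)[OF len(2), of a']
        lookup_rs_exponent(2)[OF len(1), of _ a] lookup_rs_exponent(2)[OF len(2), of _ a'] len eq
      by (metis nth_equalityI)
  qed
qed

lemma set_rs_exponents: "set (rs_exponents n) = {m. keys m \<subseteq> x_pairs \<and> x_deg x m = n}"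
proof (intro equalityI subsetI CollectI)
  fix m assume "m \<in> set (rs_exponents n)"
  then obtain a \<beta> where m: "m = rs_exponent (a, \<beta>)" and len: "length \<beta> = length ys"
    and n: "2 * a + sum_list \<beta> = n"
    by (auto simp: rs_exponents_def rs_index_def set_n_lists)
  have keys: "keys m \<subseteq> x_pairs"
    using lookup_rs_exponent(3)[OF len] unfolding m by (auto simp: in_keys_iff)
  have "map (\<lambda>y. lookup m (Upair x y)) ys = \<beta>"
    by (rule nth_equalityI) (simp_all add: len m lookup_rs_exponent(2)[OF len])
  with keys n show "keys m \<subseteq> x_pairs \<and> x_deg x m = n"
    by (simp add: x_deg_x_pairs) (simp add: m lookup_rs_exponent(1)[OF len])
next
  fix m assume "m \<in> {m. keys m \<subseteq> x_pairs \<and> x_deg x m = n}"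
  then have m: "keys m \<subseteq> x_pairs" "x_deg x m = n" by auto
  define a where "a = lookup m (Upair x x)"
  define \<beta> where "\<beta> = map (\<lambda>y. lookup m (Upair x y)) ys"
  have len: "length \<beta> = length ys" by (simp add: \<beta>_def)
  have n: "2 * a + sum_list \<beta> = n" using m by (simp add: x_deg_x_pairs a_def \<beta>_def)
  \<comment> \<open>\<open>rs_index\<close> lists exponents only up to \<open>n\<close>, which loses
    nothing in degree \<open>n\<close>.\<close>
  have "b \<le> n" if "b \<in> set \<beta>" for b
    using member_le_sum_list[OF that] n by simp
  then have "(a, \<beta>) \<in> set (rs_index n)"
    using n len by (auto simp: rs_index_def set_n_lists less_Suc_eq_le simp del: upt_Suc)
  moreover have "m = rs_exponent (a, \<beta>)"
  proof (rule poly_mapping_eqI)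
    fix k
    have "k \<in> x_pairs \<Longrightarrow> k = Upair x x \<or> (\<exists>y\<in>set ys. k = Upair x y)"
      by (auto simp: x_pairs_def vars_def)
    then consider "k = Upair x x" | i where "i < length ys" "k = Upair x (ys ! i)" | "k \<notin> x_pairs"
      by (metis in_set_conv_nth)
    then show "lookup m k = lookup (rs_exponent (a, \<beta>)) k"
    proof cases
      case 3
      then have "lookup m k = 0" using m(1) by (auto simp: in_keys_iff)
      with 3 show ?thesis by (simp add: lookup_rs_exponent(3)[OF len])
    qed (simp_all add: lookup_rs_exponent[OF len], simp_all add: a_def \<beta>_def)
  qed
  ultimately show "m \<in> set (rs_exponents n)" by (auto simp: rs_exponents_def)
qed

text \<open>A power of \<open>r\<close> is a power of half an indeterminate; this is the resulting
  scalar, and \<open>two_power\<close> is its inverse.\<close>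

definition half_power :: "('v uprod \<Rightarrow>\<^sub>0 nat) \<Rightarrow> coeff" where
  "half_power m = ((1 / 2) *\<^sub>R 1) ^ lookup m (Upair x x)"

definition two_power :: "('v uprod \<Rightarrow>\<^sub>0 nat) \<Rightarrow> coeff" where
  "two_power m = two ^ lookup m (Upair x x)"

lemma half_two_power: "half_power m * two_power m = 1"
  unfolding half_power_def two_power_def power_mult_distrib[symmetric] by simp

definition rs_pol :: "('v uprod \<Rightarrow>\<^sub>0 nat) \<Rightarrow> 'v pol" where
  "rs_pol m = single m (half_power m)"

lemma rs_monomials_eq: "rs_monomials x ys n = map (\<lambda>m. tauB (rs_pol m)) (rs_exponents n)"
proof -
  have s: "prod_list (map2 (\<lambda>y b. s_of x y ^ b) zs \<beta>)
      = tauB (single (sum_list (map2 (\<lambda>y b. single (Upair x y) b) zs \<beta>)) 1)" for zs \<beta>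
  proof (induction zs arbitrary: \<beta>)
    case (Cons z zs)
    show ?case
    proof (cases \<beta>)
      case (Cons b \<beta>')
      have "single (single (Upair x z) b
          + sum_list (map2 (\<lambda>y b. single (Upair x y) b) zs \<beta>')) (1::coeff)
         = pvar (Upair x z) ^ b * single (sum_list (map2 (\<lambda>y b. single (Upair x y) b) zs \<beta>')) 1"
        by (simp add: pvar_power mult_single)
      then show ?thesis
        using Cons.IH by (simp add: Cons tauB_mult tauB_power s_of_eq Cons.IH)
    qed simp
  qed simp
  have r: "r_of x ^ a * prod_list (map2 (\<lambda>y b. s_of x y ^ b) ys \<beta>) = tauB (rs_pol (rs_exponent (a, \<beta>)))"
    if "length \<beta> = length ys" for a \<beta>
  proof -
    have "(half * pvar (Upair x x)) ^ a = single (single (Upair x x) a) (((1 / 2) *\<^sub>R 1) ^ a)"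
    proof -
      have "pconst c ^ a = (pconst (c ^ a) :: 'v pol)" for c by (induction a) (simp_all add: pconst_mult)
      then show ?thesis by (simp add: power_mult_distrib pvar_power pconst_def mult_single)
    qed
    then have "r_of x ^ a = tauB (single (single (Upair x x) a) (((1 / 2) *\<^sub>R 1) ^ a))"
      by (simp add: r_of_eq tauB_power[symmetric])
    then show ?thesis
      by (simp add: s tauB_mult[symmetric] mult_single rs_pol_def half_power_def
          lookup_rs_exponent(1)[OF that]) (simp add: rs_exponent_def)
  qed
  have "rs_monomials x ys n = map (\<lambda>(a, \<beta>). r_of x ^ a * prod_list (map2 (\<lambda>y b. s_of x y ^ b) ys \<beta>)) (rs_index n)"
    unfolding rs_monomials_def rs_index_def by (rule comprehension_product)
  also have "\<dots> = map (\<lambda>m. tauB (rs_pol m)) (rs_exponents n)"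
    unfolding rs_exponents_def map_map
  proof (rule map_cong[OF refl])
    fix p assume "p \<in> set (rs_index n)"
    then obtain a \<beta> where p: "p = (a, \<beta>)" "length \<beta> = length ys"
      by (auto simp: rs_index_def set_n_lists simp del: upt_Suc)
    show "(case p of (a, \<beta>) \<Rightarrow> r_of x ^ a * prod_list (map2 (\<lambda>y b. s_of x y ^ b) ys \<beta>))
        = ((\<lambda>m. tauB (rs_pol m)) \<circ> rs_exponent) p"
      unfolding p(1) by (simp only: prod.case comp_apply r[OF p(2)])
  qed
  finally show ?thesis .
qed

text \<open>The order agrees with \<open>H_basis\<close>, so that matrix positions correspond.
  Degree 0 has no basis elements containing \<open>x\<close>.\<close>

definition H_index :: "nat \<Rightarrow> ('v list \<times> ('v uprod \<Rightarrow>\<^sub>0 nat)) list" where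
  "H_index n = List.product (subseqs ys) (rs_exponents n) @
     (case n of 0 \<Rightarrow> [] | Suc n' \<Rightarrow> List.product (map ((#) x) (subseqs ys)) (rs_exponents n'))"

definition H_elem :: "'v list \<times> ('v uprod \<Rightarrow>\<^sub>0 nat) \<Rightarrow> 'v radialB" where
  "H_elem = (\<lambda>(I, m). wedgeB I * tauB (rs_pol m))"

lemma H_basis_eq: "H_basis x ys n = map H_elem (H_index n)"
proof -
  have "[wedgeB I * f. I \<leftarrow> subseqs ys, f \<leftarrow> rs_monomials x ys n]
      = map H_elem (List.product (subseqs ys) (rs_exponents n))" for n
    unfolding rs_monomials_eq H_elem_def concat_map_product[symmetric] by (simp add: comp_def)
  moreover have "[wedgeB (x # I) * f. I \<leftarrow> subseqs ys, f \<leftarrow> rs_monomials x ys n]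
      = map H_elem (List.product (map ((#) x) (subseqs ys)) (rs_exponents n))" for n
    unfolding rs_monomials_eq H_elem_def concat_map_product[symmetric] by (simp add: comp_def)
  ultimately show ?thesis
    unfolding H_basis_def H_index_def by (simp split: nat.split)
qed

lemma count_list_subseqs:
  assumes "I \<in> set (subseqs ys)"
  shows "count_list I x = 0"
  using subseqs_subset[OF assms] ys by (auto intro: count_notin)

lemma set_wedge_indices: "set wedge_indices = (#) x ` set (subseqs ys) \<union> set (subseqs ys)"
  unfolding wedge_indices_def by (rule subseqs_Cons)

lemma set_H_index: "set (H_index n) =
  {(J, m). J \<in> set wedge_indices \<and> keys m \<subseteq> x_pairs \<and> count_list J x + x_deg x m = n}"
  unfolding H_index_def set_wedge_indices
  by (cases n) (auto simp: set_rs_exponents count_list_subseqs)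

lemma distinct_H_index: "distinct (H_index n)"
proof -
  have d: "distinct (subseqs ys)" "distinct (map ((#) x) (subseqs ys))"
    using distinct_set_subseqs[OF ys(1)] by (auto simp: distinct_map intro: inj_onI)
  have "set (subseqs ys) \<inter> (#) x ` set (subseqs ys) = {}"
    using subseqs_subset[of _ ys] ys by fastforce
  then show ?thesis
    unfolding H_index_def
    by (auto simp: distinct_product d distinct_rs_exponents split: nat.split)
qed

abbreviation h_dim :: "nat \<Rightarrow> nat" where "h_dim n \<equiv> length (H_index n)"

abbreviation h_basis :: "nat \<Rightarrow> nat \<Rightarrow> 'v radialB" where "h_basis n i \<equiv> H_elem (H_index n ! i)"

lemma H_elem_homog:
  assumes "(J, m) \<in> set (H_index n)"
  shows "homog x vars n (H_elem (J, m))"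
proof -
  have J: "J \<in> set (subseqs (x # ys))" and m: "keys m \<subseteq> x_pairs"
    and n: "count_list J x + x_deg x m = n"
    using assms by (auto simp: set_H_index wedge_indices_def)
  have "set J \<subseteq> vars" using subseqs_subset[OF J] by (simp add: vars_def)
  moreover have "keys m \<subseteq> pairs vars" using m by (auto simp: pairs_vars)
  ultimately have "homog x vars (count_list J x + x_deg x m) (wedgeB J * tauB (rs_pol m))"
    unfolding rs_pol_def by (intro homog.mult homog_wedgeB homog_monomial)
  then show ?thesis by (simp add: H_elem_def n)
qed

lemma h_basis_homog: "i < h_dim n \<Longrightarrow> homog x vars n (h_basis n i)"
  using H_elem_homog[of "fst (H_index n ! i)" "snd (H_index n ! i)" n] by simp

lemma KT_homog: "t \<in> pol_on y_pairs \<Longrightarrow> homog x vars 0 (tauB t)"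
proof (induction rule: pol_on_induct)
  case (single m c)
  have "keys m \<subseteq> pairs vars" using single by (auto simp: pairs_vars)
  moreover have "x_deg x m = 0"
    unfolding x_deg_def
  proof (rule sum.neutral, rule ballI)
    fix k assume "k \<in> keys m"
    with single ys show "lookup m k * pair_deg x k = 0"
      by (auto simp: y_pairs_def pairs_def pair_deg_def)
  qed
  ultimately show ?case using homog_monomial[of m vars x c] by simp
next
  case (sum p p')
  then show ?case by (simp add: tauB_add homog.add)
qed

lemma H_expansion:
  assumes "homog x vars n F"
  shows "\<exists>t. (\<forall>i. t i \<in> pol_on y_pairs) \<and> F = (\<Sum>i<h_dim n. h_basis n i * tauB (t i))"
proof -
  have "F \<in> gspan (set wedge_indices) x (pairs vars) n"
    unfolding wedge_indices_def set_xys[symmetric]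
    using homog_gspan[OF distinct_xys, of x n F] assms by (simp add: set_xys del: subseqs.simps set_simps)
  then show ?thesis
  proof (induction rule: gspan.induct)
    case zero
    show ?case by (intro exI[of _ "\<lambda>_. 0"]) simp
  next
    case (add J m F c)
    then obtain t where t: "\<And>i. t i \<in> pol_on y_pairs" "F = (\<Sum>i<h_dim n. h_basis n i * tauB (t i))"
      by blast
    \<comment> \<open>The monomial is split into its part in \<open>x_pairs\<close>, which carries
      the whole degree and picks the basis element, and a remainder of degree 0, which becomes a
      coefficient.\<close>
    define \<mu> where "\<mu> = Poly_Mapping.mapp (\<lambda>k a. if k \<in> x_pairs then a else 0) m"
    define \<nu> where "\<nu> = m - \<mu>"
    have lookup_\<mu>: "lookup \<mu> k = (if k \<in> x_pairs then lookup m k else 0)" for k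
      by (simp add: \<mu>_def lookup_mapp when_def in_keys_iff)
    have lookup_\<nu>: "lookup \<nu> k = (if k \<in> x_pairs then 0 else lookup m k)" for k
      by (simp add: \<nu>_def lookup_minus lookup_\<mu>)
    have m: "m = \<mu> + \<nu>"
      by (rule poly_mapping_eqI) (simp add: lookup_add lookup_\<mu> lookup_\<nu>)
    have \<mu>: "keys \<mu> \<subseteq> x_pairs"
      by (auto simp: in_keys_iff lookup_\<mu> split: if_splits)
    have \<nu>: "keys \<nu> \<subseteq> y_pairs"
    proof
      fix k assume "k \<in> keys \<nu>"
      then have "k \<notin> x_pairs" "k \<in> keys m"
        by (auto simp: in_keys_iff lookup_\<nu> split: if_splits)
      with add(2) show "k \<in> y_pairs" unfolding pairs_vars by blast
    qed
    have "x_deg x \<nu> = 0"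
      unfolding x_deg_def
    proof (rule sum.neutral, rule ballI)
      fix k assume "k \<in> keys \<nu>"
      with \<nu> ys show "lookup \<nu> k * pair_deg x k = 0"
        by (auto simp: y_pairs_def pairs_def pair_deg_def)
    qed
    then have "(J, \<mu>) \<in> set (H_index n)"
      using add(1,3) \<mu> by (simp add: set_H_index m x_deg_add)
    then obtain i where i: "i < h_dim n" "H_index n ! i = (J, \<mu>)"
      by (auto simp: in_set_conv_nth)
    \<comment> \<open>\<open>two_power\<close> cancels the power of 1/2 built into
      \<open>rs_pol\<close>.\<close>
    define s where "s = single \<nu> (two_power \<mu> * c)"
    have "rs_pol \<mu> * s = single m c"
      by (simp add: rs_pol_def s_def mult_single m mult.assoc[symmetric] half_two_power)
    then have gen: "wedgeB J * tauB (single m c) = h_basis n i * tauB s"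
      by (simp add: i H_elem_def mult.assoc tauB_mult[symmetric])
    let ?t = "\<lambda>j. (if j = i then s else 0) + t j"
    have "?t j \<in> pol_on y_pairs" for j
      using t(1) \<nu> by (auto intro!: pol_on_add pol_on_single simp: s_def)
    moreover have "wedgeB J * tauB (single m c) + F = (\<Sum>j<h_dim n. h_basis n j * tauB (?t j))"
    proof -
      have "(\<Sum>j<h_dim n. h_basis n j * tauB (if j = i then s else 0))
          = (\<Sum>j<h_dim n. if j = i then h_basis n j * tauB s else 0)"
        by (rule sum.cong) auto
      also have "\<dots> = h_basis n i * tauB s" using i by simp
      finally show ?thesis
        unfolding gen t(2) by (simp add: tauB_add distrib_left sum.distrib)
    qed
    ultimately show ?case by (intro exI[of _ ?t] conjI allI)
  qed
qed

lemma x_pairs_part_unique: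
  assumes "keys \<mu> \<subseteq> x_pairs" "keys \<mu>' \<subseteq> x_pairs"
    "keys \<nu> \<subseteq> y_pairs" "keys \<nu>' \<subseteq> y_pairs" "\<mu> + \<nu> = \<mu>' + \<nu>'"
  shows "\<mu> = \<mu>'"
proof (rule poly_mapping_eqI)
  fix k
  show "lookup \<mu> k = lookup \<mu>' k"
  proof (cases "k \<in> x_pairs")
    case True
    with x_pairs_y_pairs assms(3,4) have "lookup \<nu> k = 0" "lookup \<nu>' k = 0"
      by (auto simp: in_keys_iff)
    then show ?thesis using assms(5) by (metis add.right_neutral lookup_add)
  next
    case False
    with assms(1,2) have "lookup \<mu> k = 0" "lookup \<mu>' k = 0"
      by (auto simp: in_keys_iff)
    then show ?thesis by simp
  qed
qed

lemma lookup_single_mult_y_pairs: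
  assumes "keys \<mu> \<subseteq> x_pairs" "keys \<mu>' \<subseteq> x_pairs" "keys \<nu> \<subseteq> y_pairs"
    "t \<in> pol_on y_pairs"
  shows "lookup (single \<mu>' a * t) (\<mu> + \<nu>)
    = (if \<mu>' = \<mu> then a * lookup t \<nu> else 0)"
  using assms(4)
proof (induction rule: pol_on_induct)
  case (single m c)
  show ?case
    using x_pairs_part_unique[OF assms(2,1) single assms(3)]
    by (auto simp: mult_single lookup_single when_def)
qed (simp add: distrib_left lookup_add)

text \<open>\<open>ev (delta J)\<close> isolates the terms with wedge \<open>J\<close>. The
  coefficient at \<mu> + \<nu> then isolates \<open>i0\<close>, because the coefficients
  \<open>t i\<close> contain no indeterminate from \<open>x_pairs\<close>.\<close>

lemma H_independent:
  assumes t: "\<And>i. i < h_dim n \<Longrightarrow> t i \<in> pol_on y_pairs"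
    and zero: "(\<Sum>i<h_dim n. h_basis n i * tauB (t i)) = 0" and i0: "i0 < h_dim n"
  shows "t i0 = 0"
proof (rule poly_mapping_eqI)
  fix \<nu>
  obtain J \<mu> where J\<mu>: "H_index n ! i0 = (J, \<mu>)" by fastforce
  have in_index: "fst (H_index n ! i) \<in> set (subseqs (x # ys))" "keys (snd (H_index n ! i)) \<subseteq> x_pairs"
    if "i < h_dim n" for i
    using nth_mem[OF that] by (auto simp: set_H_index wedge_indices_def simp del: subseqs.simps)
  show "lookup (t i0) \<nu> = lookup 0 \<nu>"
  proof (cases "keys \<nu> \<subseteq> y_pairs")
    case True
    have "ev (delta J) (h_basis n i * tauB (t i))
        = (if fst (H_index n ! i) = J then rs_pol (snd (H_index n ! i)) * t i else 0)"
      if "i < h_dim n" for i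
      using ev_canonical[OF distinct_xys in_index(1)[OF that], of J] in_index(1)[OF i0] J\<mu>
      by (simp add: H_elem_def case_prod_beta mult.assoc tauB_mult[symmetric] del: subseqs.simps)
    then have "0 = (\<Sum>i<h_dim n. if fst (H_index n ! i) = J then rs_pol (snd (H_index n ! i)) * t i else 0)"
      using arg_cong[OF zero, of "ev (delta J)"] by (simp add: ev_sum)
    then have "0 = lookup
        (\<Sum>i<h_dim n. if fst (H_index n ! i) = J then rs_pol (snd (H_index n ! i)) * t i else 0) (\<mu> + \<nu>)"
      by (metis lookup_zero)
    also have "\<dots> = (\<Sum>i<h_dim n. if i = i0 then half_power \<mu> * lookup (t i0) \<nu> else 0)"
      unfolding lookup_sum
    proof (rule sum.cong[OF refl])
      fix i assume "i \<in> {..<h_dim n}"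
      then have i: "i < h_dim n" by simp
      have \<mu>: "keys \<mu> \<subseteq> x_pairs" using in_index(2)[OF i0] J\<mu> by simp
      have "i = i0 \<longleftrightarrow> H_index n ! i = H_index n ! i0"
        using nth_eq_iff_index_eq[OF distinct_H_index i i0] by blast
      also have "\<dots> \<longleftrightarrow> fst (H_index n ! i) = J \<and> snd (H_index n ! i) = \<mu>"
        unfolding J\<mu> by (metis fst_conv prod.collapse snd_conv)
      finally show "lookup (if fst (H_index n ! i) = J then rs_pol (snd (H_index n ! i)) * t i else 0) (\<mu> + \<nu>)
          = (if i = i0 then half_power \<mu> * lookup (t i0) \<nu> else 0)"
        using lookup_single_mult_y_pairs[OF \<mu> in_index(2)[OF i] True t[OF i]] by (auto simp: rs_pol_def)
    qed
    also have "\<dots> = half_power \<mu> * lookup (t i0) \<nu>" using i0 by simp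
    finally have "two_power \<mu> * (half_power \<mu> * lookup (t i0) \<nu>) = 0" by simp
    then show ?thesis
      using half_two_power[of \<mu>] by (simp add: mult.assoc[symmetric] mult.commute)
  next
    case False
    then show ?thesis using t[OF i0] by (auto simp: pol_on_def in_keys_iff)
  qed
qed

lemma H_unique:
  assumes t: "\<And>i. i < h_dim n \<Longrightarrow> t i \<in> pol_on y_pairs" and t': "\<And>i. i < h_dim n \<Longrightarrow> t' i \<in> pol_on y_pairs"
    and eq: "(\<Sum>i<h_dim n. h_basis n i * tauB (t i)) = (\<Sum>i<h_dim n. h_basis n i * tauB (t' i))"
    and i: "i < h_dim n"
  shows "t i = t' i"
proof -
  have "t i + - t' i = 0"
  proof (rule H_independent[OF _ _ i])
    show "t j + - t' j \<in> pol_on y_pairs" if "j < h_dim n" for j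
      using t[OF that] t'[OF that] by (intro pol_on_add) (simp_all add: pol_on_def)
    show "(\<Sum>j<h_dim n. h_basis n j * tauB (t j + - t' j)) = 0"
      using eq by (simp add: tauB_diff right_diff_distrib sum_subtractf)
  qed
  then show ?thesis by simp
qed

section \<open>The matrices and Cramer's rule\<close>

lemma vderiv_var_homog:
  assumes "homog x vars n F"
  shows "homog x vars n (vderiv x ys (F * var x))"
proof -
  have "homog x vars (n + of_bool (x = x)) (F * var x)"
    by (intro homog.mult assms homog.var) (simp add: vars_def)
  then show ?thesis using vderiv_homog[OF ys, of "Suc n" "F * var x"] by (simp add: vars_def)
qed

text \<open>Existence expands the image of each basis element by \<open>H_expansion\<close>;
  uniqueness is \<open>H_unique\<close> applied column by column.\<close>

lemma K_matrix_eq: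
  "\<exists>T\<in>carrier_mat (h_dim n) (h_dim n). (\<forall>i<h_dim n. \<forall>j<h_dim n. T $$ (i, j) \<in> pol_on y_pairs) \<and>
    K_matrix x ys n = map_mat tau T \<and>
    (\<forall>j<h_dim n. vderiv x ys (h_basis n j * var x) = (\<Sum>i<h_dim n. h_basis n i * tauB (T $$ (i, j))))"
proof -
  let ?d = "h_dim n"
  have "\<exists>t. (\<forall>i. t i \<in> pol_on y_pairs) \<and> vderiv x ys (h_basis n j * var x) = (\<Sum>i<?d. h_basis n i * tauB (t i))"
    if "j < ?d" for j
    by (rule H_expansion, rule vderiv_var_homog, rule h_basis_homog[OF that])
  then have "\<forall>j\<in>{..<?d}. \<exists>t. (\<forall>i. t i \<in> pol_on y_pairs) \<and>
      vderiv x ys (h_basis n j * var x) = (\<Sum>i<?d. h_basis n i * tauB (t i))"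
    by blast
  from bchoice[OF this] obtain t where t: "\<And>j i. j < ?d \<Longrightarrow> t j i \<in> pol_on y_pairs"
    "\<And>j. j < ?d \<Longrightarrow> vderiv x ys (h_basis n j * var x) = (\<Sum>i<?d. h_basis n i * tauB (t j i))"
    by auto
  define T where "T = mat ?d ?d (\<lambda>(i, j). t j i)"
  have T: "T \<in> carrier_mat ?d ?d" by (simp add: T_def)
  have T_entry: "T $$ (i, j) = t j i" if "i < ?d" "j < ?d" for i j using that by (simp add: T_def)
  have basis: "length (H_basis x ys n) = ?d" "H_basis x ys n ! i = h_basis n i" if "i < ?d" for i
    using that by (simp_all add: H_basis_eq)
  have len: "length (H_basis x ys n) = ?d" by (simp add: H_basis_eq)
  have on: "vector_deriv_on x ys (h_basis n j * var x) = vderiv x ys (h_basis n j * var x)" if "j < ?d" for j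
  proof (rule vector_deriv_on_eq[OF ys])
    show "h_basis n j * var x \<in> radial_on (insert x (set ys))"
      using homog_radial_on[OF h_basis_homog[OF that]]
      by (intro radial_on_mult radial_on_var) (simp_all add: vars_def)
  qed
  have "K_matrix x ys n = map_mat tau T"
    unfolding K_matrix_def Let_def len
  proof (rule the_equality)
    show "map_mat tau T \<in> carrier_mat ?d ?d \<and>
       (\<forall>i<?d. \<forall>j<?d. of_central (map_mat tau T $$ (i, j)) \<in> c_scalars ys) \<and>
       (\<forall>j<?d. vector_deriv_on x ys (H_basis x ys n ! j * var x) =
          (\<Sum>i<?d. H_basis x ys n ! i * of_central (map_mat tau T $$ (i, j))))"
      using T t by (auto simp: c_scalars_eq tauB_def[symmetric] T_entry y_pairs_def[symmetric] basis on)
  next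
    fix M
    assume M: "M \<in> carrier_mat ?d ?d \<and>
       (\<forall>i<?d. \<forall>j<?d. of_central (M $$ (i, j)) \<in> c_scalars ys) \<and>
       (\<forall>j<?d. vector_deriv_on x ys (H_basis x ys n ! j * var x) =
          (\<Sum>i<?d. H_basis x ys n ! i * of_central (M $$ (i, j))))"
    \<comment> \<open>The entries of a competing matrix are merely central elements in
      \<open>c_scalars\<close>; polynomial preimages are chosen so that independence can be
      applied.\<close>
    define s where "s i j = (SOME s. s \<in> pol_on y_pairs \<and> of_central (M $$ (i, j)) = tauB s)" for i j
    have "\<exists>s. s \<in> pol_on y_pairs \<and> of_central (M $$ (i, j)) = tauB s" if "i < ?d" "j < ?d" for i j
    proof -
      have "of_central (M $$ (i, j)) \<in> tauB ` pol_on y_pairs"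
        using M that by (simp add: c_scalars_eq y_pairs_def)
      then show ?thesis by blast
    qed
    from someI_ex[OF this] have s: "s i j \<in> pol_on y_pairs" "of_central (M $$ (i, j)) = tauB (s i j)"
      if "i < ?d" "j < ?d" for i j
      using that unfolding s_def by blast+
    have "s i j = t j i" if ij: "i < ?d" "j < ?d" for i j
    proof (rule H_unique[OF _ _ _ ij(1)])
      have "(\<Sum>i<?d. h_basis n i * tauB (s i j)) = vector_deriv_on x ys (h_basis n j * var x)"
        using M ij s(2) by (simp add: basis)
      then show "(\<Sum>i<?d. h_basis n i * tauB (s i j)) = (\<Sum>i<?d. h_basis n i * tauB (t j i))"
        using on[OF ij(2)] t(2)[OF ij(2)] by simp
    qed (use s t ij in auto)
    then show "M = map_mat tau T"
      using M T s(2) by (intro eq_matI) (auto simp: T_entry of_central_inject[symmetric] tauB_def[symmetric])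
  qed
  then show ?thesis using T t by (intro bexI[of _ T]) (auto simp: T_entry)
qed

text \<open>A polynomial lift of the matrix along \<open>tau\<close>: its determinant and adjugate
  can be located in \<open>pol_on y_pairs\<close>, unlike those computed in the centre.\<close>

definition K_pol :: "nat \<Rightarrow> 'v pol mat" where
  "K_pol n = (SOME T. T \<in> carrier_mat (h_dim n) (h_dim n) \<and>
    (\<forall>i<h_dim n. \<forall>j<h_dim n. T $$ (i, j) \<in> pol_on y_pairs) \<and> K_matrix x ys n = map_mat tau T \<and>
    (\<forall>j<h_dim n. vderiv x ys (h_basis n j * var x) = (\<Sum>i<h_dim n. h_basis n i * tauB (T $$ (i, j)))))"

lemma K_pol:
  "K_pol n \<in> carrier_mat (h_dim n) (h_dim n)"
  "i < h_dim n \<Longrightarrow> j < h_dim n \<Longrightarrow> K_pol n $$ (i, j) \<in> pol_on y_pairs"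
  "K_matrix x ys n = map_mat tau (K_pol n)"
  "j < h_dim n \<Longrightarrow> vderiv x ys (h_basis n j * var x)
    = (\<Sum>i<h_dim n. h_basis n i * tauB (K_pol n $$ (i, j)))"
  using someI_ex[OF K_matrix_eq[of n, unfolded Bex_def]] unfolding K_pol_def by blast+

lemma K_det_eq: "K_det x ys n = tau (det (K_pol n))"
  unfolding K_det_def K_pol(3) by (rule tau_hom.hom_det)

lemma det_K_pol: "det (K_pol n) \<in> pol_on y_pairs"
  by (rule det_pol_on[OF K_pol(1,2)])

lemma adj_K_pol:
  "i < h_dim n \<Longrightarrow> j < h_dim n \<Longrightarrow> adj_mat (K_pol n) $$ (i, j) \<in> pol_on y_pairs"
  by (rule adj_mat_pol_on[OF K_pol(1,2)])

lemma K_adj: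
  assumes "i < h_dim n" "j < h_dim n"
  shows "(\<Sum>k<h_dim n. K_pol n $$ (i, k) * adj_mat (K_pol n) $$ (k, j)) = (if i = j then det (K_pol n) else 0)"
    and "(\<Sum>k<h_dim n. adj_mat (K_pol n) $$ (i, k) * K_pol n $$ (k, j)) = (if i = j then det (K_pol n) else 0)"
proof -
  note A = K_pol(1)[of n] and adj = adj_mat[OF K_pol(1)[of n]]
  have "(K_pol n * adj_mat (K_pol n)) $$ (i, j) = (det (K_pol n) \<cdot>\<^sub>m 1\<^sub>m (h_dim n)) $$ (i, j)"
    by (simp only: adj)
  then show "(\<Sum>k<h_dim n. K_pol n $$ (i, k) * adj_mat (K_pol n) $$ (k, j)) = (if i = j then det (K_pol n) else 0)"
    using A adj(1) assms by (simp add: scalar_prod_def lessThan_atLeast0)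
  have "(adj_mat (K_pol n) * K_pol n) $$ (i, j) = (det (K_pol n) \<cdot>\<^sub>m 1\<^sub>m (h_dim n)) $$ (i, j)"
    by (simp only: adj)
  then show "(\<Sum>k<h_dim n. adj_mat (K_pol n) $$ (i, k) * K_pol n $$ (k, j)) = (if i = j then det (K_pol n) else 0)"
    using A adj(1) assms by (simp add: scalar_prod_def lessThan_atLeast0)
qed

lemma x_notin_y_pairs: "x \<notin> set ys" "y_pairs = pairs (set ys)"
  by (simp_all add: ys y_pairs_def)

lemma tauB_shuffle: "tauB t * (G * tauB s) = G * tauB (s * t)"
  unfolding tauB_commute[of t "G * tauB s"] by (simp add: tauB_mult mult.assoc)

text \<open>The coordinates contain no indeterminate from \<open>x_pairs\<close>, so the derivative
  is linear over them and acts on coordinate vectors through \<open>K_pol\<close>.\<close>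

lemma vderiv_combination:
  assumes "\<And>j. j < h_dim n \<Longrightarrow> e j \<in> pol_on y_pairs"
  shows "vderiv x ys ((\<Sum>j<h_dim n. h_basis n j * tauB (e j)) * var x)
    = (\<Sum>i<h_dim n. h_basis n i * tauB (\<Sum>j<h_dim n. K_pol n $$ (i, j) * e j))"
proof -
  have comm: "G * tauB t * H = tauB t * (G * H)" for G H :: "'v radialB" and t
    by (metis mult.assoc tauB_commute)
  have "vderiv x ys ((\<Sum>j<h_dim n. h_basis n j * tauB (e j)) * var x)
      = (\<Sum>j<h_dim n. vderiv x ys (tauB (e j) * (h_basis n j * var x)))"
    by (simp only: sum_distrib_right vderiv_sum comm)
  also have "\<dots> = (\<Sum>j<h_dim n. \<Sum>i<h_dim n. h_basis n i * tauB (K_pol n $$ (i, j) * e j))"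
  proof (rule sum.cong[OF refl])
    fix j assume "j \<in> {..<h_dim n}"
    then have j: "j < h_dim n" by simp
    have "vderiv x ys (tauB (e j) * (h_basis n j * var x)) = tauB (e j) * vderiv x ys (h_basis n j * var x)"
      by (rule vderiv_mult_const[of _ "set ys"]) (use assms[OF j] ys in \<open>simp_all add: y_pairs_def\<close>)
    also have "\<dots> = (\<Sum>i<h_dim n. tauB (e j) * (h_basis n i * tauB (K_pol n $$ (i, j))))"
      by (simp only: K_pol(4)[OF j] sum_distrib_left)
    also have "\<dots> = (\<Sum>i<h_dim n. h_basis n i * tauB (K_pol n $$ (i, j) * e j))"
      by (rule sum.cong[OF refl]) (rule tauB_shuffle)
    finally show "vderiv x ys (tauB (e j) * (h_basis n j * var x))
        = (\<Sum>i<h_dim n. h_basis n i * tauB (K_pol n $$ (i, j) * e j))" .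
  qed
  also have "\<dots> = (\<Sum>i<h_dim n. h_basis n i * tauB (\<Sum>j<h_dim n. K_pol n $$ (i, j) * e j))"
    by (subst sum.swap) (simp only: tauB_sum sum_distrib_left)
  finally show ?thesis .
qed

lemma tauB_det: "tauB (det (K_pol n)) = of_central (K_det x ys n)"
  by (simp add: K_det_eq tauB_def)

lemma vderiv_var_surj:
  assumes "homog x vars n H"
  shows "\<exists>E. homog x vars n E \<and> vderiv x ys (E * var x) = of_central (K_det x ys n) * H"
proof -
  let ?d = "h_dim n" and ?A = "adj_mat (K_pol n)"
  from H_expansion[OF assms] obtain h where h: "\<And>i. h i \<in> pol_on y_pairs"
    "H = (\<Sum>i<?d. h_basis n i * tauB (h i))" by blast
  \<comment> \<open>Cramer's rule without the division: the adjugate applied to the coordinates of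
    \<open>H\<close>.\<close>
  define e where "e j = (\<Sum>k<?d. ?A $$ (j, k) * h k)" for j
  have e: "e j \<in> pol_on y_pairs" if "j < ?d" for j
    unfolding e_def by (intro pol_on_sum pol_on_mult h adj_K_pol that) simp
  define E where "E = (\<Sum>j<?d. h_basis n j * tauB (e j))"
  have "homog x vars n E"
    unfolding E_def
  proof (rule homog_sum)
    fix j assume "j \<in> {..<?d}"
    then have "homog x vars (n + 0) (h_basis n j * tauB (e j))"
      by (intro homog.mult h_basis_homog KT_homog e) simp_all
    then show "homog x vars n (h_basis n j * tauB (e j))" by simp
  qed
  moreover have "vderiv x ys (E * var x) = of_central (K_det x ys n) * H"
  proof -
    have Ke: "(\<Sum>j<?d. K_pol n $$ (i, j) * e j) = det (K_pol n) * h i" if i: "i < ?d" for i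
    proof -
      have "(\<Sum>j<?d. K_pol n $$ (i, j) * e j) = (\<Sum>j<?d. \<Sum>k<?d. K_pol n $$ (i, j) * ?A $$ (j, k) * h k)"
        unfolding e_def by (simp only: sum_distrib_left mult.assoc)
      also have "\<dots> = (\<Sum>k<?d. (\<Sum>j<?d. K_pol n $$ (i, j) * ?A $$ (j, k)) * h k)"
        by (subst sum.swap) (simp only: sum_distrib_right)
      also have "\<dots> = (\<Sum>k<?d. if i = k then det (K_pol n) * h k else 0)"
        by (rule sum.cong) (use K_adj(1)[OF i] in auto)
      also have "\<dots> = det (K_pol n) * h i" using i by simp
      finally show ?thesis .
    qed
    have "vderiv x ys (E * var x) = (\<Sum>i<?d. h_basis n i * tauB (\<Sum>j<?d. K_pol n $$ (i, j) * e j))"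
      unfolding E_def by (rule vderiv_combination) (rule e)
    also have "\<dots> = (\<Sum>i<?d. tauB (det (K_pol n)) * (h_basis n i * tauB (h i)))"
    proof (rule sum.cong[OF refl])
      fix i assume "i \<in> {..<?d}"
      then have "(\<Sum>j<?d. K_pol n $$ (i, j) * e j) = h i * det (K_pol n)"
        by (simp add: Ke mult.commute[of "h i"])
      then show "h_basis n i * tauB (\<Sum>j<?d. K_pol n $$ (i, j) * e j)
          = tauB (det (K_pol n)) * (h_basis n i * tauB (h i))"
        by (simp only: tauB_shuffle)
    qed
    finally show ?thesis
      by (simp add: h(2) sum_distrib_left tauB_det)
  qed
  ultimately show ?thesis by blast
qed

text \<open>The coordinates are annihilated by \<open>K_pol\<close>; multiplying by the adjugate on
  the left leaves the determinant times each coordinate.\<close>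

lemma vderiv_var_inj:
  assumes G: "homog x vars n G" and zero: "vderiv x ys (G * var x) = 0"
  shows "of_central (K_det x ys n) * G = 0"
proof -
  let ?d = "h_dim n" and ?A = "adj_mat (K_pol n)"
  from H_expansion[OF G] obtain g where g: "\<And>i. g i \<in> pol_on y_pairs"
    "G = (\<Sum>i<?d. h_basis n i * tauB (g i))" by blast
  have "(\<Sum>i<?d. h_basis n i * tauB (\<Sum>j<?d. K_pol n $$ (i, j) * g j)) = 0"
    using zero unfolding g(2) by (subst (asm) vderiv_combination) (simp_all add: g)
  then have Kg: "(\<Sum>j<?d. K_pol n $$ (i, j) * g j) = 0" if "i < ?d" for i
    by (rule H_independent[rotated]) (auto intro!: pol_on_sum pol_on_mult K_pol g that)
  have "det (K_pol n) * g k = 0" if k: "k < ?d" for k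
  proof -
    have "0 = (\<Sum>i<?d. ?A $$ (k, i) * (\<Sum>j<?d. K_pol n $$ (i, j) * g j))"
      by (simp add: Kg)
    also have "\<dots> = (\<Sum>i<?d. \<Sum>j<?d. ?A $$ (k, i) * K_pol n $$ (i, j) * g j)"
      by (simp only: sum_distrib_left mult.assoc)
    also have "\<dots> = (\<Sum>j<?d. (\<Sum>i<?d. ?A $$ (k, i) * K_pol n $$ (i, j)) * g j)"
      by (subst sum.swap) (simp only: sum_distrib_right)
    also have "\<dots> = (\<Sum>j<?d. if k = j then det (K_pol n) * g j else 0)"
      by (rule sum.cong) (use K_adj(2)[OF k] in auto)
    also have "\<dots> = det (K_pol n) * g k" using k by simp
    finally show ?thesis by simp
  qed
  then have "tauB (det (K_pol n)) * (h_basis n k * tauB (g k)) = 0" if "k < ?d" for k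
    using that by (simp add: tauB_shuffle mult.commute)
  then show ?thesis by (simp add: g(2) sum_distrib_left tauB_det)
qed

text \<open>Every monomial in a coefficient of the component of degree n has, together with its
  wedge, total degree n. Different components thus share no monomial for a given wedge and cannot
  cancel.\<close>

lemma homog_direct:
  assumes H: "\<And>n. homog x vars n (Hs n)" and zero: "(\<Sum>n<N. Hs n) = 0" and n: "n < N"
  shows "Hs n = 0"
proof -
  have gs: "Hs n \<in> gspan (set wedge_indices) x (pairs vars) n" for n
    unfolding wedge_indices_def set_xys[symmetric]
    using homog_gspan[OF distinct_xys, of x n "Hs n"] H by (simp add: set_xys del: subseqs.simps set_simps)
  have deg: "count_list J x + x_deg x m = n"
    if "F \<in> gspan (set wedge_indices) x (pairs vars) n" "J \<in> set wedge_indices" "m \<in> keys (ev (delta J) F)" for F J m n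
    using that
  proof (induction rule: gspan.induct)
    case (add us m' F c)
    have "ev (delta J) (wedgeB us * tauB (single m' c))
        = (if us = J then single m' c else 0)"
      using ev_canonical[OF distinct_xys, of us J] add(1) add.prems(1) by (simp add: wedge_indices_def del: subseqs.simps)
    with add.prems(2) have "m \<in> keys (if us = J then single m' c else 0)
        \<or> m \<in> keys (ev (delta J) F)"
      using keys_add[of "if us = J then single m' c else 0" "ev (delta J) F"]
      by (auto simp: ev_add)
    then show ?case
      using add by (auto split: if_splits)
  qed simp
  have expand: "F = (\<Sum>J\<in>set wedge_indices. wedgeB J * tauB (ev (delta J) F))"
    if "F \<in> gspan (set wedge_indices) x (pairs vars) n" for F n
    using that
  proof (induction rule: gspan.induct)
    case (add us m' F c)
    have "(\<Sum>J\<in>set wedge_indices. wedgeB J * tauB (ev (delta J) (wedgeB us * tauB (single m' c))))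
        = (\<Sum>J\<in>set wedge_indices. if us = J then wedgeB us * tauB (single m' c) else 0)"
      by (rule sum.cong)
         (use ev_canonical[OF distinct_xys, of us] add(1) in \<open>auto simp: wedge_indices_def simp del: subseqs.simps\<close>)
    also have "\<dots> = wedgeB us * tauB (single m' c)" using add(1) by simp
    finally show ?case
      using add.IH by (simp add: ev_add tauB_add distrib_left sum.distrib)
  qed simp
  have "ev (delta J) (Hs n) = 0" if J: "J \<in> set wedge_indices" for J
  proof (rule poly_mapping_eqI)
    fix m
    show "lookup (ev (delta J) (Hs n)) m = lookup 0 m"
    proof (rule ccontr)
      assume "\<not> ?thesis"
      then have m: "m \<in> keys (ev (delta J) (Hs n))" by (simp add: in_keys_iff)
      then have "count_list J x + x_deg x m = n" by (rule deg[OF gs J])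
      then have other: "lookup (ev (delta J) (Hs k)) m = 0" if "k \<noteq> n" for k
        using deg[OF gs J, of m k] that by (auto simp: in_keys_iff)
      have "0 = lookup (ev (delta J) (\<Sum>k<N. Hs k)) m" using zero by simp
      also have "\<dots> = (\<Sum>k<N. lookup (ev (delta J) (Hs k)) m)"
        by (simp add: ev_sum lookup_sum)
      also have "\<dots> = (\<Sum>k<N. if k = n then lookup (ev (delta J) (Hs k)) m else 0)"
        by (rule sum.cong) (auto simp: other)
      also have "\<dots> = lookup (ev (delta J) (Hs n)) m" using n by simp
      finally show False using m by (simp add: in_keys_iff)
    qed
  qed
  then show ?thesis using expand[OF gs, of n] by simp
qed

lemma K_det_Omega: "K_det x ys n \<in> Omega_mon x"
  unfolding Omega_mon_def using ys by (intro mult_closure.gen) blast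

end

text \<open>Determinants over different sets Y multiply to a polynomial over the union of these
  sets, which still avoids \<open>x\<close>. Hence the derivative is linear over the whole
  multiplicative set.\<close>

lemma Omega_mon_tau:
  "\<omega> \<in> Omega_mon x \<Longrightarrow> \<exists>t W. x \<notin> W \<and> t \<in> pol_on (pairs W) \<and> \<omega> = tau t"
  unfolding Omega_mon_def
proof (induction rule: mult_closure.induct)
  case one
  show ?case by (intro exI[of _ 1] exI[of _ "{}"]) simp
next
  case (gen g)
  then obtain ys k where g: "g = K_det x ys k" and ys: "distinct ys" "x \<notin> set ys" by blast
  interpret enumerated x ys by standard (rule ys)+
  show ?case
    unfolding g K_det_eq using det_K_pol x_notin_y_pairs by auto
next
  case (mult a b)
  then obtain t W s W' where t: "x \<notin> W" "t \<in> pol_on (pairs W)" "a = tau t"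
    and s: "x \<notin> W'" "s \<in> pol_on (pairs W')" "b = tau s" by blast
  have "t * s \<in> pol_on (pairs (W \<union> W'))"
    using pol_on_mono[OF t(2) pairs_mono[OF Un_upper1]] pol_on_mono[OF s(2) pairs_mono[OF Un_upper2]]
    by (rule pol_on_mult)
  then show ?case
    using t s by (intro exI[of _ "t * s"] exI[of _ "W \<union> W'"]) (simp add: tau_hom.hom_mult)
qed

lemma vector_deriv_Omega:
  assumes "\<omega> \<in> Omega_mon x"
  shows "vector_deriv x (of_central \<omega> * F) = of_central \<omega> * vector_deriv x F"
proof -
  from Omega_mon_tau[OF assms] obtain t W where
    "x \<notin> W" "t \<in> pol_on (pairs W)" "\<omega> = tau t" by blast
  then show ?thesis using vector_deriv_mult_const[of t W x F] by (simp add: tauB_def)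
qed

lemma Omega_mon_mult: "a \<in> Omega_mon x \<Longrightarrow> b \<in> Omega_mon x \<Longrightarrow> a * b \<in> Omega_mon x"
  and Omega_mon_one: "1 \<in> Omega_mon x"
  unfolding Omega_mon_def by (auto intro: mult_closure.intros)

text \<open>The derivative of the component of degree k + 1 has degree k, where
  \<open>vderiv_var_surj\<close> solves the equation up to the determinant of degree k. The finitely
  many components are then brought to a common denominator.\<close>

lemma vector_deriv_var_surj:
  "\<exists>d\<in>Omega_mon x. \<exists>E. vector_deriv x (of_central d * F) = vector_deriv x (E * var x)"
proof -
  obtain ys where ys: "distinct ys" "x \<notin> set ys" and F: "F \<in> radial_on (insert x (set ys))"
    using exists_finite_support[of x F] by blast
  interpret enumerated x ys by standard (rule ys)+
  have zero: "vector_deriv x 0 = 0" using vector_deriv_add[of x 0 0] by simp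
  obtain N Fs where Fs: "\<And>n. homog x vars n (Fs n)" and F_eq: "F = (\<Sum>n<N. Fs n)"
    using radial_on_homog_sum[OF F, of x] unfolding vars_def by blast
  have piece: "\<exists>d\<in>Omega_mon x. \<exists>E. vector_deriv x (of_central d * Fs n) = vector_deriv x (E * var x)" for n
  proof (cases n)
    \<comment> \<open>Degree 0 is killed by the derivative, so \<open>E = 0\<close> solves the
      equation.\<close>
    case 0
    have "vderiv x ys (Fs 0) = 0"
      using vderiv_homog[OF ys, of 0 "Fs 0"] Fs[of 0] by (simp add: vars_def)
    then have "vector_deriv x (Fs 0) = 0"
      using vector_deriv_eq[OF ys, of "Fs 0"] homog_radial_on[OF Fs[of 0]] by (simp add: vars_def)
    then show ?thesis
      by (intro bexI[of _ 1] exI[of _ 0]) (simp_all add: 0 zero of_central_hom Omega_mon_one)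
  next
    case (Suc k)
    have "homog x vars k (vderiv x ys (Fs n))"
      using vderiv_homog[OF ys, of n "Fs n"] Fs[of n] by (simp add: vars_def Suc)
    from vderiv_var_surj[OF this] obtain E where E: "homog x vars k E"
      "vderiv x ys (E * var x) = of_central (K_det x ys k) * vderiv x ys (Fs n)" by blast
    have "E * var x \<in> radial_on vars"
      using homog_radial_on[OF E(1)] by (intro radial_on_mult radial_on_var) (simp_all add: vars_def)
    then have "vector_deriv x (E * var x) = of_central (K_det x ys k) * vector_deriv x (Fs n)"
      using vector_deriv_eq[OF ys] homog_radial_on[OF Fs[of n]] E(2) by (simp add: vars_def)
    then show ?thesis
      by (intro bexI[of _ "K_det x ys k"] exI[of _ E]) (simp_all add: vector_deriv_Omega K_det_Omega)
  qed
  have "\<exists>d\<in>Omega_mon x. \<exists>E. vector_deriv x (of_central d * (\<Sum>n<N. Fs n)) = vector_deriv x (E * var x)"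
  proof (induction N)
    case 0
    show ?case
      by (intro bexI[of _ 1] exI[of _ 0]) (simp_all add: Omega_mon_one)
  next
    case (Suc N)
    then obtain d E where d: "d \<in> Omega_mon x"
      "of_central d * vector_deriv x (\<Sum>n<N. Fs n) = vector_deriv x (E * var x)"
      by (auto simp: vector_deriv_Omega)
    from piece[of N] obtain d' E' where d': "d' \<in> Omega_mon x"
      "of_central d' * vector_deriv x (Fs N) = vector_deriv x (E' * var x)"
      by (auto simp: vector_deriv_Omega)
    \<comment> \<open>Over the common denominator \<open>d * d'\<close> each old solution is
      multiplied by the denominator of the other.\<close>
    have "vector_deriv x (of_central (d * d') * (\<Sum>n<Suc N. Fs n))
        = of_central (d * d') * vector_deriv x (\<Sum>n<N. Fs n) + of_central (d * d') * vector_deriv x (Fs N)"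
      by (simp add: vector_deriv_Omega Omega_mon_mult d d' vector_deriv_add distrib_left)
    also have "of_central (d * d') * vector_deriv x (\<Sum>n<N. Fs n) = vector_deriv x (of_central d' * E * var x)"
      by (simp add: mult.commute[of d] of_central_hom mult.assoc vector_deriv_Omega d d')
    also have "of_central (d * d') * vector_deriv x (Fs N) = vector_deriv x (of_central d * E' * var x)"
      by (simp add: of_central_hom mult.assoc vector_deriv_Omega d d')
    finally have "vector_deriv x (of_central (d * d') * (\<Sum>n<Suc N. Fs n))
        = vector_deriv x ((of_central d' * E + of_central d * E') * var x)"
      by (simp add: vector_deriv_add distrib_right)
    then show ?case using Omega_mon_mult[OF d(1) d'(1)] by blast
  qed
  then show ?thesis by (simp add: F_eq)
qed

lemma vector_deriv_var_inj:
  assumes zero: "vector_deriv x (G * var x) = 0"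
  shows "\<exists>d\<in>Omega_mon x. of_central d * G = 0"
proof -
  obtain ys where ys: "distinct ys" "x \<notin> set ys" and G: "G \<in> radial_on (insert x (set ys))"
    using exists_finite_support[of x G] by blast
  interpret enumerated x ys by standard (rule ys)+
  obtain N Gs where Gs: "\<And>n. homog x vars n (Gs n)" and G_eq: "G = (\<Sum>n<N. Gs n)"
    using radial_on_homog_sum[OF G, of x] unfolding vars_def by blast
  have "G * var x \<in> radial_on (insert x (set ys))"
    by (intro radial_on_mult radial_on_var G) simp
  then have "vderiv x ys (G * var x) = 0" using vector_deriv_eq[OF ys] zero by simp
  then have "(\<Sum>n<N. vderiv x ys (Gs n * var x)) = 0"
    by (simp add: G_eq sum_distrib_right vderiv_sum)
  then have "vderiv x ys (Gs n * var x) = 0" if "n < N" for n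
    using homog_direct[OF vderiv_var_homog[OF Gs]] that by blast
  then have kill: "of_central (K_det x ys n) * Gs n = 0" if "n < N" for n
    using vderiv_var_inj[OF Gs] that by blast
  \<comment> \<open>The determinant of degree n kills the component of degree n, so the product over
    all degrees kills every component.\<close>
  define d where "d = (\<Prod>n<N. K_det x ys n)"
  have "(\<Prod>n\<in>A. K_det x ys n) \<in> Omega_mon x" for A
    by (induction A rule: infinite_finite_induct) (auto intro: Omega_mon_one Omega_mon_mult K_det_Omega)
  then have "d \<in> Omega_mon x" unfolding d_def .
  moreover have "of_central d * Gs n = 0" if "n < N" for n
  proof -
    have "d = (\<Prod>n\<in>{..<N} - {n}. K_det x ys n) * K_det x ys n"
      unfolding d_def using that by (subst prod.remove[of _ n]) (simp_all add: mult.commute)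
    then show ?thesis using kill[OF that] by (simp add: of_central_hom mult.assoc)
  qed
  then have "of_central d * G = 0" by (simp add: G_eq sum_distrib_left)
  ultimately show ?thesis by blast
qed

section \<open>Localization\<close>

locale central_localization =
  fixes \<Omega> :: "'a::ring_1 central set"
  assumes one_in: "1 \<in> \<Omega>" and mult_in: "a \<in> \<Omega> \<Longrightarrow> b \<in> \<Omega> \<Longrightarrow> a * b \<in> \<Omega>"
begin

abbreviation "M \<equiv> localization \<Omega>"
abbreviation "lfrac \<equiv> loc_frac \<Omega>"

lemma act_assoc: "of_central a * (of_central b * F) = of_central (a * b) * F"
  by (simp add: times_central.rep_eq mult.assoc)

lemma act_right: "F * (of_central a * G) = of_central a * (F * G)"
  by (metis mult.assoc of_central_commute)

lemma act_mult: "(of_central a * F) * (of_central b * G) = of_central (a * b) * (F * G)"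
  by (simp only: mult.assoc act_right[of F] act_assoc)

lemma loc_rel_iff: "((F, s), (G, t)) \<in> loc_rel \<Omega> \<longleftrightarrow> s \<in> \<Omega> \<and> t \<in> \<Omega> \<and>
    (\<exists>u\<in>\<Omega>. of_central (u * t) * F = of_central (u * s) * G)"
  by (simp add: loc_rel_def right_diff_distrib act_assoc)

lemma equiv_loc_rel: "equiv (UNIV \<times> \<Omega>) (loc_rel \<Omega>)"
proof (rule equivI)
  show "loc_rel \<Omega> \<subseteq> (UNIV \<times> \<Omega>) \<times> (UNIV \<times> \<Omega>)"
    by (auto simp: loc_rel_def)
  show "refl_on (UNIV \<times> \<Omega>) (loc_rel \<Omega>)"
    using one_in by (auto simp: refl_on_def loc_rel_iff)
  show "sym (loc_rel \<Omega>)"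
    by (rule symI) (auto simp: loc_rel_iff, metis)
  show "trans (loc_rel \<Omega>)"
  proof (rule transI, clarify)
    fix F s G t H r
    assume "((F, s), (G, t)) \<in> loc_rel \<Omega>" "((G, t), (H, r)) \<in> loc_rel \<Omega>"
    then obtain u v where mem: "s \<in> \<Omega>" "t \<in> \<Omega>" "r \<in> \<Omega>" "u \<in> \<Omega>" "v \<in> \<Omega>"
      and u: "of_central (u * t) * F = of_central (u * s) * G"
      and v: "of_central (v * r) * G = of_central (v * t) * H"
      by (auto simp: loc_rel_iff)
    \<comment> \<open>The middle denominator \<open>t\<close> cannot be cancelled; it is absorbed
      into the witness \<open>u * v * t\<close>.\<close>
    have "of_central (u * v * t * r) * F = of_central (v * r) * (of_central (u * t) * F)"
      by (simp add: act_assoc ac_simps)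
    also have "\<dots> = of_central (u * s) * (of_central (v * r) * G)"
      unfolding u by (simp add: act_assoc ac_simps)
    also have "\<dots> = of_central (u * v * t * s) * H"
      unfolding v by (simp add: act_assoc ac_simps)
    finally show "((F, s), (H, r)) \<in> loc_rel \<Omega>"
      using mem by (auto simp: loc_rel_iff intro!: bexI[of _ "u * v * t"] mult_in)
  qed
qed

lemma frac_eq_iff:
  assumes "s \<in> \<Omega>" "t \<in> \<Omega>"
  shows "lfrac F s = lfrac G t \<longleftrightarrow> (\<exists>u\<in>\<Omega>. of_central (u * t) * F = of_central (u * s) * G)"
  unfolding loc_frac_def
  by (subst eq_equiv_class_iff[OF equiv_loc_rel]) (use assms in \<open>auto simp: loc_rel_iff\<close>)

lemma frac_eqI:
  "s \<in> \<Omega> \<Longrightarrow> t \<in> \<Omega> \<Longrightarrow> of_central t * F = of_central s * G \<Longrightarrow> lfrac F s = lfrac G t"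
  by (subst frac_eq_iff) (auto intro!: bexI[OF _ one_in])

lemma carrier_eq: "carrier M = {lfrac F s | F s. s \<in> \<Omega>}"
  by (auto simp: localization_def quotient_def loc_frac_def)

lemma frac_carrier: "s \<in> \<Omega> \<Longrightarrow> lfrac F s \<in> carrier M"
  by (auto simp: carrier_eq)

lemma carrierE:
  assumes "A \<in> carrier M"
  obtains F s where "A = lfrac F s" "s \<in> \<Omega>"
  using assms by (auto simp: carrier_eq)

text \<open>The operations are unions over all representatives. If each representative yields the
  same class, the union over a nonempty class is that class, so well-definedness and evaluation are
  one step.\<close>

lemma UN_frac:
  assumes "s \<in> \<Omega>"
    and "\<And>G t u. t \<in> \<Omega> \<Longrightarrow> u \<in> \<Omega> \<Longrightarrow> of_central (u * t) * F = of_central (u * s) * G \<Longrightarrow> g G t = C"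
  shows "(\<Union>(G, t)\<in>lfrac F s. g G t) = C"
proof -
  have "(F, s) \<in> lfrac F s"
    unfolding loc_frac_def by (rule equiv_class_self[OF equiv_loc_rel]) (simp add: assms(1))
  then have "lfrac F s \<noteq> {}" by blast
  moreover have "(case p of (G, t) \<Rightarrow> g G t) = C" if "p \<in> lfrac F s" for p
    using that assms(2) by (auto simp: loc_frac_def loc_rel_iff)
  ultimately show ?thesis by auto
qed

lemma frac_mult:
  assumes s: "s \<in> \<Omega>" and t: "t \<in> \<Omega>"
  shows "lfrac F s \<otimes>\<^bsub>M\<^esub> lfrac G t = lfrac (F * G) (s * t)"
proof -
  have "(\<Union>(F', s')\<in>lfrac F s. \<Union>(G', t')\<in>lfrac G t. lfrac (F' * G') (s' * t')) = lfrac (F * G) (s * t)"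
  proof (intro UN_frac s t)
    fix F' s' u G' t' v
    assume mem: "s' \<in> \<Omega>" "u \<in> \<Omega>" "t' \<in> \<Omega>" "v \<in> \<Omega>"
      and u: "of_central (u * s') * F = of_central (u * s) * F'"
      and v: "of_central (v * t') * G = of_central (v * t) * G'"
    have "of_central (u * v * (s * t)) * (F' * G') = (of_central (u * s) * F') * (of_central (v * t) * G')"
      unfolding act_mult by (simp add: ac_simps)
    also have "\<dots> = (of_central (u * s') * F) * (of_central (v * t') * G)"
      by (simp only: u v)
    also have "\<dots> = of_central (u * v * (s' * t')) * (F * G)"
      unfolding act_mult by (simp add: ac_simps)
    finally show "lfrac (F' * G') (s' * t') = lfrac (F * G) (s * t)"
      using mem s t by (subst frac_eq_iff) (auto intro!: mult_in bexI[of _ "u * v"])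
  qed
  then show ?thesis by (simp add: localization_def)
qed

lemma frac_add:
  assumes s: "s \<in> \<Omega>" and t: "t \<in> \<Omega>"
  shows "lfrac F s \<oplus>\<^bsub>M\<^esub> lfrac G t = lfrac (of_central t * F + of_central s * G) (s * t)"
proof -
  have "(\<Union>(F', s')\<in>lfrac F s. \<Union>(G', t')\<in>lfrac G t. lfrac (of_central t' * F' + of_central s' * G') (s' * t'))
      = lfrac (of_central t * F + of_central s * G) (s * t)"
  proof (intro UN_frac s t)
    fix F' s' u G' t' v
    assume mem: "s' \<in> \<Omega>" "u \<in> \<Omega>" "t' \<in> \<Omega>" "v \<in> \<Omega>"
      and u: "of_central (u * s') * F = of_central (u * s) * F'"
      and v: "of_central (v * t') * G = of_central (v * t) * G'"
    have "of_central (u * v * (s * t)) * (of_central t' * F' + of_central s' * G')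
        = of_central (v * t * t') * (of_central (u * s) * F') + of_central (u * s * s') * (of_central (v * t) * G')"
      by (simp add: distrib_left act_assoc ac_simps)
    also have "\<dots> = of_central (v * t * t') * (of_central (u * s') * F) + of_central (u * s * s') * (of_central (v * t') * G)"
      by (simp only: u v)
    also have "\<dots> = of_central (u * v * (s' * t')) * (of_central t * F + of_central s * G)"
      by (simp add: distrib_left act_assoc ac_simps)
    finally show "lfrac (of_central t' * F' + of_central s' * G') (s' * t')
        = lfrac (of_central t * F + of_central s * G) (s * t)"
      using mem s t by (subst frac_eq_iff) (auto intro!: mult_in bexI[of _ "u * v"])
  qed
  then show ?thesis by (simp add: localization_def)
qed

lemma zero_eq: "\<zero>\<^bsub>M\<^esub> = lfrac 0 1"
  by (simp add: localization_def)

lemma frac_zero: "s \<in> \<Omega> \<Longrightarrow> lfrac 0 s = \<zero>\<^bsub>M\<^esub>"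
  unfolding zero_eq by (rule frac_eqI) (simp_all add: one_in)

lemma frac_same_add: "s \<in> \<Omega> \<Longrightarrow> lfrac F s \<oplus>\<^bsub>M\<^esub> lfrac G s = lfrac (F + G) s"
  by (simp add: frac_add) (rule frac_eqI, simp_all add: mult_in distrib_left act_assoc)

lemma abelian_group_localization: "abelian_group M"
proof (rule abelian_groupI)
  fix A B C
  assume "A \<in> carrier M" "B \<in> carrier M" "C \<in> carrier M"
  then obtain F s G t H r where A: "A = lfrac F s" "s \<in> \<Omega>" and B: "B = lfrac G t" "t \<in> \<Omega>"
    and C: "C = lfrac H r" "r \<in> \<Omega>" by (elim carrierE)
  show "A \<oplus>\<^bsub>M\<^esub> B \<oplus>\<^bsub>M\<^esub> C = A \<oplus>\<^bsub>M\<^esub> (B \<oplus>\<^bsub>M\<^esub> C)"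
    using A B C by (simp add: frac_add mult_in distrib_left act_assoc ac_simps)
next
  fix A B
  assume "A \<in> carrier M" "B \<in> carrier M"
  then obtain F s G t where A: "A = lfrac F s" "s \<in> \<Omega>" and B: "B = lfrac G t" "t \<in> \<Omega>"
    by (elim carrierE)
  show "A \<oplus>\<^bsub>M\<^esub> B \<in> carrier M"
    using A B by (simp add: frac_add frac_carrier mult_in)
  show "A \<oplus>\<^bsub>M\<^esub> B = B \<oplus>\<^bsub>M\<^esub> A"
    using A B by (simp add: frac_add ac_simps)
next
  show "\<zero>\<^bsub>M\<^esub> \<in> carrier M" by (simp add: zero_eq frac_carrier one_in)
  fix A
  assume "A \<in> carrier M"
  then obtain F s where A: "A = lfrac F s" "s \<in> \<Omega>" by (elim carrierE)
  show "\<zero>\<^bsub>M\<^esub> \<oplus>\<^bsub>M\<^esub> A = A"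
    using A by (simp add: zero_eq frac_add one_in one_central.rep_eq)
  have "lfrac (- F) s \<oplus>\<^bsub>M\<^esub> A = \<zero>\<^bsub>M\<^esub>"
    using A by (simp add: frac_same_add frac_zero)
  then show "\<exists>B\<in>carrier M. B \<oplus>\<^bsub>M\<^esub> A = \<zero>\<^bsub>M\<^esub>"
    using A frac_carrier by blast
qed

section \<open>Extension of operators to the localization\<close>

context
  fixes D :: "'a \<Rightarrow> 'a"
  assumes D_add: "D (F + G) = D F + D G"
    and D_linear: "\<omega> \<in> \<Omega> \<Longrightarrow> D (of_central \<omega> * F) = of_central \<omega> * D F"
begin

lemma loc_extend_frac:
  assumes s: "s \<in> \<Omega>"
  shows "loc_extend \<Omega> D (lfrac F s) = lfrac (D F) s"
  unfolding loc_extend_def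
proof (intro UN_frac s)
  fix G t u
  assume mem: "t \<in> \<Omega>" "u \<in> \<Omega>" and u: "of_central (u * t) * F = of_central (u * s) * G"
  have "of_central (u * t) * D F = of_central (u * s) * D G"
    using arg_cong[OF u, of D] mem s by (simp add: D_linear mult_in)
  then show "lfrac (D G) t = lfrac (D F) s"
    using mem s by (subst frac_eq_iff) (auto intro!: bexI[of _ u])
qed

lemma loc_extend_hom: "abelian_group_hom M M (loc_extend \<Omega> D)"
proof (rule abelian_group_homI[OF abelian_group_localization abelian_group_localization])
  show "group_hom (add_monoid M) (add_monoid M) (loc_extend \<Omega> D)"
  proof (rule group_hom.intro)
    interpret abelian_group M by (rule abelian_group_localization)
    show "group (add_monoid M)" by (rule a_group)
    then show "group (add_monoid M)" .
    show "group_hom_axioms (add_monoid M) (add_monoid M) (loc_extend \<Omega> D)"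
    proof (rule group_hom_axioms.intro, rule homI)
      fix A B
      assume "A \<in> carrier (add_monoid M)" "B \<in> carrier (add_monoid M)"
      then obtain F s G t where A: "A = lfrac F s" "s \<in> \<Omega>" and B: "B = lfrac G t" "t \<in> \<Omega>"
        by (auto elim!: carrierE)
      show "loc_extend \<Omega> D A \<in> carrier (add_monoid M)"
        using A by (simp add: loc_extend_frac frac_carrier)
      show "loc_extend \<Omega> D (A \<otimes>\<^bsub>add_monoid M\<^esub> B)
          = loc_extend \<Omega> D A \<otimes>\<^bsub>add_monoid M\<^esub> loc_extend \<Omega> D B"
        using A B by (simp add: frac_add loc_extend_frac mult_in D_add D_linear)
    qed
  qed
qed

end

text \<open>The last two hypotheses say that \<open>F \<mapsto> D (F x)\<close> becomes injective after localization and that its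
  image there contains the image of \<open>D\<close>.\<close>

lemma localization_direct_sum:
  assumes D_add: "\<And>F G. D (F + G) = D F + D G"
    and D_linear: "\<And>\<omega> F. \<omega> \<in> \<Omega> \<Longrightarrow> D (of_central \<omega> * F) = of_central \<omega> * D F"
    and surj: "\<And>F. \<exists>d\<in>\<Omega>. \<exists>E. D (of_central d * F) = D (E * x)"
    and inj: "\<And>G. D (G * x) = 0 \<Longrightarrow> \<exists>d\<in>\<Omega>. of_central d * G = 0"
  shows "internal_direct_sum M (a_kernel M M (loc_extend \<Omega> D))
    (loc_extend \<Omega> (\<lambda>F. F * x) ` carrier M)"
proof -
  let ?D = "loc_extend \<Omega> D" and ?R = "loc_extend \<Omega> (\<lambda>F. F * x)"
  interpret abelian_group M by (rule abelian_group_localization)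
  interpret D: abelian_group_hom M M ?D by (rule loc_extend_hom[OF D_add D_linear])
  interpret R: abelian_group_hom M M ?R by (rule loc_extend_hom) (simp_all add: distrib_right mult.assoc)
  have D_frac: "?D (lfrac F s) = lfrac (D F) s" if "s \<in> \<Omega>" for F s
    by (rule loc_extend_frac[OF D_add D_linear that])
  have R_frac: "?R (lfrac F s) = lfrac (F * x) s" if "s \<in> \<Omega>" for F s
    by (rule loc_extend_frac) (simp_all add: distrib_right mult.assoc that)
  have D_diff: "D (F - G) = D F - D G" for F G
    using D_add[of "F - G" G] by simp
  show ?thesis
    unfolding internal_direct_sum_def
  proof (intro conjI ballI)
    show "additive_subgroup (a_kernel M M ?D) M" by (rule D.additive_subgroup_a_kernel)
    show "additive_subgroup (?R ` carrier M) M"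
      by (rule additive_subgroup.intro) (use group_hom.img_is_subgroup[OF R.a_group_hom] in simp)
    fix A assume "A \<in> carrier M"
    then obtain F s where A: "A = lfrac F s" and s: "s \<in> \<Omega>" by (elim carrierE)
    from surj[of F] obtain d E where d: "d \<in> \<Omega>" and E: "D (of_central d * F) = D (E * x)" by blast
    \<comment> \<open>The fraction is expanded by \<open>d\<close>; subtracting \<open>E x\<close>
      from \<open>d F\<close> then leaves a numerator that \<open>D\<close> kills.\<close>
    let ?k = "lfrac (of_central d * F - E * x) (d * s)" and ?l = "lfrac (E * x) (d * s)"
    have ds: "d * s \<in> \<Omega>" using d s by (rule mult_in)
    show "\<exists>!p. p \<in> a_kernel M M ?D \<times> ?R ` carrier M \<and> A = fst p \<oplus>\<^bsub>M\<^esub> snd p"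
    proof (rule ex1I[of _ "(?k, ?l)"])
      have "?k \<in> a_kernel M M ?D"
        unfolding a_kernel_def'
        using ds by (simp add: frac_carrier D_frac D_diff E frac_zero)
      moreover have "?l \<in> ?R ` carrier M"
        using R_frac[OF ds, of E] frac_carrier[OF ds] by (metis imageI)
      moreover have "A = ?k \<oplus>\<^bsub>M\<^esub> ?l"
        unfolding A frac_same_add[OF ds]
        by (rule frac_eqI) (simp_all add: s ds act_assoc ac_simps)
      ultimately show "(?k, ?l) \<in> a_kernel M M ?D \<times> ?R ` carrier M \<and> A = fst (?k, ?l) \<oplus>\<^bsub>M\<^esub> snd (?k, ?l)"
        by simp
      \<comment> \<open>Applying \<open>D\<close> removes the kernel parts. With denominators
        cleared, \<open>D\<close> kills the difference of the two numerators, a right multiple of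
        \<open>x\<close>, and \<open>inj\<close> supplies the factor that identifies the
        fractions.\<close>
      have unique: "l = l'"
        if k: "k \<in> a_kernel M M ?D" "k' \<in> a_kernel M M ?D"
          and l: "l \<in> ?R ` carrier M" "l' \<in> ?R ` carrier M"
          and eq: "k \<oplus>\<^bsub>M\<^esub> l = k' \<oplus>\<^bsub>M\<^esub> l'" for k k' l l'
      proof -
        from l obtain G t G' t' where l: "l = lfrac (G * x) t" "t \<in> \<Omega>" and l': "l' = lfrac (G' * x) t'" "t' \<in> \<Omega>"
          by (auto elim!: carrierE simp: R_frac)
        have kc: "k \<in> carrier M" "k' \<in> carrier M" "?D k = \<zero>\<^bsub>M\<^esub>" "?D k' = \<zero>\<^bsub>M\<^esub>"
          using k by (auto simp: a_kernel_def')
        have lc: "l \<in> carrier M" "l' \<in> carrier M" using l l' by (simp_all add: frac_carrier)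
        have "?D l = ?D l'"
          using arg_cong[OF eq, of ?D] kc lc by (simp add: D.hom_add)
        then obtain u where u: "u \<in> \<Omega>"
          "of_central (u * t') * D (G * x) = of_central (u * t) * D (G' * x)"
          using l l' by (auto simp: D_frac frac_eq_iff)
        have "D ((of_central (u * t') * G - of_central (u * t) * G') * x) = 0"
          using u l(2) l'(2) by (simp add: left_diff_distrib mult.assoc D_diff D_linear mult_in)
        from inj[OF this] obtain e where e: "e \<in> \<Omega>"
          "of_central e * (of_central (u * t') * G - of_central (u * t) * G') = 0" by blast
        then have "of_central (e * u * t') * G = of_central (e * u * t) * G'"
          by (simp add: right_diff_distrib act_assoc mult.assoc)
        then have "of_central (e * u * t') * (G * x) = of_central (e * u * t) * (G' * x)"
          by (metis mult.assoc)
        then show "l = l'"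
          unfolding l l' using u e l(2) l'(2)
          by (subst frac_eq_iff) (auto intro!: bexI[of _ "e * u"] mult_in)
      qed
      fix p
      assume p: "p \<in> a_kernel M M ?D \<times> ?R ` carrier M \<and> A = fst p \<oplus>\<^bsub>M\<^esub> snd p"
      then have fst_p: "fst p \<in> a_kernel M M ?D" and snd_p: "snd p \<in> ?R ` carrier M" by auto
      have sum: "fst p \<oplus>\<^bsub>M\<^esub> snd p = ?k \<oplus>\<^bsub>M\<^esub> ?l"
        using p \<open>A = ?k \<oplus>\<^bsub>M\<^esub> ?l\<close> by simp
      have snd_eq: "snd p = ?l"
        by (rule unique[OF fst_p \<open>?k \<in> a_kernel M M ?D\<close> snd_p \<open>?l \<in> ?R ` carrier M\<close> sum])
      have "fst p \<in> carrier M" using fst_p by (simp add: a_kernel_def')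
      then have "fst p = ?k"
        using sum frac_carrier[OF ds] unfolding snd_eq by (simp add: add.right_cancel)
      with snd_eq show "p = (?k, ?l)" by (simp add: prod_eq_iff)
    qed
  qed
qed

lemma loc_extend_mult_right:
  assumes "A \<in> carrier M"
  shows "loc_extend \<Omega> (\<lambda>F. F * x) A = A \<otimes>\<^bsub>M\<^esub> lfrac x 1"
proof -
  from assms obtain F s where A: "A = lfrac F s" and s: "s \<in> \<Omega>" by (elim carrierE)
  have "loc_extend \<Omega> (\<lambda>F. F * x) (lfrac F s) = lfrac (F * x) s"
    by (rule loc_extend_frac) (simp_all add: distrib_right mult.assoc s)
  then show ?thesis by (simp add: A frac_mult s one_in)
qed

end

theorem theorem5p7:
  fixes x :: 'v
  defines "\<Omega> \<equiv> Omega_mon x"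
  defines "M \<equiv> localization \<Omega>"
  shows "internal_direct_sum M
      (a_kernel M M (loc_extend \<Omega> (vector_deriv x)))
      (loc_extend \<Omega> (\<lambda>F. F * var x) ` carrier M) \<and>
    loc_extend \<Omega> (\<lambda>F. F * var x) ` carrier M =
      (\<lambda>X. X \<otimes>\<^bsub>M\<^esub> loc_frac \<Omega> (var x) 1) ` carrier M"
proof -
  interpret central_localization "Omega_mon x"
    by standard (rule Omega_mon_one, rule Omega_mon_mult)
  show ?thesis
    unfolding M_def \<Omega>_def
  proof
    show "internal_direct_sum (localization (Omega_mon x))
      (a_kernel (localization (Omega_mon x)) (localization (Omega_mon x)) (loc_extend (Omega_mon x) (vector_deriv x)))
      (loc_extend (Omega_mon x) (\<lambda>F. F * var x) ` carrier (localization (Omega_mon x)))"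
      by (rule localization_direct_sum)
        (rule vector_deriv_add vector_deriv_Omega vector_deriv_var_surj vector_deriv_var_inj, assumption?)+
    show "loc_extend (Omega_mon x) (\<lambda>F. F * var x) ` carrier (localization (Omega_mon x)) =
      (\<lambda>X. X \<otimes>\<^bsub>localization (Omega_mon x)\<^esub> loc_frac (Omega_mon x) (var x) 1) ` carrier (localization (Omega_mon x))"
      by (rule image_cong[OF refl]) (rule loc_extend_mult_right)
  qed
qed

end
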